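(* Let $n\ge1$, let $q_1,q_2$ be powers of a prime $p$, $q=q_1\otimes q_2$, let $d$ be such that $q=q_1^d$, and let $R=A(n,q_1,q_2)$. When $n\ge 2$, let $a$ be the smallest prime divisor of $n$. (1) If $n=1$, then $R$ is $\sigma$-elementary if and only if $(q_1,q_2)\ne(2,2)$ and $(q_1,q_2)\ne(4,4)$. If $(q_1,q_2)=(2,2)$ then $\sigma(R)=3$; if $(q_1,q_2)=(4,4)$ then $\sigma(R)=4$; otherwise $\sigma(R)=q+1$. (2) If $n\ge 2$ and $d\ge n-(n/a)$, then $R$ is not $\sigma$-elementary, and $\sigma(R)=\sigma(M_n(\mathbb{F}_{q_1}))$. In particular, $R$ is not $\sigma$-elementary when $n=2$.
   Context: Rings are associative and need not have an identity; a subring is an additive subgroup closed under multiplication. A cover of a ring $R$ is a collection of proper subrings whose union is $R$; $\sigma(R)$ is the minimum cardinality of a cover ($\infty$ if none exists). $R$ is $\sigma$-elementary if $\sigma(R)<\sigma(R/I)$ for every nonzero two-sided ideal $I$ of $R$. For powers $q_1=p^{d_1}$, $q_2=p^{d_2}$ of a prime $p$, $q_1\otimes q_2:=p^{\operatorname{lcm}(d_1,d_2)}$; $\mathbb{F}_{q_1},\mathbb{F}_{q_2}$ are subfields of $\mathbb{F}_q$. $A(n,q_1,q_2)$ is the subring of $M_{n+1}(\mathbb{F}_q)$ of all block matrices $\begin{pmatrix} A & v\\ 0 & b\end{pmatrix}$ with $A\in M_n(\mathbb{F}_{q_1})$, $v\in M_{n\times 1}(\mathbb{F}_q)$, $b\in\mathbb{F}_{q_2}$.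 *)

theory Defs
  imports Main "HOL-Library.Extended_Nat" "HOL-Computational_Algebra.Primes"
begin

record 'a rng_struct =
  rcarrier :: "'a set"
  radd :: "'a \<Rightarrow> 'a \<Rightarrow> 'a"
  rmult :: "'a \<Rightarrow> 'a \<Rightarrow> 'a"
  rzero :: 'a
  rneg :: "'a \<Rightarrow> 'a"

definition subrng :: "'a set \<Rightarrow> 'a rng_struct \<Rightarrow> bool" where
  "subrng S R \<longleftrightarrow> S \<subseteq> rcarrier R \<and> rzero R \<in> S \<and>
     (\<forall>x\<in>S. \<forall>y\<in>S. radd R x y \<in> S \<and> rmult R x y \<in> S) \<and>
     (\<forall>x\<in>S. rneg R x \<in> S)"

definition is_cover :: "'a set set \<Rightarrow> 'a rng_struct \<Rightarrow> bool" where
  "is_cover C R \<longleftrightarrow> (\<forall>S\<in>C. subrng S R \<and> S \<noteq> rcarrier R) \<and> \<Union>C = rcarrier R"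

text \<open>Covering number; infinity if there is no (finite) cover.\<close>
definition sigma :: "'a rng_struct \<Rightarrow> enat" where
  "sigma R = (INF C\<in>{C. is_cover C R}. (if finite C then enat (card C) else \<infinity>))"

definition rideal :: "'a set \<Rightarrow> 'a rng_struct \<Rightarrow> bool" where
  "rideal I R \<longleftrightarrow> subrng I R \<and>
     (\<forall>r\<in>rcarrier R. \<forall>x\<in>I. rmult R r x \<in> I \<and> rmult R x r \<in> I)"

definition rcoset :: "'a rng_struct \<Rightarrow> 'a set \<Rightarrow> 'a \<Rightarrow> 'a set" where
  "rcoset R I a = {radd R a i | i. i \<in> I}"

definition rrep :: "'a set \<Rightarrow> 'a" where
  "rrep X = (SOME x. x \<in> X)"

definition rquot :: "'a rng_struct \<Rightarrow> 'a set \<Rightarrow> 'a set rng_struct" where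
  "rquot R I = \<lparr> rcarrier = {rcoset R I a | a. a \<in> rcarrier R},
      radd = (\<lambda>X Y. rcoset R I (radd R (rrep X) (rrep Y))),
      rmult = (\<lambda>X Y. rcoset R I (rmult R (rrep X) (rrep Y))),
      rzero = I,
      rneg = (\<lambda>X. rcoset R I (rneg R (rrep X))) \<rparr>"

definition sigma_elementary :: "'a rng_struct \<Rightarrow> bool" where
  "sigma_elementary R \<longleftrightarrow>
     (\<forall>I. rideal I R \<and> I \<noteq> {rzero R} \<longrightarrow> sigma R < sigma (rquot R I))"

text \<open>Matrices are functions nat => nat => 'k; an m x m matrix vanishes outside indices < m.\<close>
definition mat_rng_on :: "nat \<Rightarrow> (nat \<Rightarrow> nat \<Rightarrow> 'k::field) set \<Rightarrow> (nat \<Rightarrow> nat \<Rightarrow> 'k) rng_struct" where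
  "mat_rng_on m S = \<lparr> rcarrier = S,
      radd = (\<lambda>A B i j. A i j + B i j),
      rmult = (\<lambda>A B i j. \<Sum>k<m. A i k * B k j),
      rzero = (\<lambda>i j. 0),
      rneg = (\<lambda>A i j. - A i j) \<rparr>"

text \<open>The subfield of order q1 of a finite field 'k (of order a power of q1):
  the set of roots of x^q1 - x.\<close>
definition subfield_of_order :: "nat \<Rightarrow> 'k::field set" where
  "subfield_of_order r = {x. x ^ r = x}"

definition full_mat :: "nat \<Rightarrow> nat \<Rightarrow> (nat \<Rightarrow> nat \<Rightarrow> 'k::field) rng_struct" where
  "full_mat n q1 = mat_rng_on n
     {M. (\<forall>i j. (i \<ge> n \<or> j \<ge> n) \<longrightarrow> M i j = 0) \<and>
         (\<forall>i<n. \<forall>j<n. M i j \<in> subfield_of_order q1)}"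

definition A_rng :: "nat \<Rightarrow> nat \<Rightarrow> nat \<Rightarrow> (nat \<Rightarrow> nat \<Rightarrow> 'k::field) rng_struct" where
  "A_rng n q1 q2 = mat_rng_on (n + 1)
     {M. (\<forall>i j. (i > n \<or> j > n) \<longrightarrow> M i j = 0) \<and>
         (\<forall>i<n. \<forall>j<n. M i j \<in> subfield_of_order q1) \<and>
         (\<forall>j<n. M n j = 0) \<and>
         M n n \<in> subfield_of_order q2}"

definition smallest_prime_divisor :: "nat \<Rightarrow> nat" where
  "smallest_prime_divisor n = Min {a. prime a \<and> a dvd n}"

end

theory Submission
  imports Defs "HOL-Library.Function_Algebras" "HOL-Algebra.Multiplicative_Group"
    "HOL-Computational_Algebra.Polynomial"
begin

text \<open>Write \<open>q = q\<^sub>1\<close>, \<open>F\<close> for the subfield of order \<open>q\<close> and \<open>J\<close> for the ideal of matrices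
  \<open>(0, v; 0, 0)\<close>, which is an irreducible bimodule.

  For \<open>n \<ge> 2\<close>, consider a cover of \<open>A(n, q\<^sub>1, q\<^sub>2)\<close> whose proper projections to \<open>M\<^sub>n(F)\<close> miss a matrix
  \<open>A\<close>, and let \<open>b\<close> generate the unit group of the field of order \<open>q\<^sub>2\<close>. A subring of the cover that
  contains some \<open>(A, v; 0, b)\<close> meets \<open>J\<close> trivially, so distinct \<open>v\<close> need distinct subrings, and the
  cover has at least \<open>q\<^bsup>dn\<^esup>\<close> members. Hence it suffices that \<open>M\<^sub>n(F)\<close> has a cover by at most
  \<open>q\<^bsup>n(n - n/a)\<^esup>\<close> proper subrings. Take the stabilizers of the nonzero subspaces \<open>W\<close> with
  \<open>|W|\<^sup>2 \<le> q\<^bsup>n\<^esup>\<close> and the centralizers of the subfields of order \<open>q\<^bsup>a\<^esup>\<close>: if \<open>A\<close> stabilizes no such \<open>W\<close>,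
  then \<open>F[A]\<close> is a field of order \<open>q\<^bsup>n\<^esup>\<close>, and it contains a subfield of order \<open>q\<^bsup>a\<^esup>\<close>.

  For \<open>n = 1\<close>, outside the two exceptional cases some pair \<open>(a, b)\<close> generates the product of the
  two fields. A proper subring containing \<open>(a, v; 0, b)\<close> is then a complement of \<open>J\<close>, which gives the
  lower bound \<open>q + 1\<close>, where \<open>q\<close> is now the order of the large field, and shows that no proper
  quotient has a cover.\<close>

section \<open>Division rings acting on finite groups\<close>

text \<open>The count has no slack: for \<open>n = 2\<close> and \<open>q = 2\<close> the bound on
  the cover of \<open>M_2(F)\<close> is 4, and three stabilizers of lines and one centralizer of a
  field attain it. Hence the care with subfields: a minimal polynomial has neither 0 nor 1 as a
  root, and the first vector of a code is no multiple of the first unit vector. Extension fields of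
  \<open>F\<close> occur as sets of matrices, not as types, so dimensions are read off from
  cardinalities.

  For \<open>n \<ge> 2\<close> the upper bound and the failure to be sigma-elementary have one
  source: \<open>M_n(F)\<close> is the quotient by a nonzero ideal, and covers pull back along
  surjections. For \<open>n = 1\<close> the exceptional orders are those where no pair generates the
  product of the two fields: with order 2 every coordinate is 0 or 1, and with order 4 two elements
  outside the prime field are equal or squares of each other. The product then has a cover with 3 or
  4 members, which pulls back. Otherwise \<open>q + 1\<close> is attained by \<open>q\<close>
  conjugates of the diagonal ring and the ring of matrices with equal diagonal entries.\<close>

definition add_grp :: "'v::ab_group_add set \<Rightarrow> bool" where
  "add_grp S \<longleftrightarrow> 0 \<in> S \<and> (\<forall>x\<in>S. \<forall>y\<in>S. x - y \<in> S)"

lemma add_grpD: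
  assumes "add_grp S"
  shows "0 \<in> S" and "\<And>x y. x \<in> S \<Longrightarrow> y \<in> S \<Longrightarrow> x - y \<in> S"
    and "\<And>x. x \<in> S \<Longrightarrow> - x \<in> S" and "\<And>x y. x \<in> S \<Longrightarrow> y \<in> S \<Longrightarrow> x + y \<in> S"
proof -
  show 0: "0 \<in> S" and d: "\<And>x y. x \<in> S \<Longrightarrow> y \<in> S \<Longrightarrow> x - y \<in> S"
    using assms by (auto simp: add_grp_def)
  show n: "- x \<in> S" if "x \<in> S" for x
    using d[OF 0 that] by simp
  show "x + y \<in> S" if "x \<in> S" "y \<in> S" for x y
    using d[OF that(1) n[OF that(2)]] by simp
qed

lemma add_grpI:
  assumes "0 \<in> S" "\<And>x y. x \<in> S \<Longrightarrow> y \<in> S \<Longrightarrow> x + y \<in> S" "\<And>x. x \<in> S \<Longrightarrow> - x \<in> S"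
  shows "add_grp S"
  unfolding add_grp_def using assms by (metis ab_group_add_class.ab_diff_conv_add_uminus)

lemma add_grp_sum:
  assumes "add_grp S" "\<And>i. i \<in> A \<Longrightarrow> f i \<in> S"
  shows "sum f A \<in> S"
  using assms by (induction A rule: infinite_finite_induct) (auto intro: add_grpD)

text \<open>\<open>D\<close> acts on \<open>U\<close> as a division ring; only the action matters, so \<open>D\<close> carries no ring
  operations of its own.\<close>

locale divop =
  fixes D :: "'d set" and act :: "'d \<Rightarrow> 'v::ab_group_add \<Rightarrow> 'v" and U :: "'v set"
  assumes finite_U: "finite U" and grp_U: "add_grp U"
    and act_U: "f \<in> D \<Longrightarrow> x \<in> U \<Longrightarrow> act f x \<in> U"
    and act_add: "f \<in> D \<Longrightarrow> x \<in> U \<Longrightarrow> y \<in> U \<Longrightarrow> act f (x + y) = act f x + act f y"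
    and act_inv: "f \<in> D \<Longrightarrow> g \<in> D \<Longrightarrow> f \<noteq> g \<Longrightarrow> \<exists>h\<in>D. \<forall>x\<in>U. act h (act f x - act g x) = x"
    and act_diff: "f \<in> D \<Longrightarrow> g \<in> D \<Longrightarrow> \<exists>h\<in>D. \<forall>x\<in>U. act h x = act f x - act g x"
    and act_comp: "f \<in> D \<Longrightarrow> g \<in> D \<Longrightarrow> \<exists>h\<in>D. \<forall>x\<in>U. act h x = act f (act g x)"
    and act_one: "\<exists>e\<in>D. \<forall>x\<in>U. act e x = x"
begin

definition submod :: "'v set \<Rightarrow> bool" where
  "submod S \<longleftrightarrow> S \<subseteq> U \<and> add_grp S \<and> (\<forall>f\<in>D. \<forall>x\<in>S. act f x \<in> S)"

definition extend :: "'v \<Rightarrow> 'v set \<Rightarrow> 'v set" where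
  "extend u S = {s + act f u | s f. s \<in> S \<and> f \<in> D}"

text \<open>Lists rather than sets, because subspaces are later counted through lists that span
  them.\<close>

fun span :: "'v list \<Rightarrow> 'v set" where
  "span [] = {0}"
| "span (u # us) = extend u (span us)"

lemma submod_U: "submod U"
  by (simp add: submod_def grp_U act_U)

lemma act_0: "f \<in> D \<Longrightarrow> act f 0 = 0"
  using act_add[of f 0 0] add_grpD(1)[OF grp_U] by simp

lemma act_zero_op: "\<exists>z\<in>D. \<forall>x\<in>U. act z x = 0"
  using act_one act_diff by (metis cancel_comm_monoid_add_class.diff_cancel)

lemma submod_zero: "submod {0}"
  using act_0 add_grpD(1)[OF grp_U] by (auto simp: submod_def add_grp_def)

lemma submod_extend:
  assumes S: "submod S" and u: "u \<in> U"
  shows "submod (extend u S)" and "S \<subseteq> extend u S" and "u \<in> extend u S"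
proof -
  have SU: "S \<subseteq> U" and gS: "add_grp S" using S by (auto simp: submod_def)
  obtain z where z: "z \<in> D" "\<forall>x\<in>U. act z x = 0" using act_zero_op by blast
  obtain e where e: "e \<in> D" "\<forall>x\<in>U. act e x = x" using act_one by blast
  show sub: "S \<subseteq> extend u S"
  proof
    fix s assume "s \<in> S"
    then have "s = s + act z u" "s \<in> S" "z \<in> D" using z u by auto
    then show "s \<in> extend u S" unfolding extend_def by blast
  qed
  have "u = 0 + act e u" using e u by simp
  then show "u \<in> extend u S" unfolding extend_def using e(1) add_grpD(1)[OF gS] by blast
  show "submod (extend u S)"
    unfolding submod_def
  proof (intro conjI ballI)
    show "extend u S \<subseteq> U"
      using SU u act_U add_grpD(4)[OF grp_U] by (auto simp: extend_def)
    show "add_grp (extend u S)"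
      unfolding add_grp_def
    proof (intro conjI ballI)
      show "0 \<in> extend u S" using sub add_grpD(1)[OF gS] by blast
      fix x y assume "x \<in> extend u S" "y \<in> extend u S"
      then obtain s f t g where *: "x = s + act f u" "y = t + act g u" "s \<in> S" "t \<in> S" "f \<in> D" "g \<in> D"
        by (auto simp: extend_def)
      obtain h where h: "h \<in> D" "\<forall>x\<in>U. act h x = act f x - act g x" using act_diff * by blast
      have "x - y = (s - t) + act h u" using * h u by simp
      then show "x - y \<in> extend u S" using h(1) add_grpD(2)[OF gS *(3,4)] unfolding extend_def by blast
    qed
    fix f x assume f: "f \<in> D" and "x \<in> extend u S"
    then obtain s g where *: "x = s + act g u" "s \<in> S" "g \<in> D" by (auto simp: extend_def)
    obtain h where h: "h \<in> D" "\<forall>x\<in>U. act h x = act f (act g x)" using act_comp f *(3) by blast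
    have "act f x = act f s + act h u" using * h u f SU act_add act_U by auto
    moreover have "act f s \<in> S" using S f *(2) by (auto simp: submod_def)
    ultimately show "act f x \<in> extend u S" using h(1) unfolding extend_def by blast
  qed
qed

text \<open>If \<open>s + act f u = t + act g u\<close> with \<open>f \<noteq> g\<close>, the
  inverse of the difference sends \<open>t - s\<close>, an element of \<open>S\<close>, to
  \<open>u\<close>.\<close>

lemma extend_inj:
  assumes S: "submod S" and u: "u \<in> U" "u \<notin> S"
  shows "inj_on (\<lambda>(s, f). s + act f u) (S \<times> D)"
proof (rule inj_onI, clarify)
  fix s f t g
  assume *: "s \<in> S" "f \<in> D" "t \<in> S" "g \<in> D" "s + act f u = t + act g u"
  have gS: "add_grp S" using S by (simp add: submod_def)
  have "f = g"
  proof (rule ccontr)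
    assume "f \<noteq> g"
    then obtain h where h: "h \<in> D" "\<forall>x\<in>U. act h (act f x - act g x) = x" using act_inv * by blast
    have "act f u - act g u = t - s" using *(5) by (simp add: algebra_simps)
    then have "act h (act f u - act g u) \<in> S"
      using add_grpD(2)[OF gS *(3,1)] S h(1) by (auto simp: submod_def)
    then show False using h u by auto
  qed
  then show "s = t \<and> f = g" using *(5) by simp
qed

lemma extend_image: "extend u S = (\<lambda>(s, f). s + act f u) ` (S \<times> D)"
  by (auto simp: extend_def)

lemma card_extend:
  assumes "submod S" "u \<in> U" "u \<notin> S"
  shows "card (extend u S) = card S * card D"
  unfolding extend_image by (simp add: card_image[OF extend_inj[OF assms]] card_cartesian_product)

lemma extend_least:
  assumes "submod T" "S \<subseteq> T" "u \<in> T"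
  shows "extend u S \<subseteq> T"
  using assms add_grpD(4)[of T] unfolding submod_def extend_def by blast

lemma submod_span: "set us \<subseteq> U \<Longrightarrow> submod (span us)"
  by (induction us) (auto intro: submod_zero submod_extend)

lemma set_subset_span: "set us \<subseteq> U \<Longrightarrow> set us \<subseteq> span us"
proof (induction us)
  case (Cons u us)
  then show ?case using submod_extend(2,3)[OF submod_span[of us], of u] by auto
qed simp

lemma span_least: "submod T \<Longrightarrow> set us \<subseteq> T \<Longrightarrow> span us \<subseteq> T"
  by (induction us) (auto simp: submod_def add_grp_def dest: extend_least[rotated 1, unfolded submod_def])

lemma span_le: "set us \<subseteq> span vs \<Longrightarrow> set vs \<subseteq> U \<Longrightarrow> span us \<subseteq> span vs"
  by (rule span_least[OF submod_span])

text \<open>Greedy choice: a vector outside the current span multiplies its order by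
  \<open>card D\<close>. New vectors go to the front, and the head is nonzero because it lies
  outside the previous span; the shears that count subspaces need a nonzero head.\<close>

lemma submod_basis:
  assumes S: "submod S"
  shows "\<exists>us. set us \<subseteq> S \<and> span us = S \<and> card S = card D ^ length us \<and> (us \<noteq> [] \<longrightarrow> hd us \<noteq> 0)"
proof -
  have finS: "finite S" and SU: "S \<subseteq> U" using S finite_U finite_subset by (auto simp: submod_def)
  have "set us \<subseteq> S \<Longrightarrow> card (span us) = card D ^ length us \<Longrightarrow> (us \<noteq> [] \<longrightarrow> hd us \<noteq> 0) \<Longrightarrow> ?thesis" for us
  proof (induction "card S - card (span us)" arbitrary: us rule: less_induct)
    case less
    have sub: "span us \<subseteq> S" using span_least[OF S less.prems(1)] .
    show ?case
    proof (cases "span us = S")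
      case True then show ?thesis using less.prems by auto
    next
      case False
      then obtain u where u: "u \<in> S" "u \<notin> span us" using sub by blast
      have sm: "submod (span us)" using submod_span less.prems(1) SU by blast
      have u0: "u \<noteq> 0" using u(2) sm by (auto simp: submod_def add_grp_def)
      have uU: "u \<in> U" using u SU by auto
      have "span us \<subset> span (u # us)" using submod_extend[OF sm uU] u(2) by auto
      moreover have "span (u # us) \<subseteq> S" using extend_least[OF S sub u(1)] by simp
      ultimately have "card (span us) < card (span (u # us))" "card (span (u # us)) \<le> card S"
        using finS by (auto intro: psubset_card_mono card_mono finite_subset)
      then have "card S - card (span (u # us)) < card S - card (span us)" by simp
      from less.hyps[OF this] show ?thesis
        using u u0 less.prems card_extend[OF sm uU u(2)] by simp
    qed
  qed
  from this[of "[]"] show ?thesis by simp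
qed

lemma card_submod: "submod S \<Longrightarrow> \<exists>s. card S = card D ^ s"
  using submod_basis by blast

end

section \<open>Subfields of a finite field\<close>

text \<open>The unit group is cyclic of order \<open>N = (r - 1) * t\<close>, so the elements whose
  power with exponent \<open>r - 1\<close> is 1 are the powers of the \<open>t\<close>-th power of a
  generator. Stated for an abstract field because it serves both the ambient field and fields of
  matrices.\<close>

lemma (in field) roots_of_frobenius:
  assumes fin: "finite (carrier R)" and r: "r \<ge> 2" and dvd: "(r - 1) dvd (card (carrier R) - 1)"
  shows "\<exists>g\<in>carrier R. g \<noteq> \<zero> \<and> {x \<in> carrier R. x [^] r = x} = insert \<zero> {g [^] i | i::nat. True} \<and>
    card {x \<in> carrier R. x [^] r = x} = r"
proof -
  interpret G: group "mult_of R" by (rule field_mult_group)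
  have finG: "finite (carrier (mult_of R))" using fin by (rule finite_mult_of)
  have pow: "x [^]\<^bsub>mult_of R\<^esub> (k::nat) = x [^] k" for x k by (simp add: nat_pow_mult_of)
  have one: "\<one>\<^bsub>mult_of R\<^esub> = \<one>" by simp
  obtain c where c: "c \<in> carrier (mult_of R)" "carrier (mult_of R) = {c [^] i | i::nat. True}"
    using finite_field_mult_group_has_gen[OF fin] by auto
  have ordcard: "card {a [^] i | i::nat. True} = G.ord a" if "a \<in> carrier (mult_of R)" for a
  proof -
    have "{a [^] i | i::nat. True} = (\<lambda>x. a [^] x) ` {0..G.ord a - 1}"
      using G.ord_elems[OF finG that] by (auto simp: pow)
    moreover have "inj_on (\<lambda>x. a [^] x) {0..G.ord a - 1}"
      using G.ord_inj[OF that] by (simp add: pow)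
    ultimately show ?thesis using G.ord_ge_1[OF finG that] by (simp add: card_image)
  qed
  define N where "N = card (carrier R) - 1"
  have cardG: "card (carrier (mult_of R)) = N"
    unfolding N_def using fin by (simp add: carrier_mult_of card_Diff_singleton)
  have ordc: "G.ord c = N" using ordcard[OF c(1)] cardG unfolding c(2) by simp
  obtain t where t: "N = (r - 1) * t" using dvd unfolding N_def by (auto elim: dvdE)
  have N0: "N > 0" using G.ord_ge_1[OF finG c(1)] ordc by simp
  have t0: "t > 0" and r1: "r - 1 > 0" using N0 t by auto
  define g where "g = c [^] t"
  have cR: "c \<in> carrier R" using c(1) by (simp add: carrier_mult_of)
  have gG: "g \<in> carrier (mult_of R)" unfolding g_def using c(2) by blast
  have gR: "g \<in> carrier R" "g \<noteq> \<zero>" using gG by (auto simp: carrier_mult_of)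
  have cpow: "c [^] (k::nat) = \<one> \<longleftrightarrow> N dvd k" for k
    using G.pow_eq_id[OF c(1), of k] by (simp add: pow ordc)
  have gpow: "g [^] (k::nat) = \<one> \<longleftrightarrow> (r - 1) dvd k" for k
    unfolding g_def using cpow[of "t * k"] t t0 cR by (simp add: nat_pow_pow mult.commute)
  have "G.ord g = r - 1"
    using G.pow_eq_id[OF gG] gpow by (metis dvd_antisym dvd_refl pow one)
  then have cardg: "card {g [^] i | i::nat. True} = r - 1" using ordcard[OF gG] by simp
  have root: "x [^] r = x \<longleftrightarrow> x [^] (r - 1) = \<one>" if "x \<in> carrier R" "x \<noteq> \<zero>" for x
  proof -
    have "x [^] r = x [^] (r - 1) \<otimes> x" using r by (metis Suc_diff_1 nat_pow_Suc r1 zero_less_diff less_trans zero_less_one)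
    then show ?thesis using that by (metis l_one m_rcancel nat_pow_closed one_closed)
  qed
  have 1: "{x \<in> carrier R. x [^] r = x} = insert \<zero> {g [^] i | i::nat. True}"
  proof (intro equalityI subsetI)
    fix x assume "x \<in> {x \<in> carrier R. x [^] r = x}"
    then have x: "x \<in> carrier R" "x [^] r = x" by auto
    show "x \<in> insert \<zero> {g [^] i | i::nat. True}"
    proof (cases "x = \<zero>")
      case False
      then have "x \<in> carrier (mult_of R)" using x by (simp add: carrier_mult_of)
      then obtain i :: nat where i: "x = c [^] i" using c(2) by blast
      have "c [^] (i * (r - 1)) = \<one>" using root[OF x(1) False] x(2) i cR by (simp add: nat_pow_pow)
      then have "t dvd i" using cpow t r1 by (simp add: mult.commute)
      then obtain j where "i = t * j" by (auto elim: dvdE)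
      then have "x = g [^] j" using i cR by (simp add: g_def nat_pow_pow)
      then show ?thesis by blast
    qed simp
  next
    fix x assume "x \<in> insert \<zero> {g [^] i | i::nat. True}"
    then consider "x = \<zero>" | i :: nat where "x = g [^] i" by blast
    then show "x \<in> {x \<in> carrier R. x [^] r = x}"
    proof cases
      case 1 then show ?thesis using r by (simp add: nat_pow_zero)
    next
      case 2
      have "x \<in> carrier (mult_of R)" using 2 gG G.nat_pow_closed[of g i] by (simp add: pow)
      then have x: "x \<in> carrier R" "x \<noteq> \<zero>" by (auto simp: carrier_mult_of)
      have "x [^] (r - 1) = \<one>" using 2 gpow gR by (simp add: nat_pow_pow)
      then show ?thesis using root x by blast
    qed
  qed
  have nz: "\<zero> \<notin> {g [^] i | i::nat. True}"
  proof
    assume "\<zero> \<in> {g [^] i | i::nat. True}"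
    then obtain i :: nat where "\<zero> = g [^] i" by blast
    moreover have "g [^] i \<in> carrier (mult_of R)" using gG G.nat_pow_closed[of g i] by (simp add: pow)
    ultimately show False by (simp add: carrier_mult_of)
  qed
  have "finite {g [^] i | i::nat. True}" using cardg r1 by (intro card_ge_0_finite) simp
  then have "card (insert \<zero> {g [^] i | i::nat. True}) = r" using nz cardg r by simp
  then show ?thesis using 1 gR by auto
qed

lemma divides_pred_power:
  fixes p :: nat
  assumes "d dvd e"
  shows "p ^ d - 1 dvd p ^ e - 1"
proof -
  obtain k where k: "e = d * k" using assms by (auto elim: dvdE)
  have "x - 1 dvd x ^ k - 1" for x :: nat
  proof (cases "x = 0")
    case False
    show ?thesis
    proof (induction k)
      case (Suc k)
      have "x ^ k \<ge> 1" using False by simp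
      then have "x ^ Suc k - 1 = x * (x ^ k - 1) + (x - 1)" using False
        by (simp add: diff_mult_distrib2)
      then show ?case using Suc by simp
    qed simp
  qed (cases k; simp)
  then show ?thesis by (simp add: k power_mult)
qed

text \<open>Turns the type into a record, so that \<open>roots_of_frobenius\<close> applies to
  it.\<close>

definition univ_ring :: "'k::field ring" where
  "univ_ring = \<lparr>carrier = UNIV, mult = (*), one = 1, zero = 0, add = (+)\<rparr>"

lemma field_univ_ring: "Ring.field univ_ring"
proof -
  interpret cring "univ_ring :: 'k::field ring"
    by (rule cringI; (rule abelian_groupI comm_monoidI)?)
      (auto simp: univ_ring_def algebra_simps intro: exI[of _ "- _"])
  show ?thesis
    by (rule cring_fieldI2) (auto simp: univ_ring_def intro: right_inverse)
qed

lemma univ_ring_pow: "x [^]\<^bsub>univ_ring\<^esub> (k::nat) = x ^ k"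
  by (induction k) (simp_all add: univ_ring_def)

text \<open>The shift by 1 permutes the field, so summing over all elements shows that
  \<open>p ^ e\<close> copies of 1 add up to 0.\<close>

lemma CHAR_finite_field:
  assumes card: "card (UNIV :: 'k::{finite,field} set) = p ^ e" and p: "prime p"
  shows "CHAR('k) = p"
proof -
  have "(\<Sum>x\<in>UNIV. x + 1 :: 'k) = (\<Sum>x\<in>UNIV. x)"
    by (rule sum.reindex_bij_witness[of _ "\<lambda>x. x - 1" "\<lambda>x. x + 1"]) auto
  then have "of_nat (p ^ e) = (0 :: 'k)" by (simp add: sum.distrib card)
  then have d: "CHAR('k) dvd p ^ e" by (simp only: of_nat_eq_0_iff_char_dvd)
  then have "CHAR('k) > 0" using p by (metis dvd_0_left_iff gr0I power_not_zero not_prime_0)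
  then have "prime CHAR('k)" by (rule prime_CHAR_semidom)
  then show ?thesis using d p by (metis prime_dvd_power primes_dvd_imp_eq)
qed

text \<open>Order and cyclicity come from \<open>roots_of_frobenius\<close>, since
  \<open>p ^ d - 1\<close> divides \<open>p ^ e - 1\<close>; closure under sums is additivity of the
  Frobenius power.\<close>

lemma subfield_of_order_props:
  fixes r :: nat
  assumes card: "card (UNIV :: 'k::{finite,field} set) = p ^ e" and p: "prime p"
    and d: "d dvd e" "d \<ge> 1" and r: "r = p ^ d"
  defines "F \<equiv> subfield_of_order r :: 'k set"
  shows "card F = r" and "\<exists>g\<in>F. g \<noteq> 0 \<and> F = insert 0 {g ^ i | i::nat. True}"
    and "\<And>x y. x \<in> F \<Longrightarrow> y \<in> F \<Longrightarrow> x + y \<in> F \<and> x * y \<in> F"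
    and "\<And>x. x \<in> F \<Longrightarrow> - x \<in> F \<and> inverse x \<in> F" and "0 \<in> F" "1 \<in> F" "r \<ge> 2"
proof -
  have "p ^ 1 \<le> p ^ d" using d(2) prime_ge_2_nat[OF p] by (intro power_increasing) auto
  then have r2: "r \<ge> 2" using r prime_ge_2_nat[OF p] by simp
  show "r \<ge> 2" by fact
  interpret field "univ_ring :: 'k ring" by (rule field_univ_ring)
  have "\<exists>g\<in>carrier (univ_ring :: 'k ring). g \<noteq> \<zero>\<^bsub>univ_ring\<^esub> \<and>
     {x \<in> carrier univ_ring. x [^]\<^bsub>univ_ring\<^esub> r = x} = insert \<zero>\<^bsub>univ_ring\<^esub> {g [^]\<^bsub>univ_ring\<^esub> i | i::nat. True} \<and>
    card {x \<in> carrier (univ_ring :: 'k ring). x [^]\<^bsub>univ_ring\<^esub> r = x} = r"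
    by (rule roots_of_frobenius)
      (use r2 card r divides_pred_power[OF d(1)] in \<open>auto simp: univ_ring_def\<close>)
  then obtain g :: 'k where g: "g \<noteq> 0" "F = insert 0 {g ^ i | i::nat. True}" "card F = r"
    unfolding univ_ring_pow by (auto simp: univ_ring_def F_def subfield_of_order_def)
  have "g = g ^ 1" by simp
  then have "g \<in> F" unfolding g(2) by blast
  then show "\<exists>g\<in>F. g \<noteq> 0 \<and> F = insert 0 {g ^ i | i::nat. True}" and "card F = r" using g by auto
  note ch = CHAR_finite_field[OF card p]
  have mem: "x \<in> F \<longleftrightarrow> x ^ r = x" for x by (simp add: F_def subfield_of_order_def)
  have fresh: "(x + y) ^ r = x ^ r + y ^ r" for x y :: 'k
    by (rule freshmans_dream'[of r d]) (use ch p r in simp_all)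
  show "x + y \<in> F \<and> x * y \<in> F" if "x \<in> F" "y \<in> F" for x y
    using that by (simp add: mem fresh power_mult_distrib)
  have 0: "(0 :: 'k) ^ r = 0" using r2 by (simp add: power_0_left)
  then show "0 \<in> F" "1 \<in> F" by (simp_all add: mem)
  show "- x \<in> F \<and> inverse x \<in> F" if "x \<in> F" for x
  proof -
    \<comment> \<open>Additivity yields negatives without distinguishing the parity of
      \<open>r\<close>.\<close>
    have "x ^ r + (- x) ^ r = 0" using fresh[of x "- x"] 0 by simp
    then have "(- x) ^ r = - x" using that by (simp add: mem add_eq_0_iff)
    moreover have "inverse x ^ r = inverse x" using that by (simp only: mem power_inverse)
    ultimately show ?thesis by (simp only: mem)
  qed
qed

section \<open>Matrices over a subfield\<close>

text \<open>Only the inner index is bounded. Associativity and distributivity therefore hold for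
  arbitrary functions, with no membership conditions.\<close>

definition mm :: "nat \<Rightarrow> (nat \<Rightarrow> nat \<Rightarrow> 'k::field) \<Rightarrow> (nat \<Rightarrow> nat \<Rightarrow> 'k) \<Rightarrow> nat \<Rightarrow> nat \<Rightarrow> 'k" where
  "mm n A B = (\<lambda>i j. \<Sum>k<n. A i k * B k j)"

definition mv :: "nat \<Rightarrow> (nat \<Rightarrow> nat \<Rightarrow> 'k::field) \<Rightarrow> (nat \<Rightarrow> 'k) \<Rightarrow> nat \<Rightarrow> 'k" where
  "mv n A v = (\<lambda>i. \<Sum>k<n. A i k * v k)"

definition idm :: "nat \<Rightarrow> nat \<Rightarrow> nat \<Rightarrow> 'k::field" where
  "idm n = (\<lambda>i j. if i = j \<and> i < n then 1 else 0)"

definition svec :: "'k::field \<Rightarrow> (nat \<Rightarrow> 'k) \<Rightarrow> nat \<Rightarrow> 'k" where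
  "svec c v = (\<lambda>i. c * v i)"

definition smat :: "'k::field \<Rightarrow> (nat \<Rightarrow> nat \<Rightarrow> 'k) \<Rightarrow> nat \<Rightarrow> nat \<Rightarrow> 'k" where
  "smat c A = (\<lambda>i j. c * A i j)"

definition unitv :: "nat \<Rightarrow> nat \<Rightarrow> 'k::field" where
  "unitv i = (\<lambda>j. if j = i then 1 else 0)"

definition unitm :: "nat \<Rightarrow> nat \<Rightarrow> nat \<Rightarrow> nat \<Rightarrow> 'k::field" where
  "unitm i j = (\<lambda>r s. if r = i \<and> s = j then 1 else 0)"

fun mpow :: "nat \<Rightarrow> (nat \<Rightarrow> nat \<Rightarrow> 'k::field) \<Rightarrow> nat \<Rightarrow> nat \<Rightarrow> nat \<Rightarrow> 'k" where
  "mpow n A 0 = idm n"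
| "mpow n A (Suc k) = mm n A (mpow n A k)"

lemma sum_fun_apply: "(\<Sum>x\<in>A. f x) i = (\<Sum>x\<in>A. f x i)"
  by (induction A rule: infinite_finite_induct) auto

lemma mm_add_left: "mm n (A + B) C = mm n A C + mm n B C"
  by (simp add: mm_def fun_eq_iff algebra_simps sum.distrib)
lemma mm_add_right: "mm n A (B + C) = mm n A B + mm n A C"
  by (simp add: mm_def fun_eq_iff algebra_simps sum.distrib)
lemma mm_diff_left: "mm n (A - B) C = mm n A C - mm n B C"
  by (simp add: mm_def fun_eq_iff algebra_simps sum_subtractf)
lemma mm_diff_right: "mm n A (B - C) = mm n A B - mm n A C"
  by (simp add: mm_def fun_eq_iff algebra_simps sum_subtractf)
lemma mm_zero [simp]: "mm n 0 A = 0" "mm n A 0 = 0"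
  by (simp_all add: mm_def fun_eq_iff)
lemma mm_assoc: "mm n (mm n A B) C = mm n A (mm n B C)"
proof (intro ext)
  fix i j
  have "mm n (mm n A B) C i j = (\<Sum>k<n. \<Sum>l<n. A i l * B l k * C k j)"
    by (simp add: mm_def sum_distrib_right)
  also have "\<dots> = (\<Sum>l<n. \<Sum>k<n. A i l * B l k * C k j)" by (rule sum.swap)
  also have "\<dots> = mm n A (mm n B C) i j" by (simp add: mm_def sum_distrib_left mult.assoc)
  finally show "mm n (mm n A B) C i j = mm n A (mm n B C) i j" .
qed
lemma mv_mm: "mv n (mm n A B) v = mv n A (mv n B v)"
proof (intro ext)
  fix i
  have "mv n (mm n A B) v i = (\<Sum>k<n. \<Sum>l<n. A i l * B l k * v k)"
    by (simp add: mm_def mv_def sum_distrib_right)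
  also have "\<dots> = (\<Sum>l<n. \<Sum>k<n. A i l * B l k * v k)" by (rule sum.swap)
  also have "\<dots> = mv n A (mv n B v) i" by (simp add: mv_def sum_distrib_left mult.assoc)
  finally show "mv n (mm n A B) v i = mv n A (mv n B v) i" .
qed
lemma mv_add_left: "mv n (A + B) v = mv n A v + mv n B v"
  by (simp add: mv_def fun_eq_iff algebra_simps sum.distrib)
lemma mv_diff_left: "mv n (A - B) v = mv n A v - mv n B v"
  by (simp add: mv_def fun_eq_iff algebra_simps sum_subtractf)
lemma mv_add: "mv n A (v + w) = mv n A v + mv n A w"
  by (simp add: mv_def fun_eq_iff algebra_simps sum.distrib)
lemma mv_diff: "mv n A (v - w) = mv n A v - mv n A w"
  by (simp add: mv_def fun_eq_iff algebra_simps sum_subtractf)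
lemma mv_zero [simp]: "mv n 0 v = 0" "mv n A 0 = 0"
  by (simp_all add: mv_def fun_eq_iff)
lemma mv_smat: "mv n (smat c A) v = svec c (mv n A v)"
  by (simp add: mv_def smat_def svec_def sum_distrib_left mult.assoc)
lemma mv_svec: "mv n A (svec c v) = svec c (mv n A v)"
  by (simp add: mv_def svec_def sum_distrib_left mult.assoc mult.left_commute)
lemma mm_smat_left: "mm n (smat c A) B = smat c (mm n A B)"
  by (simp add: mm_def smat_def sum_distrib_left mult.assoc)
lemma mm_smat_right: "mm n A (smat c B) = smat c (mm n A B)"
  by (simp add: mm_def smat_def sum_distrib_left mult.left_commute mult.assoc)
lemma smat_smat: "smat a (smat b A) = smat (a * b) A"
  by (simp add: smat_def mult.assoc)
lemma smat_add: "smat a (A + B) = smat a A + smat a B" "smat (a + b) A = smat a A + smat b A"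
  by (simp_all add: smat_def fun_eq_iff algebra_simps)
lemma smat_diff: "smat a (A - B) = smat a A - smat a B" "smat (a - b) A = smat a A - smat b A"
  by (simp_all add: smat_def fun_eq_iff algebra_simps)
lemma smat_simps [simp]: "smat 0 A = 0" "smat c 0 = 0" "smat 1 A = A"
  by (simp_all add: smat_def fun_eq_iff)
lemma svec_svec: "svec a (svec b A) = svec (a * b) A"
  by (simp add: svec_def mult.assoc)
lemma svec_add: "svec a (v + w) = svec a v + svec a w" "svec (a + b) v = svec a v + svec b v"
  by (simp_all add: svec_def fun_eq_iff algebra_simps)
lemma svec_diff: "svec a (v - w) = svec a v - svec a w" "svec (a - b) v = svec a v - svec b v"
  by (simp_all add: svec_def fun_eq_iff algebra_simps)
lemma svec_simps [simp]: "svec 0 v = 0" "svec c 0 = 0" "svec 1 v = v"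
  by (simp_all add: svec_def fun_eq_iff)
lemma svec_eq_0_iff [simp]: "svec c v = 0 \<longleftrightarrow> c = 0 \<or> v = 0"
  by (auto simp: svec_def fun_eq_iff)

lemma mm_sum_left: "mm n (sum f A) B = (\<Sum>x\<in>A. mm n (f x) B)"
  by (induction A rule: infinite_finite_induct)
    (simp_all only: sum.infinite sum.empty sum.insert not_False_eq_True mm_add_left mm_zero)
lemma mm_sum_right: "mm n B (sum f A) = (\<Sum>x\<in>A. mm n B (f x))"
  by (induction A rule: infinite_finite_induct)
    (simp_all only: sum.infinite sum.empty sum.insert not_False_eq_True mm_add_right mm_zero)
lemma mv_sum_left: "mv n (sum f A) v = (\<Sum>x\<in>A. mv n (f x) v)"
  by (induction A rule: infinite_finite_induct)
    (simp_all only: sum.infinite sum.empty sum.insert not_False_eq_True mv_add_left mv_zero)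
lemma smat_sum: "smat c (sum f A) = (\<Sum>x\<in>A. smat c (f x))"
  by (induction A rule: infinite_finite_induct)
    (simp_all only: sum.infinite sum.empty sum.insert not_False_eq_True smat_add smat_simps)

locale fsub =
  fixes F :: "'k::{finite,field} set" and q :: nat
  assumes F_add: "x \<in> F \<Longrightarrow> y \<in> F \<Longrightarrow> x + y \<in> F" and F_mult: "x \<in> F \<Longrightarrow> y \<in> F \<Longrightarrow> x * y \<in> F"
    and F_minus: "x \<in> F \<Longrightarrow> - x \<in> F" and F_inverse: "x \<in> F \<Longrightarrow> inverse x \<in> F"
    and F_0 [simp]: "0 \<in> F" and F_1 [simp]: "1 \<in> F" and card_F: "card F = q"
begin

lemma F_diff: "x \<in> F \<Longrightarrow> y \<in> F \<Longrightarrow> x - y \<in> F"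
  using F_add[of x "- y"] F_minus by simp

lemma F_sum: "(\<And>i. i \<in> A \<Longrightarrow> f i \<in> F) \<Longrightarrow> sum f A \<in> F"
  by (induction A rule: infinite_finite_induct) (auto intro: F_add)

lemma q_ge_2: "q \<ge> 2"
proof -
  have "card {0, 1 :: 'k} \<le> card F" by (intro card_mono) auto
  then show ?thesis using card_F by simp
qed

end

locale fmat = fsub F q for F :: "'k::{finite,field} set" and q + fixes n :: nat
  assumes n_ge_1: "n \<ge> 1"
begin

definition V :: "(nat \<Rightarrow> 'k) set" where
  "V = {v. (\<forall>i. v i \<in> F) \<and> (\<forall>i\<ge>n. v i = 0)}"

definition M :: "(nat \<Rightarrow> nat \<Rightarrow> 'k) set" where
  "M = {A. (\<forall>i j. A i j \<in> F) \<and> (\<forall>i j. i \<ge> n \<or> j \<ge> n \<longrightarrow> A i j = 0)}"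

lemma bij_V: "bij_betw (\<lambda>v. restrict v {..<n}) V (PiE {..<n} (\<lambda>_. F))"
proof (rule bij_betwI[where g = "\<lambda>f i. if i < n then f i else 0"])
  show "(\<lambda>v. restrict v {..<n}) \<in> V \<rightarrow> PiE {..<n} (\<lambda>_. F)" by (auto simp: V_def)
  show "(\<lambda>f i. if i < n then f i else 0) \<in> (PiE {..<n} (\<lambda>_. F)) \<rightarrow> V"
    by (auto simp: V_def PiE_def Pi_def)
qed (auto simp: V_def fun_eq_iff PiE_def extensional_def)

lemma finite_V: "finite V"
  using bij_betw_finite[OF bij_V] by (simp add: finite_PiE)

lemma card_V: "card V = q ^ n"
  using bij_betw_same_card[OF bij_V] by (simp add: card_PiE card_F)

lemma finite_M: "finite M"
proof (rule inj_on_finite)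
  show "inj_on (\<lambda>A. restrict (\<lambda>j i. A i j) {..<n}) M"
  proof (rule inj_onI)
    fix A B assume *: "A \<in> M" "B \<in> M" "restrict (\<lambda>j i. A i j) {..<n} = restrict (\<lambda>j i. B i j) {..<n}"
    have "A i j = B i j" for i j
    proof (cases "j < n")
      case True
      then have "(\<lambda>i. A i j) = (\<lambda>i. B i j)" using fun_cong[OF *(3), of j] by simp
      then show ?thesis by (rule fun_cong)
    qed (use * in \<open>simp add: M_def\<close>)
    then show "A = B" by (intro ext)
  qed
  show "(\<lambda>A. restrict (\<lambda>j i. A i j) {..<n}) ` M \<subseteq> PiE {..<n} (\<lambda>_. V)"
    by (auto simp: M_def V_def)
  show "finite (PiE {..<n} (\<lambda>_. V))" using finite_V by (simp add: finite_PiE)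
qed

lemma grp_V: "add_grp V" and grp_M: "add_grp M"
  by (auto simp: add_grp_def V_def M_def F_diff)

lemma mv_V: "A \<in> M \<Longrightarrow> v \<in> V \<Longrightarrow> mv n A v \<in> V"
  by (auto simp: M_def V_def mv_def intro!: F_sum F_mult)

lemma mm_M: "A \<in> M \<Longrightarrow> B \<in> M \<Longrightarrow> mm n A B \<in> M"
  by (auto simp: M_def mm_def intro!: F_sum F_mult)

lemma idm_M: "idm n \<in> M" by (auto simp: M_def idm_def)
lemma smat_M: "c \<in> F \<Longrightarrow> A \<in> M \<Longrightarrow> smat c A \<in> M" by (auto simp: M_def smat_def F_mult)
lemma svec_V: "c \<in> F \<Longrightarrow> v \<in> V \<Longrightarrow> svec c v \<in> V" by (auto simp: V_def svec_def F_mult)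
lemma unitv_V: "i < n \<Longrightarrow> unitv i \<in> V" by (auto simp: V_def unitv_def)
lemma unitm_M: "i < n \<Longrightarrow> j < n \<Longrightarrow> unitm i j \<in> M" by (auto simp: M_def unitm_def)
lemma mpow_M: "A \<in> M \<Longrightarrow> mpow n A k \<in> M" by (induction k) (auto intro: idm_M mm_M)

lemma sum_idm: "(\<Sum>k<n. idm n i k * f k) = (if i < n then f i else 0)"
    "(\<Sum>k<n. f k * idm n k i) = (if i < n then f i else 0)"
  by (simp_all add: idm_def if_distrib[of "\<lambda>x. x * _"] if_distrib[of "(*) _"] cong: if_cong)

lemma mm_idm: "A \<in> M \<Longrightarrow> mm n (idm n) A = A" "A \<in> M \<Longrightarrow> mm n A (idm n) = A"
  by (auto simp: M_def mm_def fun_eq_iff sum_idm)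

lemma mv_idm: "v \<in> V \<Longrightarrow> mv n (idm n) v = v"
  by (auto simp: V_def mv_def fun_eq_iff sum_idm)

lemma mv_unitv: "j < n \<Longrightarrow> mv n A (unitv j) = (\<lambda>i. A i j)"
  by (simp add: mv_def unitv_def fun_eq_iff if_distrib[of "(*) _"] cong: if_cong)

lemma mat_eqI:
  assumes "A \<in> M" "B \<in> M" "\<And>j. j < n \<Longrightarrow> mv n A (unitv j) = mv n B (unitv j)"
  shows "A = B"
proof (intro ext)
  fix i j show "A i j = B i j"
  proof (cases "j < n")
    case True
    then have "(\<lambda>i. A i j) = (\<lambda>i. B i j)" using assms(3)[of j] by (simp add: mv_unitv)
    then show ?thesis by (rule fun_cong)
  qed (use assms in \<open>simp add: M_def\<close>)
qed

lemma idm_neq_0: "(idm n :: nat \<Rightarrow> nat \<Rightarrow> 'k) \<noteq> 0"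
proof
  assume "idm n = (0 :: nat \<Rightarrow> nat \<Rightarrow> 'k)"
  from fun_cong[OF fun_cong[OF this, of 0], of 0] show False using n_ge_1 by (simp add: idm_def)
qed

lemma divop_F_V: "divop F svec V"
proof
  show "\<exists>h\<in>F. \<forall>x\<in>V. svec h (svec f x - svec g x) = x" if "f \<in> F" "g \<in> F" "f \<noteq> g" for f g
  proof (intro bexI ballI)
    show "svec (inverse (f - g)) (svec f x - svec g x) = x" for x
      using that by (simp add: svec_diff(2)[symmetric] svec_svec)
  qed (use that in \<open>simp add: F_inverse F_diff\<close>)
  show "\<exists>h\<in>F. \<forall>x\<in>V. svec h x = svec f x - svec g x" if "f \<in> F" "g \<in> F" for f g
    using that by (metis F_diff svec_diff(2))
  show "\<exists>h\<in>F. \<forall>x\<in>V. svec h x = svec f (svec g x)" if "f \<in> F" "g \<in> F" for f g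
    using that by (metis F_mult svec_svec)
  show "\<exists>e\<in>F. \<forall>x\<in>V. svec e x = x" using F_1 svec_simps(3) by blast
qed (auto simp: finite_V grp_V svec_V svec_add)

definition is_field :: "(nat \<Rightarrow> nat \<Rightarrow> 'k) set \<Rightarrow> bool" where
  "is_field K \<longleftrightarrow> K \<subseteq> M \<and> add_grp K \<and> (\<forall>c\<in>F. smat c (idm n) \<in> K) \<and>
     (\<forall>A\<in>K. \<forall>B\<in>K. mm n A B \<in> K \<and> mm n A B = mm n B A) \<and>
     (\<forall>A\<in>K. A \<noteq> 0 \<longrightarrow> (\<exists>B\<in>K. mm n B A = idm n))"

lemma is_fieldD:
  assumes "is_field K"
  shows "K \<subseteq> M" "add_grp K" "\<And>c. c \<in> F \<Longrightarrow> smat c (idm n) \<in> K" "idm n \<in> K"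
    "\<And>A B. A \<in> K \<Longrightarrow> B \<in> K \<Longrightarrow> mm n A B \<in> K" "\<And>A B. A \<in> K \<Longrightarrow> B \<in> K \<Longrightarrow> mm n A B = mm n B A"
    "\<And>A. A \<in> K \<Longrightarrow> A \<noteq> 0 \<Longrightarrow> \<exists>B\<in>K. mm n B A = idm n" "finite K"
    "\<And>c A. c \<in> F \<Longrightarrow> A \<in> K \<Longrightarrow> smat c A \<in> K"
proof -
  show sM: "K \<subseteq> M" and "add_grp K" and sc: "\<And>c. c \<in> F \<Longrightarrow> smat c (idm n) \<in> K"
    and mu: "\<And>A B. A \<in> K \<Longrightarrow> B \<in> K \<Longrightarrow> mm n A B \<in> K" and "\<And>A B. A \<in> K \<Longrightarrow> B \<in> K \<Longrightarrow> mm n A B = mm n B A"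
    and "\<And>A. A \<in> K \<Longrightarrow> A \<noteq> 0 \<Longrightarrow> \<exists>B\<in>K. mm n B A = idm n"
    using assms by (auto simp: is_field_def)
  show "idm n \<in> K" using sc[of 1] by simp
  show "finite K" using sM finite_M finite_subset by blast
  show "smat c A \<in> K" if "c \<in> F" "A \<in> K" for c A
    using mu[OF sc[OF that(1)] that(2)] that sM by (simp add: mm_smat_left mm_idm subset_eq)
qed

text \<open>Injectivity of multiplication on a finite commutative ring already yields inverses.\<close>

lemma is_fieldI:
  assumes "K \<subseteq> M" "add_grp K" "\<And>c. c \<in> F \<Longrightarrow> smat c (idm n) \<in> K"
    "\<And>A B. A \<in> K \<Longrightarrow> B \<in> K \<Longrightarrow> mm n A B \<in> K" "\<And>A B. A \<in> K \<Longrightarrow> B \<in> K \<Longrightarrow> mm n A B = mm n B A"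
    and dom: "\<And>A B. A \<in> K \<Longrightarrow> B \<in> K \<Longrightarrow> mm n B A = 0 \<Longrightarrow> A \<noteq> 0 \<Longrightarrow> B = 0"
  shows "is_field K"
proof -
  have fin: "finite K" using assms(1) finite_M finite_subset by blast
  have one: "idm n \<in> K" using assms(3)[of 1] by simp
  have "\<exists>B\<in>K. mm n B A = idm n" if A: "A \<in> K" "A \<noteq> 0" for A
  proof -
    have "inj_on (\<lambda>B. mm n B A) K"
    proof (rule inj_onI)
      fix B C assume "B \<in> K" "C \<in> K" "mm n B A = mm n C A"
      then have "mm n (B - C) A = 0" "B - C \<in> K" using assms(2) by (auto simp: mm_diff_left add_grp_def)
      from dom[OF A(1) this(2,1) A(2)] show "B = C" by simp
    qed
    then have "(\<lambda>B. mm n B A) ` K = K"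
      by (rule endo_inj_surj[OF fin, rotated]) (use A assms(4) in auto)
    then show ?thesis using one by force
  qed
  then show ?thesis using assms unfolding is_field_def by blast
qed

text \<open>Makes the column space a vector space over a field of matrices, which relates
  \<open>card K\<close> to \<open>q ^ n\<close>.\<close>

lemma divop_mv:
  assumes K: "is_field K"
  shows "divop K (mv n) V"
proof
  note KD = is_fieldD[OF K]
  show "\<exists>h\<in>K. \<forall>x\<in>V. mv n h (mv n f x - mv n g x) = x" if "f \<in> K" "g \<in> K" "f \<noteq> g" for f g
  proof -
    have "f - g \<in> K" "f - g \<noteq> 0" using that add_grpD(2)[OF KD(2)] by auto
    then obtain h where "h \<in> K" "mm n h (f - g) = idm n" using KD(7) by blast
    then show ?thesis by (metis mv_diff_left mv_mm mv_idm)
  qed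
  show "\<exists>h\<in>K. \<forall>x\<in>V. mv n h x = mv n f x - mv n g x" if "f \<in> K" "g \<in> K" for f g
    using that add_grpD(2)[OF KD(2)] by (metis mv_diff_left)
  show "\<exists>h\<in>K. \<forall>x\<in>V. mv n h x = mv n f (mv n g x)" if "f \<in> K" "g \<in> K" for f g
    using that KD(5) by (metis mv_mm)
  show "\<exists>e\<in>K. \<forall>x\<in>V. mv n e x = x" using KD(4) mv_idm by blast
  show "mv n f x \<in> V" if "f \<in> K" "x \<in> V" for f x using that KD(1) mv_V by blast
qed (auto simp: finite_V grp_V mv_add)

text \<open>Serves as the tower law: the order of \<open>L\<close> is a power of the order of
  \<open>K\<close>.\<close>

lemma divop_mm:
  assumes K: "is_field K" and L: "is_field L" "K \<subseteq> L"
  shows "divop K (mm n) L"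
proof
  note KD = is_fieldD[OF K] and LD = is_fieldD[OF L(1)]
  show "\<exists>h\<in>K. \<forall>x\<in>L. mm n h (mm n f x - mm n g x) = x" if "f \<in> K" "g \<in> K" "f \<noteq> g" for f g
  proof -
    have "f - g \<in> K" "f - g \<noteq> 0" using that add_grpD(2)[OF KD(2)] by auto
    then obtain h where "h \<in> K" "mm n h (f - g) = idm n" using KD(7) by blast
    then show ?thesis by (metis LD(1) mm_assoc mm_diff_left mm_idm(1) subsetD)
  qed
  show "\<exists>h\<in>K. \<forall>x\<in>L. mm n h x = mm n f x - mm n g x" if "f \<in> K" "g \<in> K" for f g
    using that add_grpD(2)[OF KD(2)] by (metis mm_diff_left)
  show "\<exists>h\<in>K. \<forall>x\<in>L. mm n h x = mm n f (mm n g x)" if "f \<in> K" "g \<in> K" for f g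
    using that KD(5) by (metis mm_assoc)
  show "\<exists>e\<in>K. \<forall>x\<in>L. mm n e x = x" using KD(4) LD(1) mm_idm(1) by blast
  show "mm n f x \<in> L" if "f \<in> K" "x \<in> L" for f x using that LD(5) L(2) by blast
  show "finite L" "add_grp L" using LD by auto
qed (auto simp: mm_add_right)

end

section \<open>Matrices without small invariant subspaces\<close>

text \<open>Each fibre over the image is a translate of the kernel.\<close>

lemma card_ker_im:
  fixes h :: "'v::ab_group_add \<Rightarrow> 'w::ab_group_add"
  assumes fin: "finite V" and grp: "add_grp V"
    and h: "\<And>x y. x \<in> V \<Longrightarrow> y \<in> V \<Longrightarrow> h (x - y) = h x - h y"
  shows "card V = card {x \<in> V. h x = 0} * card (h ` V)"
proof -
  have "card {x \<in> V. h x = y} = card {x \<in> V. h x = 0}" if y: "y \<in> h ` V" for y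
  proof -
    obtain v where v: "v \<in> V" "y = h v" using y by blast
    have "h (x + v) = h x + h v" if "x \<in> V" for x
      using h[OF add_grpD(4)[OF grp that v(1)] v(1)] by (simp add: algebra_simps)
    then have "bij_betw (\<lambda>x. x + v) {x \<in> V. h x = 0} {x \<in> V. h x = y}"
      by (intro bij_betwI[where g = "\<lambda>x. x - v"]) (use v h add_grpD[OF grp] in auto)
    then show ?thesis by (simp add: bij_betw_same_card)
  qed
  then have "card (\<Union>y\<in>h ` V. {x \<in> V. h x = y}) = (\<Sum>y\<in>h ` V. card {x \<in> V. h x = 0})"
    using fin by (subst card_UN_disjoint) auto
  moreover have "(\<Union>y\<in>h ` V. {x \<in> V. h x = y}) = V" by blast
  ultimately show ?thesis by simp
qed

text \<open>Horner's scheme. Polynomials are taken over the whole ambient field, and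
  \<open>PF\<close> cuts out those over \<open>F\<close>: they form a type whose multiplication
  obeys the Frobenius law, whereas matrix multiplication belongs to no type.\<close>

definition pev :: "nat \<Rightarrow> (nat \<Rightarrow> nat \<Rightarrow> 'k::field) \<Rightarrow> 'k poly \<Rightarrow> nat \<Rightarrow> nat \<Rightarrow> 'k" where
  "pev n A P = fold_coeffs (\<lambda>c X. smat c (idm n) + mm n A X) P 0"

lemma pev_0 [simp]: "pev n A 0 = 0"
  by (simp add: pev_def)

lemma pev_pCons: "pev n A (pCons c P) = smat c (idm n) + mm n A (pev n A P)"
  by (cases "c = 0 \<and> P = 0") (auto simp: pev_def)

lemma pev_add: "pev n A (P + Q) = pev n A P + pev n A Q"
  by (induction P Q rule: poly_induct2)
    (simp_all only: pev_0 pev_pCons add_pCons smat_add mm_add_right add_ac add_0_left)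

lemma pev_smult: "pev n A (smult c P) = smat c (pev n A P)"
  by (induction P) (simp_all only: smult_0_right pev_0 smat_simps smult_pCons pev_pCons smat_add smat_smat mm_smat_right)

lemma pev_diff: "pev n A (P - Q) = pev n A P - pev n A Q"
proof -
  have "pev n A ((P - Q) + Q) = pev n A (P - Q) + pev n A Q" by (rule pev_add)
  then show ?thesis by simp
qed

context fmat
begin

interpretation FV: divop F svec V by (rule divop_F_V)

definition PF :: "'k poly set" where
  "PF = {P. \<forall>i. coeff P i \<in> F}"

lemma PF_pCons: "pCons c P \<in> PF \<longleftrightarrow> c \<in> F \<and> P \<in> PF"
  by (auto simp: PF_def coeff_pCons split: nat.splits)

lemma PF_diff: "P \<in> PF \<Longrightarrow> Q \<in> PF \<Longrightarrow> P - Q \<in> PF"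
  by (simp add: PF_def F_diff)

lemma PF_mult: "P \<in> PF \<Longrightarrow> Q \<in> PF \<Longrightarrow> P * Q \<in> PF"
  by (auto simp: PF_def coeff_mult intro!: F_sum F_mult)

lemma PF_const: "[:c:] \<in> PF \<longleftrightarrow> c \<in> F" "0 \<in> PF" "1 \<in> PF"
  by (simp_all add: PF_def coeff_pCons one_pCons split: nat.splits)

lemma PF_power: "P \<in> PF \<Longrightarrow> P ^ k \<in> PF"
  by (induction k) (auto intro: PF_mult PF_const)

lemma pev_M: "A \<in> M \<Longrightarrow> P \<in> PF \<Longrightarrow> pev n A P \<in> M"
proof (induction P)
  case 0 show ?case using add_grpD(1)[OF grp_M] by (simp only: pev_0)
next
  case (pCons c P)
  then show ?case by (metis pev_pCons PF_pCons add_grpD(4)[OF grp_M] smat_M idm_M mm_M)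
qed

lemma pev_mult: "A \<in> M \<Longrightarrow> P \<in> PF \<Longrightarrow> Q \<in> PF \<Longrightarrow> pev n A (P * Q) = mm n (pev n A P) (pev n A Q)"
proof (induction P)
  case (pCons c P)
  have Q: "pev n A Q \<in> M" using pCons.prems pev_M by blast
  have "pev n A (pCons c P * Q) = smat c (pev n A Q) + mm n A (pev n A (P * Q))"
    by (simp only: mult_pCons_left pev_add pev_smult pev_pCons smat_simps add_0_left)
  also have "\<dots> = mm n (pev n A (pCons c P)) (pev n A Q)"
    using pCons Q by (simp only: PF_pCons pev_pCons mm_add_left mm_smat_left mm_idm mm_assoc)
  finally show ?case .
qed (simp only: mult_zero_left pev_0 mm_zero)

lemma pev_const: "pev n A [:c:] = smat c (idm n)" "pev n A 1 = idm n"
  by (simp_all only: one_pCons pev_pCons pev_0 mm_zero add_0_right smat_simps)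

lemma pev_X: "A \<in> M \<Longrightarrow> pev n A [:0, 1:] = A"
  by (simp only: pev_pCons pev_0 mm_zero add_0_right add_0_left smat_simps mm_idm)

text \<open>If a matrix has no invariant subspace in \<open>small_mods\<close>, then each nonzero operator commuting with
  it is injective: kernel and image are invariant and their cardinalities multiply to \<open>q ^ n\<close>.\<close>

definition small_mods :: "(nat \<Rightarrow> 'k) set set" where
  "small_mods = {W. FV.submod W \<and> W \<noteq> {0} \<and> card W ^ 2 \<le> q ^ n}"

section \<open>The algebra generated by a matrix without small invariant subspaces\<close>

context
  fixes A :: "nat \<Rightarrow> nat \<Rightarrow> 'k"
  assumes A: "A \<in> M" and irr: "\<And>W. W \<in> small_mods \<Longrightarrow> \<exists>w\<in>W. mv n A w \<notin> W"
begin

lemma commuting_inj: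
  assumes f: "f \<in> M" "mm n f A = mm n A f" "f \<noteq> 0" and v: "v \<in> V" "mv n f v = 0"
  shows "v = 0"
proof (rule ccontr)
  assume v0: "v \<noteq> 0"
  let ?K = "{x \<in> V. mv n f x = 0}" and ?I = "mv n f ` V"
  have comm: "mv n f (mv n A x) = mv n A (mv n f x)" for x
    by (metis f(2) mv_mm)
  have "card V = card ?K * card ?I"
    by (rule card_ker_im) (auto simp: finite_V grp_V mv_diff)
  then have prod: "card ?K * card ?I = q ^ n" by (simp add: card_V)
  have K: "FV.submod ?K"
    using add_grpD[OF grp_V] by (auto simp: FV.submod_def add_grp_def mv_diff svec_V mv_svec)
  have I: "FV.submod ?I"
    unfolding FV.submod_def add_grp_def
  proof (intro conjI ballI)
    show "?I \<subseteq> V" using mv_V f by blast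
    show "0 \<in> ?I" using add_grpD(1)[OF grp_V] by (metis imageI mv_zero(2))
    show "x - y \<in> ?I" if "x \<in> ?I" "y \<in> ?I" for x y
      using that add_grpD(2)[OF grp_V] by (auto simp: mv_diff[symmetric])
    show "svec c x \<in> ?I" if "c \<in> F" "x \<in> ?I" for c x
      using that svec_V by (auto simp: mv_svec[symmetric])
  qed
  have K0: "?K \<noteq> {0}" using v v0 by blast
  have "\<exists>j<n. mv n f (unitv j) \<noteq> 0"
  proof (rule ccontr)
    assume "\<not> ?thesis"
    then have "f = 0" using add_grpD(1)[OF grp_M] by (intro mat_eqI f) auto
    then show False using f(3) by simp
  qed
  then have I0: "?I \<noteq> {0}" using unitv_V by blast
  have "mv n A w \<in> ?K" if "w \<in> ?K" for w using that mv_V[OF A] comm by auto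
  then have "?K \<notin> small_mods" using irr by blast
  moreover have "mv n A w \<in> ?I" if w: "w \<in> ?I" for w
  proof -
    obtain x where x: "x \<in> V" "w = mv n f x" using w by blast
    then have "mv n A w = mv n f (mv n A x)" using comm by simp
    then show ?thesis using mv_V[OF A x(1)] by blast
  qed
  then have "?I \<notin> small_mods" using irr by blast
  \<comment> \<open>Each order squared exceeds the product of the two, so each of the two is larger
    than the other.\<close>
  ultimately have "card ?K ^ 2 > q ^ n" "card ?I ^ 2 > q ^ n"
    using K I K0 I0 by (auto simp: small_mods_def)
  then have "card ?I < card ?K" "card ?K < card ?I"
    unfolding prod[symmetric] power2_eq_square by (meson mult_less_cancel1 mult_less_cancel2)+
  then show False by simp
qed

definition L :: "(nat \<Rightarrow> nat \<Rightarrow> 'k) set" where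
  "L = pev n A ` PF"

lemma LE: assumes "x \<in> L" obtains P where "P \<in> PF" "x = pev n A P"
  using assms by (auto simp: L_def)

lemma L_comm: "x \<in> L \<Longrightarrow> y \<in> L \<Longrightarrow> mm n x y = mm n y x"
  by (elim LE) (metis A mult.commute pev_mult)

lemma A_in_L: "A \<in> L"
  unfolding L_def by (rule image_eqI[where x = "[:0, 1:]"])
    (simp_all only: pev_X[OF A] PF_pCons PF_const F_0 F_1 simp_thms)

text \<open>Only zero products are at issue. If \<open>mm n y x = 0\<close> with
  \<open>y \<noteq> 0\<close>, then \<open>y\<close> kills all columns of \<open>x\<close>; it
  commutes with \<open>A\<close>, so it is injective by \<open>commuting_inj\<close>, and
  \<open>x = 0\<close>.\<close>

lemma is_field_L: "is_field L"
proof (rule is_fieldI)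
  show LM: "L \<subseteq> M" using pev_M A by (auto simp: L_def)
  show "add_grp L"
    unfolding add_grp_def L_def using PF_const(2) PF_diff
    by (force simp: pev_diff[symmetric] intro: image_eqI[where x = 0])
  show "smat c (idm n) \<in> L" if "c \<in> F" for c
    unfolding L_def pev_const(1)[of A, symmetric] using that PF_const(1) by blast
  show "mm n x y \<in> L" if "x \<in> L" "y \<in> L" for x y
    using that PF_mult by (auto simp: L_def pev_mult[OF A, symmetric])
  show "mm n x y = mm n y x" if "x \<in> L" "y \<in> L" for x y using that by (rule L_comm)
  show "y = 0" if xy: "x \<in> L" "y \<in> L" "mm n y x = 0" "x \<noteq> 0" for x y
  proof (rule ccontr)
    assume y0: "y \<noteq> 0"
    have "mv n x (unitv j) = 0" if "j < n" for j
    proof (rule commuting_inj)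
      show "y \<in> M" "mm n y A = mm n A y" "y \<noteq> 0" using xy LM y0 L_comm A_in_L by auto
      show "mv n x (unitv j) \<in> V" using xy LM that mv_V unitv_V by blast
      show "mv n y (mv n x (unitv j)) = 0" using xy(3) by (simp add: mv_mm[symmetric])
    qed
    then have "x = 0" using xy LM add_grpD(1)[OF grp_M] by (intro mat_eqI) auto
    then show False using xy by simp
  qed
qed

text \<open>The column space is a vector space over \<open>L\<close>, and the \<open>L\<close>-line
  through the first unit vector is invariant under \<open>A\<close>. It is thus too large for
  \<open>small_mods\<close>: \<open>card L ^ 2\<close> exceeds \<open>q ^ n\<close>, which leaves
  dimension 1.\<close>

lemma card_L: "card L = q ^ n"
proof -
  interpret LV: divop L "mv n" V by (rule divop_mv[OF is_field_L])
  have sub: "FV.submod W" if "LV.submod W" for W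
    unfolding FV.submod_def
  proof (intro conjI ballI)
    show W: "W \<subseteq> V" "add_grp W" using that by (auto simp: LV.submod_def)
    show "svec c x \<in> W" if c: "c \<in> F" "x \<in> W" for c x
      using \<open>LV.submod W\<close> is_fieldD(3)[OF is_field_L c(1)] c(2) W
      by (metis LV.submod_def mv_idm mv_smat subsetD)
  qed
  obtain us :: "(nat \<Rightarrow> 'k) list" where us: "card V = card L ^ length us" using LV.submod_basis[OF LV.submod_U] by blast
  have u0: "unitv 0 \<in> V" using unitv_V n_ge_1 by simp
  have ne: "(unitv 0 :: nat \<Rightarrow> 'k) \<notin> {0}"
  proof
    assume "(unitv 0 :: nat \<Rightarrow> 'k) \<in> {0}"
    then have "(unitv 0 :: nat \<Rightarrow> 'k) = 0" by simp
    from fun_cong[OF this, of 0] show False by (simp add: unitv_def)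
  qed
  let ?W = "LV.span [unitv 0]"
  have W: "LV.submod ?W" using LV.submod_span[of "[unitv 0]"] u0 by simp
  have cW: "card ?W = card L" using LV.card_extend[OF LV.submod_zero u0 ne] by simp
  have "unitv 0 \<in> ?W" using LV.set_subset_span[of "[unitv 0]"] u0 by simp
  then have W0: "?W \<noteq> {0}" using ne by metis
  have "\<forall>w\<in>?W. mv n A w \<in> ?W" using W A_in_L by (simp add: LV.submod_def)
  then have "?W \<notin> small_mods" using irr by blast
  then have big: "card L ^ 2 > q ^ n" using sub[OF W] W0 cW by (auto simp: small_mods_def)
  have pos: "card L > 0" using is_fieldD(4,8)[OF is_field_L] by (auto simp: card_gt_0_iff)
  have "length us < 2"
  proof (rule ccontr)
    assume "\<not> length us < 2"
    then have "card L ^ 2 \<le> card L ^ length us" using pos by (intro power_increasing) auto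
    then show False using big us card_V by simp
  qed
  moreover have "length us \<noteq> 0"
  proof
    assume "length us = 0"
    then have "q ^ n = 1" using us card_V by simp
    then show False using q_ge_2 n_ge_1 by simp
  qed
  ultimately have "length us = 1" by linarith
  then show ?thesis using us card_V by simp
qed

text \<open>In the field \<open>L\<close> of order \<open>q ^ n\<close> the elements fixed by the
  power with exponent \<open>q ^ a\<close> form a subfield of that order, because
  \<open>q ^ a - 1\<close> divides \<open>q ^ n - 1\<close>; it commutes with \<open>A\<close>,
  which also lies in \<open>L\<close>.\<close>

lemma subfield_of_centralizer:
  assumes a: "a \<ge> 1" "a dvd n" and q: "q = CHAR('k) ^ e" and Fq: "\<And>c. c \<in> F \<Longrightarrow> c ^ q = c"
    and ch: "CHAR('k) > 0"
  shows "\<exists>K. is_field K \<and> card K = q ^ a \<and> (\<forall>C\<in>K. mm n A C = mm n C A)"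
proof -
  note LD = is_fieldD[OF is_field_L]
  define R where "R = (\<lparr>carrier = L, mult = mm n, one = idm n, zero = 0, add = (+)\<rparr> :: (nat \<Rightarrow> nat \<Rightarrow> 'k) ring)"
  have Rsel: "carrier R = L" "\<zero>\<^bsub>R\<^esub> = 0" "\<one>\<^bsub>R\<^esub> = idm n" "x \<otimes>\<^bsub>R\<^esub> y = mm n x y" "x \<oplus>\<^bsub>R\<^esub> y = x + y" for x y
    by (simp_all add: R_def)
  have idm_L: "mm n (idm n) x = x" "mm n x (idm n) = x" if "x \<in> L" for x using that LD(1) mm_idm by blast+
  have "cring R"
  proof (rule cringI)
    show "abelian_group R"
      by (rule abelian_groupI) (use add_grpD[OF LD(2)] in \<open>auto simp: Rsel add_ac intro: bexI[of _ "- _"]\<close>)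
    show "comm_monoid R"
      by (rule comm_monoidI) (use LD in \<open>simp_all add: Rsel mm_assoc idm_L\<close>)
    show "(x \<oplus>\<^bsub>R\<^esub> y) \<otimes>\<^bsub>R\<^esub> z = x \<otimes>\<^bsub>R\<^esub> z \<oplus>\<^bsub>R\<^esub> y \<otimes>\<^bsub>R\<^esub> z" for x y z
      by (simp only: Rsel mm_add_left)
  qed
  then interpret cring R .
  have "Ring.field R"
  proof (rule cring_fieldI2)
    show "\<zero>\<^bsub>R\<^esub> \<noteq> \<one>\<^bsub>R\<^esub>" using idm_neq_0 by (simp add: Rsel)
    show "\<exists>y\<in>carrier R. x \<otimes>\<^bsub>R\<^esub> y = \<one>\<^bsub>R\<^esub>" if "x \<in> carrier R" "x \<noteq> \<zero>\<^bsub>R\<^esub>" for x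
      using that LD(6,7) by (metis Rsel(1-4))
  qed
  then interpret field R .
  have pow: "pev n A P [^]\<^bsub>R\<^esub> (k::nat) = pev n A (P ^ k)" if "P \<in> PF" for P k
    by (induction k) (simp_all add: Rsel pev_const pev_mult[OF A] PF_power that del: power_Suc add: power_Suc2)
  define r where "r = q ^ a"
  have "q ^ 1 \<le> q ^ a" using a q_ge_2 by (intro power_increasing) auto
  then have r2: "r \<ge> 2" using q_ge_2 by (simp add: r_def)
  define K where "K = {x \<in> carrier R. x [^]\<^bsub>R\<^esub> r = x}"
  have K: "card K = r"
    using roots_of_frobenius[of r] r2 LD(8) divides_pred_power[OF a(2), of q]
    unfolding K_def by (auto simp: Rsel card_L r_def)
  have KI: "pev n A P \<in> K" if "P \<in> PF" "pev n A (P ^ r) = pev n A P" for P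
    using that pow by (auto simp: K_def Rsel L_def)
  have KE: "\<exists>P\<in>PF. x = pev n A P \<and> pev n A (P ^ r) = pev n A P" if "x \<in> K" for x
    using that pow by (auto simp: K_def Rsel L_def)
  have "prime CHAR('k)" using ch by (rule prime_CHAR_semidom)
  \<comment> \<open>Additivity of the Frobenius power is taken from polynomials; evaluation at
    \<open>A\<close> transports it to \<open>L\<close>.\<close>
  then have fresh: "(P + Q) ^ r = P ^ r + Q ^ r" for P Q :: "'k poly"
    by (intro freshmans_dream'[of r "e * a"]) (simp_all add: r_def q power_mult)
  have fresh': "(P - Q) ^ r = P ^ r - Q ^ r" for P Q :: "'k poly"
    using fresh[of "P - Q" Q] by simp
  have Fr: "c ^ r = c" if "c \<in> F" for c
    unfolding r_def by (induction a) (simp_all add: power_mult Fq that mult.commute[of q])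
  have KL: "K \<subseteq> L" by (auto simp: K_def Rsel)
  have "is_field K"
  proof (rule is_fieldI)
    show "K \<subseteq> M" using KL LD(1) by blast
    show "add_grp K"
      unfolding add_grp_def
    proof (intro conjI ballI)
      show "0 \<in> K" using KI[of 0] PF_const r2 by (simp add: power_0_left)
      fix x y assume "x \<in> K" "y \<in> K"
      then obtain P Q where "P \<in> PF" "x = pev n A P" "pev n A (P ^ r) = pev n A P"
        "Q \<in> PF" "y = pev n A Q" "pev n A (Q ^ r) = pev n A Q" using KE by metis
      then show "x - y \<in> K" using KI[of "P - Q"] by (simp only: pev_diff fresh' PF_diff)
    qed
    show "smat c (idm n) \<in> K" if "c \<in> F" for c
      using KI[of "[:c:]"] that by (simp add: PF_const pev_const poly_const_pow Fr)
    show "mm n x y \<in> K" if xy: "x \<in> K" "y \<in> K" for x y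
    proof -
      obtain P Q where "P \<in> PF" "x = pev n A P" "pev n A (P ^ r) = pev n A P"
        "Q \<in> PF" "y = pev n A Q" "pev n A (Q ^ r) = pev n A Q" using KE xy by metis
      then show ?thesis using KI[of "P * Q"] by (simp only: pev_mult[OF A] power_mult_distrib PF_mult PF_power)
    qed
    show "mm n x y = mm n y x" if "x \<in> K" "y \<in> K" for x y using that KL L_comm by blast
    show "y = 0" if "x \<in> K" "y \<in> K" "mm n y x = 0" "x \<noteq> 0" for x y
      using that KL integral[of y x] by (auto simp: Rsel)
  qed
  moreover have "mm n A C = mm n C A" if "C \<in> K" for C using that KL A_in_L L_comm by blast
  ultimately show ?thesis using K unfolding r_def by blast
qed

end

end

section \<open>Counting subspaces and subfields\<close>

text \<open>Size of the targets of both counting maps: the head is restricted to nonzero vectors for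
  subspaces, and to vectors outside a line for codes of fields.\<close>

lemma card_lists_hd:
  assumes "finite V" "B \<subseteq> V"
  shows "card {xs. length xs = Suc k \<and> set xs \<subseteq> V \<and> hd xs \<in> B} = card B * card V ^ k"
    and "finite {xs. length xs = Suc k \<and> set xs \<subseteq> V \<and> hd xs \<in> B}"
proof -
  have eq: "{xs. length xs = Suc k \<and> set xs \<subseteq> V \<and> hd xs \<in> B} =
      (\<lambda>(x, xs). x # xs) ` (B \<times> {xs. set xs \<subseteq> V \<and> length xs = k})"
    using assms(2) by (auto simp: length_Suc_conv image_iff)
  show "card {xs. length xs = Suc k \<and> set xs \<subseteq> V \<and> hd xs \<in> B} = card B * card V ^ k"
    unfolding eq by (subst card_image) (auto simp: inj_on_def card_cartesian_product card_lists_length_eq assms(1))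
  show "finite {xs. length xs = Suc k \<and> set xs \<subseteq> V \<and> hd xs \<in> B}"
    using finite_subset[OF assms(2,1)] finite_lists_length_eq[OF assms(1), of k] unfolding eq by blast
qed

section \<open>Spanning lists of small subspaces\<close>

context fmat
begin

interpretation FV: divop F svec V by (rule divop_F_V)

text \<open>The size condition says that twice the dimension is at most \<open>n\<close>, so a basis
  has at most \<open>h\<close> members.\<close>

lemma small_mods_span:
  assumes W: "W \<in> small_mods" and h: "h = n div 2" "h \<ge> 1"
  shows "\<exists>w ws. w \<noteq> 0 \<and> length ws = h - 1 \<and> set (w # ws) \<subseteq> V \<and> FV.span (w # ws) = W"
proof -
  have sm: "FV.submod W" and W0: "W \<noteq> {0}" and le: "card W ^ 2 \<le> q ^ n"
    using W by (auto simp: small_mods_def)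
  obtain us where us: "set us \<subseteq> W" "FV.span us = W" "card W = card F ^ length us" "us \<noteq> [] \<Longrightarrow> hd us \<noteq> 0"
    using FV.submod_basis[OF sm] by blast
  have WV: "W \<subseteq> V" using sm by (simp add: FV.submod_def)
  have "q ^ (length us * 2) \<le> q ^ n" using le us(3) by (simp add: card_F power_mult)
  then have len: "length us \<le> h" using q_ge_2 h by (simp add: power_increasing_iff)
  have ne: "us \<noteq> []" using us(2) W0 by auto
  \<comment> \<open>Zero vectors at the tail bring all lists to the common length \<open>h\<close>
    and leave the nonzero head alone.\<close>
  define vs where "vs = us @ replicate (h - length us) 0"
  have setv: "set vs \<subseteq> W" using us(1) sm by (auto simp: vs_def FV.submod_def add_grp_def)
  then have "FV.span vs \<subseteq> W" using FV.span_least[OF sm] by simp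
  moreover have "set us \<subseteq> FV.span vs" using FV.set_subset_span[of vs] setv WV by (auto simp: vs_def)
  then have "W \<subseteq> FV.span vs" using FV.span_le[of us vs] setv WV us(2) by simp
  ultimately have span: "FV.span vs = W" by simp
  obtain w ws where vs: "vs = w # ws" using ne by (cases vs) (auto simp: vs_def)
  have "w \<noteq> 0" using us(4) ne vs by (cases us) (auto simp: vs_def)
  moreover have "length ws = h - 1" using arg_cong[OF vs, of length] len by (simp add: vs_def)
  ultimately show ?thesis using span vs setv WV by (intro exI[of _ w] exI[of _ ws]) auto
qed

text \<open>Each small subspace has at least \<open>(q - 1) * q ^ (h - 1)\<close> spanning lists of length \<open>h\<close>: shear the
  tail of one such list along its nonzero head.\<close>

lemma span_shear:
  assumes V: "set (w # ws) \<subseteq> V" and c: "c \<in> F" "c \<noteq> 0" and cs: "set cs \<subseteq> F" "length cs = length ws"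
  defines "vs \<equiv> svec c w # map2 (\<lambda>v b. v + svec b w) ws cs"
  shows "FV.span vs = FV.span (w # ws)" "set vs \<subseteq> V"
proof -
  let ?S = "FV.span (w # ws)"
  have sm: "FV.submod ?S" using V by (rule FV.submod_span)
  have mem: "w \<in> ?S" "set ws \<subseteq> ?S" using FV.set_subset_span[OF V] by auto
  have sub: "set vs \<subseteq> ?S"
  proof
    fix x assume "x \<in> set vs"
    then consider "x = svec c w" | v b where "v \<in> set ws" "b \<in> set cs" "x = v + svec b w"
      by (auto simp: vs_def dest: set_zip_leftD set_zip_rightD)
    then show "x \<in> ?S"
    proof cases
      case 1 then show ?thesis using sm mem c(1) by (simp add: FV.submod_def)
    next
      case 2
      then have "svec b w \<in> ?S" using sm mem cs(1) by (auto simp: FV.submod_def)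
      then show ?thesis using 2 mem sm add_grpD(4)[of ?S] by (auto simp: FV.submod_def)
    qed
  qed
  show vV: "set vs \<subseteq> V" using sub sm by (auto simp: FV.submod_def)
  let ?T = "FV.span vs"
  have smT: "FV.submod ?T" using vV by (rule FV.submod_span)
  have memT: "set vs \<subseteq> ?T" using FV.set_subset_span[OF vV] .
  have "svec (inverse c) (svec c w) \<in> ?T"
    using smT memT c by (auto simp: FV.submod_def vs_def F_inverse)
  then have wT: "w \<in> ?T" using c by (simp add: svec_svec)
  have "v \<in> ?T" if v: "v \<in> set ws" for v
  proof -
    obtain i where i: "i < length ws" "v = ws ! i" using v by (auto simp: in_set_conv_nth)
    have b: "cs ! i \<in> F" using cs i by (auto simp: subset_eq)
    have "v + svec (cs ! i) w \<in> set (map2 (\<lambda>v b. v + svec b w) ws cs)"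
      using i cs by (auto simp: set_zip image_iff intro!: exI[of _ i])
    then have "v + svec (cs ! i) w \<in> ?T" using memT by (auto simp: vs_def)
    moreover have "svec (cs ! i) w \<in> ?T" using smT wT b by (simp add: FV.submod_def)
    ultimately have "(v + svec (cs ! i) w) - svec (cs ! i) w \<in> ?T"
      using smT add_grpD(2)[of ?T] by (simp only: FV.submod_def)
    then show ?thesis by (simp only: add_diff_cancel)
  qed
  then have "set (w # ws) \<subseteq> ?T" using wT by auto
  then show "?T = ?S" using FV.span_le[OF sub V] FV.span_le[of "w # ws" vs] vV by blast
qed

text \<open>The span of a sheared list returns the subspace, hence the list chosen for it; the head
  then returns the scalar, and the other entries return the shear coefficients.\<close>

lemma card_small_mods:
  assumes h: "h = n div 2" "h \<ge> 1"
  shows "(q - 1) * q ^ (h - 1) * card small_mods \<le> (q ^ n - 1) * (q ^ n) ^ (h - 1)"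
proof -
  have "\<exists>f. \<forall>W\<in>small_mods. fst (f W) \<noteq> 0 \<and> length (snd (f W)) = h - 1 \<and>
      set (fst (f W) # snd (f W)) \<subseteq> V \<and> FV.span (fst (f W) # snd (f W)) = W"
    by (rule bchoice) (use small_mods_span[OF _ h] in \<open>metis fst_conv snd_conv\<close>)
  then obtain f where f: "\<And>W. W \<in> small_mods \<Longrightarrow> fst (f W) \<noteq> 0 \<and> length (snd (f W)) = h - 1 \<and>
      set (fst (f W) # snd (f W)) \<subseteq> V \<and> FV.span (fst (f W) # snd (f W)) = W" by metis
  define g where "g = (\<lambda>(W, c, cs). svec c (fst (f W)) # map2 (\<lambda>v b. v + svec b (fst (f W))) (snd (f W)) cs)"
  let ?D = "small_mods \<times> (F - {0}) \<times> {cs. set cs \<subseteq> F \<and> length cs = h - 1}"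
  let ?R = "{xs. length xs = Suc (h - 1) \<and> set xs \<subseteq> V \<and> hd xs \<in> V - {0}}"
  have span_g: "FV.span (g (W, c, cs)) = W \<and> set (g (W, c, cs)) \<subseteq> V" if "(W, c, cs) \<in> ?D" for W c cs
    using span_shear[of "fst (f W)" "snd (f W)" c cs] f[of W] that by (auto simp: g_def)
  have "inj_on g ?D"
  proof (rule inj_onI)
    fix x y assume xy: "x \<in> ?D" "y \<in> ?D" "g x = g y"
    obtain W c cs where x: "x = (W, c, cs)" by (rule prod_cases3)
    obtain X b bs where y: "y = (X, b, bs)" by (rule prod_cases3)
    have "FV.span (g (W, c, cs)) = W" using span_g xy(1) unfolding x by blast
    moreover have "FV.span (g (X, b, bs)) = X" using span_g xy(2) unfolding y by blast
    ultimately have WX: "W = X" using xy(3) unfolding x y by simp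
    have W: "W \<in> small_mods" and F: "length cs = h - 1" "length bs = h - 1" using xy by (auto simp: x y)
    note fW = f[OF W]
    have g1: "svec c (fst (f W)) = svec b (fst (f W))"
      and g2: "map2 (\<lambda>v b. v + svec b (fst (f W))) (snd (f W)) cs = map2 (\<lambda>v b. v + svec b (fst (f W))) (snd (f W)) bs"
      using xy(3) unfolding x y g_def WX by simp_all
    have canc: "r = s" if "svec r (fst (f W)) = svec s (fst (f W))" for r s
    proof -
      have "svec (r - s) (fst (f W)) = 0" using that by (simp only: svec_diff(2) diff_self)
      then show ?thesis using fW by simp
    qed
    have "cs = bs"
    proof (rule nth_equalityI)
      show "length cs = length bs" using F by simp
      fix i assume "i < length cs"
      then have "snd (f W) ! i + svec (cs ! i) (fst (f W)) = snd (f W) ! i + svec (bs ! i) (fst (f W))"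
        using arg_cong[OF g2, of "\<lambda>l. l ! i"] F fW by (simp only: length_map length_zip nth_map nth_zip min.idem case_prod_conv)
      then show "cs ! i = bs ! i" using canc by (simp only: add_left_cancel)
    qed
    then show "x = y" using canc[OF g1] WX by (simp add: x y)
  qed
  moreover have "g ` ?D \<subseteq> ?R"
  proof
    fix ys assume "ys \<in> g ` ?D"
    then obtain W c cs where ys: "ys = g (W, c, cs)" and D: "(W, c, cs) \<in> ?D" by blast
    then have *: "W \<in> small_mods" "c \<noteq> 0" "length cs = h - 1" by auto
    have len: "length ys = Suc (h - 1)" using f[OF *(1)] * by (simp add: g_def ys)
    have sub: "set ys \<subseteq> V" using span_g[OF D] ys by simp
    have hd: "hd ys = svec c (fst (f W))" by (simp add: g_def ys)
    have "hd ys \<noteq> 0" using f[OF *(1)] * unfolding hd by simp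
    moreover have "hd ys \<in> V" using sub by (rule subsetD) (simp add: g_def ys)
    ultimately show "ys \<in> ?R" using len sub by simp
  qed
  ultimately have "card ?D \<le> card ?R"
    using card_lists_hd(2)[of V "V - {0}"] finite_V by (intro card_inj_on_le) auto
  moreover have "card ?R = (q ^ n - 1) * (q ^ n) ^ (h - 1)"
    using card_lists_hd(1)[of V "V - {0}" "h - 1"] finite_V add_grpD(1)[OF grp_V] by (simp add: card_V)
  moreover have "card ?D = card small_mods * ((q - 1) * q ^ (h - 1))"
    by (simp add: card_cartesian_product card_lists_length_eq card_F)
  ultimately show ?thesis by (simp add: mult_ac)
qed

end

text \<open>Value at \<open>C\<close> of the polynomial of degree below \<open>j\<close> with
  coefficients \<open>c\<close>. The coefficients are a function, so that their choices can be
  counted as a function space.\<close>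

definition comb :: "nat \<Rightarrow> (nat \<Rightarrow> nat \<Rightarrow> 'k::field) \<Rightarrow> (nat \<Rightarrow> 'k) \<Rightarrow> nat \<Rightarrow> nat \<Rightarrow> nat \<Rightarrow> 'k" where
  "comb n C c j = (\<Sum>t<j. smat (c t) (mpow n C t))"

lemma comb_0: "comb n C c 0 = 0"
  by (simp only: comb_def lessThan_0 sum.empty)

lemma comb_Suc: "comb n C c (Suc j) = comb n C c j + smat (c j) (mpow n C j)"
  by (simp only: comb_def sum.lessThan_Suc)

lemma comb_cong: "(\<And>t. t < j \<Longrightarrow> c t = c' t) \<Longrightarrow> comb n C c j = comb n C c' j"
  unfolding comb_def by (rule sum.cong) auto

lemma comb_diff: "comb n C (\<lambda>t. c t - c' t) j = comb n C c j - comb n C c' j"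
  by (simp only: comb_def smat_diff sum_subtractf)

lemma comb_smult: "comb n C (\<lambda>t. r * c t) j = smat r (comb n C c j)"
  by (simp only: comb_def smat_sum smat_smat)

lemma mv_comb: "mv n (comb n C c j) v = (\<Sum>t<j. svec (c t) (mv n (mpow n C t) v))"
  by (simp only: comb_def mv_sum_left mv_smat)

section \<open>Generators of a subfield of prime degree\<close>

context fmat
begin

definition PA :: "(nat \<Rightarrow> nat \<Rightarrow> 'k) \<Rightarrow> nat \<Rightarrow> (nat \<Rightarrow> nat \<Rightarrow> 'k) set" where
  "PA C j = {comb n C c j | c. \<forall>t. c t \<in> F}"

definition SC :: "(nat \<Rightarrow> nat \<Rightarrow> 'k) set" where
  "SC = (\<lambda>c. smat c (idm n)) ` F"

lemma card_SC: "card SC = q"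
  unfolding SC_def
proof (subst card_image)
  show "inj_on (\<lambda>c. smat c (idm n :: nat \<Rightarrow> nat \<Rightarrow> 'k)) F"
  proof (rule inj_onI)
    fix c d :: 'k assume "smat c (idm n) = smat d (idm n)"
    from fun_cong[OF fun_cong[OF this, of 0], of 0] show "c = d" using n_ge_1 by (simp add: smat_def idm_def)
  qed
qed (rule card_F)

lemma SC_0_1: "0 \<in> SC" "idm n \<in> SC"
proof -
  have "smat 0 (idm n) \<in> SC" "smat 1 (idm n) \<in> SC" unfolding SC_def by (intro imageI F_0 F_1)+
  then show "0 \<in> SC" "idm n \<in> SC" by (simp_all only: smat_simps)
qed

lemma PA_mono_mem: "i < j \<Longrightarrow> mpow n C i \<in> PA C j"
proof -
  assume ij: "i < j"
  have "comb n C (\<lambda>t. if t = i then 1 else 0) j = (\<Sum>t<j. if t = i then mpow n C t else 0)"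
    unfolding comb_def by (intro sum.cong refl) (simp only: smat_simps split: if_splits, simp)
  also have "\<dots> = mpow n C i" using ij by (simp only: sum.delta finite_lessThan lessThan_iff if_True)
  finally show ?thesis unfolding PA_def by (intro CollectI exI[of _ "\<lambda>t. if t = i then 1 else 0"]) simp
qed

lemma grp_PA: "add_grp (PA C j)"
  unfolding add_grp_def
proof (intro conjI ballI)
  have "comb n C (\<lambda>t. 0) j = 0" unfolding comb_def by (simp only: smat_simps sum.neutral_const)
  then show "0 \<in> PA C j" unfolding PA_def by (intro CollectI exI[of _ "\<lambda>t. 0"]) simp
  fix x y assume "x \<in> PA C j" "y \<in> PA C j"
  then obtain c d where "x = comb n C c j" "y = comb n C d j" "\<forall>t. c t \<in> F" "\<forall>t. d t \<in> F" by (auto simp: PA_def)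
  then have "x - y = comb n C (\<lambda>t. c t - d t) j" "\<forall>t. c t - d t \<in> F" by (auto simp: comb_diff F_diff)
  then show "x - y \<in> PA C j" unfolding PA_def by blast
qed

lemma smat_PA: "r \<in> F \<Longrightarrow> x \<in> PA C j \<Longrightarrow> smat r x \<in> PA C j"
proof -
  assume r: "r \<in> F" and "x \<in> PA C j"
  then obtain c where "x = comb n C c j" "\<forall>t. c t \<in> F" by (auto simp: PA_def)
  then have "smat r x = comb n C (\<lambda>t. r * c t) j" "\<forall>t. r * c t \<in> F" using r by (auto simp: comb_smult F_mult)
  then show ?thesis unfolding PA_def by blast
qed

lemma PA_1: "PA C 1 = SC"
proof -
  have "comb n C c 1 = smat (c 0) (idm n)" for c
    using comb_Suc[of n C c 0] by (simp only: comb_0 add_0_left mpow.simps One_nat_def)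
  then show ?thesis by (auto simp: PA_def SC_def image_iff intro: exI[of _ "\<lambda>_. _"])
qed

text \<open>If the leading coefficients differed, the highest power would be a combination of the
  lower ones.\<close>

lemma comb_unique:
  assumes "\<And>i. i < j \<Longrightarrow> mpow n C i \<notin> PA C i" "\<forall>t. c t \<in> F" "\<forall>t. d t \<in> F"
    and "comb n C c j = comb n C d j" and "t < j"
  shows "c t = d t"
  using assms
proof (induction j arbitrary: t)
  case (Suc j)
  have eq: "comb n C c j + smat (c j) (mpow n C j) = comb n C d j + smat (d j) (mpow n C j)"
    using Suc.prems(4) by (simp only: comb_Suc)
  have cj: "c j = d j"
  proof (rule ccontr)
    assume ne: "c j \<noteq> d j"
    have "smat (d j - c j) (mpow n C j) = comb n C (\<lambda>t. c t - d t) j"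
      using eq by (simp only: smat_diff comb_diff) (simp add: algebra_simps)
    moreover have "comb n C (\<lambda>t. c t - d t) j \<in> PA C j" using Suc.prems by (auto simp: PA_def F_diff)
    moreover have "inverse (d j - c j) \<in> F" using Suc.prems(2,3) by (simp only: F_inverse F_diff)
    ultimately have "smat (inverse (d j - c j)) (smat (d j - c j) (mpow n C j)) \<in> PA C j"
      using smat_PA by metis
    then show False using Suc.prems(1)[of j] ne by (simp add: smat_smat)
  qed
  then have eq': "comb n C c j = comb n C d j" using eq by (simp only: add_right_cancel)
  show ?case
  proof (cases "t = j")
    case False
    then have "t < j" using Suc.prems(5) by simp
    then show ?thesis using Suc.IH[OF _ Suc.prems(2,3) eq'] Suc.prems(1) by simp
  qed (use cj in simp)
qed simp

lemma card_PA:
  assumes "\<And>i. i < j \<Longrightarrow> mpow n C i \<notin> PA C i"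
  shows "card (PA C j) = q ^ j"
proof -
  let ?P = "PiE {..<j} (\<lambda>_. F)"
  define e where "e = (\<lambda>(c::nat \<Rightarrow> 'k) t. if t < j then c t else 0)"
  have eF: "\<forall>t. e c t \<in> F" if "c \<in> ?P" for c using that by (auto simp: e_def)
  have "PA C j = (\<lambda>c. comb n C (e c) j) ` ?P"
  proof (intro equalityI subsetI)
    fix x assume "x \<in> PA C j"
    then obtain c where c: "x = comb n C c j" "\<forall>t. c t \<in> F" by (auto simp: PA_def)
    have "x = comb n C (e (restrict c {..<j})) j" unfolding c(1) by (rule comb_cong) (simp add: e_def)
    moreover have "restrict c {..<j} \<in> ?P" using c by auto
    ultimately show "x \<in> (\<lambda>c. comb n C (e c) j) ` ?P" by blast
  qed (use eF in \<open>auto simp: PA_def\<close>)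
  moreover have "inj_on (\<lambda>c. comb n C (e c) j) ?P"
  proof (rule inj_onI)
    fix c d assume *: "c \<in> ?P" "d \<in> ?P" "comb n C (e c) j = comb n C (e d) j"
    have "e c t = e d t" if "t < j" for t by (rule comb_unique[OF assms eF[OF *(1)] eF[OF *(2)] *(3) that])
    then show "c = d" using * by (intro PiE_ext[of c _ _ d]) (auto simp: e_def)
  qed
  ultimately show ?thesis by (simp add: card_image card_PiE card_F)
qed

lemma is_field_integral:
  assumes K: "is_field K" and "A \<in> K" "B \<in> K" "mm n B A = 0" "A \<noteq> 0"
  shows "B = 0"
proof -
  note KD = is_fieldD[OF K]
  obtain D where D: "D \<in> K" "mm n D A = idm n" using KD(7) assms by blast
  have "mm n A B = 0" using KD(6) assms by metis
  then have "mm n (mm n D A) B = 0" by (simp only: mm_assoc mm_zero)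
  then show ?thesis using KD(1) assms(3) D(2) mm_idm(1) by (metis subsetD)
qed

lemma is_field_sub:
  assumes K: "is_field K" and S: "S \<subseteq> K" "add_grp S" "\<And>c. c \<in> F \<Longrightarrow> smat c (idm n) \<in> S"
    "\<And>A B. A \<in> S \<Longrightarrow> B \<in> S \<Longrightarrow> mm n A B \<in> S"
  shows "is_field S"
proof (rule is_fieldI)
  note KD = is_fieldD[OF K]
  show "S \<subseteq> M" using S(1) KD(1) by blast
  show "mm n A B = mm n B A" if "A \<in> S" "B \<in> S" for A B using that S(1) KD(6) by blast
  show "B = 0" if AB: "A \<in> S" "B \<in> S" "mm n B A = 0" "A \<noteq> 0" for A B
    by (rule is_field_integral[OF K]) (use AB S(1) in auto)
qed (use S in auto)

context
  fixes K :: "(nat \<Rightarrow> nat \<Rightarrow> 'k) set" and a :: nat and C :: "nat \<Rightarrow> nat \<Rightarrow> 'k"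
  assumes K: "is_field K" and cardK: "card K = q ^ a" and a: "prime a" and C: "C \<in> K" "C \<notin> SC"
begin

lemma mpow_K: "mpow n C t \<in> K"
  using is_fieldD[OF K] C by (induction t) auto

lemma comb_K: "\<forall>t. c t \<in> F \<Longrightarrow> comb n C c j \<in> K"
  unfolding comb_def using is_fieldD[OF K] mpow_K by (intro add_grp_sum) auto

lemma PA_K: "PA C j \<subseteq> K"
  using comb_K by (auto simp: PA_def)

text \<open>Since \<open>a\<close> is prime, a subfield of \<open>K\<close> containing \<open>F\<close> is \<open>F\<close> or \<open>K\<close>, so that the
  minimal polynomial of \<open>C\<close> has degree \<open>a\<close>.\<close>

lemma PA_field:
  shows "PA C a = K" and "mpow n C a \<in> PA C a" and "\<And>i. i < a \<Longrightarrow> mpow n C i \<notin> PA C i"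
proof -
  note KD = is_fieldD[OF K]
  \<comment> \<open>Otherwise \<open>a + 1\<close> independent powers would fit into
    \<open>K\<close>, which has only \<open>q ^ a\<close> elements.\<close>
  have "\<exists>j. mpow n C j \<in> PA C j"
  proof (rule ccontr)
    assume "\<not> ?thesis"
    then have "card (PA C (Suc a)) = q ^ Suc a" by (intro card_PA) blast
    moreover have "card (PA C (Suc a)) \<le> q ^ a" using card_mono[OF KD(8) PA_K] cardK by simp
    ultimately show False using q_ge_2 by simp
  qed
  then obtain j where j: "mpow n C j \<in> PA C j" and min: "\<And>i. i < j \<Longrightarrow> mpow n C i \<notin> PA C i"
    using exists_least_iff[of "\<lambda>j. mpow n C j \<in> PA C j"] by blast
  note gP = grp_PA[of C j]
  have "mpow n C 0 \<notin> PA C 0" using idm_neq_0 by (auto simp: PA_def comb_0)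
  then have j0: "j > 0" using j by (metis gr0I)
  have stepC: "mm n C x \<in> PA C j" if x: "x \<in> PA C j" for x
  proof -
    obtain c where c: "x = comb n C c j" "\<forall>t. c t \<in> F" using x by (auto simp: PA_def)
    have "mm n C x = (\<Sum>t<j. smat (c t) (mpow n C (Suc t)))"
      by (simp only: c(1) comb_def mm_sum_right mm_smat_right mpow.simps)
    moreover have "mpow n C (Suc t) \<in> PA C j" if "t < j" for t
      using that j PA_mono_mem[of "Suc t" j C] by (cases "Suc t = j") auto
    ultimately show ?thesis using c(2) by (auto intro!: add_grp_sum[OF gP] smat_PA simp del: mpow.simps)
  qed
  have stepP: "mm n (mpow n C t) x \<in> PA C j" if "x \<in> PA C j" for t x
  proof (induction t)
    case 0
    have "x \<in> M" using that PA_K KD(1) by blast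
    then show ?case using that by (simp add: mm_idm)
  qed (simp only: mpow.simps mm_assoc stepC)
  have fld: "is_field (PA C j)"
  proof (rule is_field_sub[OF K PA_K gP])
    show "smat c (idm n) \<in> PA C j" if "c \<in> F" for c
      using smat_PA[OF that PA_mono_mem[OF j0]] by simp
    show "mm n x y \<in> PA C j" if xy: "x \<in> PA C j" "y \<in> PA C j" for x y
    proof -
      obtain c where c: "x = comb n C c j" "\<forall>t. c t \<in> F" using xy by (auto simp: PA_def)
      have "mm n x y = (\<Sum>t<j. smat (c t) (mm n (mpow n C t) y))"
        by (simp only: c(1) comb_def mm_sum_left mm_smat_left)
      then show ?thesis using c(2) stepP xy by (auto intro!: add_grp_sum[OF gP] smat_PA)
    qed
  qed
  have cP: "card (PA C j) = q ^ j" using min by (rule card_PA)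
  \<comment> \<open>The least \<open>j\<close> at which a power depends on its predecessors is the
    degree of the field \<open>PA C j\<close>; as \<open>K\<close> is a vector space over this
    field, \<open>j\<close> divides the prime \<open>a\<close>.\<close>
  interpret D: divop "PA C j" "mm n" K by (rule divop_mm[OF fld K PA_K])
  obtain s where "card K = (q ^ j) ^ s" using D.card_submod[OF D.submod_U] cP by auto
  then have "q ^ a = q ^ (j * s)" by (simp add: cardK power_mult)
  then have "a = j * s" using q_ge_2 by (simp add: power_inject_exp)
  then have "j = 1 \<or> j = a" using a by (metis One_nat_def mult.right_neutral prime_product)
  moreover have "j \<noteq> 1"
  proof
    assume "j = 1"
    then have "mpow n C 1 \<in> SC" using j PA_1 by simp
    moreover have "mpow n C 1 = C" using C KD(1) mm_idm(2) by auto
    ultimately show False using C by simp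
  qed
  ultimately have ja: "j = a" by simp
  show "PA C a = K" using card_subset_eq[OF KD(8) PA_K] cP cardK ja by simp
  show "mpow n C a \<in> PA C a" and "\<And>i. i < a \<Longrightarrow> mpow n C i \<notin> PA C i" using j min ja by auto
qed

end

end

section \<open>Encoding a generator by its minimal polynomial and its action on a basis\<close>

context fmat
begin

interpretation FV: divop F svec V by (rule divop_F_V)

text \<open>Coefficients \<open>c\<close> of a relation \<open>C\<^sup>a = \<Sum>t<a. c t * C\<^sup>t\<close> whose polynomial has neither \<open>0\<close> nor \<open>1\<close>
  as a root.\<close>

definition coefs :: "nat \<Rightarrow> (nat \<Rightarrow> 'k) set" where
  "coefs a = {c. (\<forall>t. c t \<in> F) \<and> (\<forall>t\<ge>a. c t = 0) \<and> c 0 \<noteq> 0 \<and> (\<Sum>t<a. c t) \<noteq> 1}"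

text \<open>The constant term and \<open>1 - (\<Sum>t<a. c t)\<close> are nonzero, the coefficients
  strictly between the first and the last are free, and the last one is recovered from the
  sum.\<close>

lemma card_coefs:
  assumes a: "a \<ge> 2"
  shows "finite (coefs a)" and "card (coefs a) \<le> (q - 1)\<^sup>2 * q ^ (a - 2)"
proof -
  let ?g = "\<lambda>c :: nat \<Rightarrow> 'k. (c 0, 1 - (\<Sum>t<a. c t), restrict c {1..<a - 1})"
  let ?T = "(F - {0}) \<times> (F - {0}) \<times> PiE {1..<a - 1} (\<lambda>_. F)"
  have finT: "finite ?T" by (intro finite_cartesian_product finite_PiE) auto
  have im: "?g ` coefs a \<subseteq> ?T"
    by (auto simp: coefs_def intro!: F_diff F_sum)
  have inj: "inj_on ?g (coefs a)"
  proof (rule inj_onI)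
    fix c d assume *: "c \<in> coefs a" "d \<in> coefs a" "?g c = ?g d"
    have 0: "c 0 = d 0" and s: "(\<Sum>t<a. c t) = (\<Sum>t<a. d t)"
      and r: "restrict c {1..<a - 1} = restrict d {1..<a - 1}" using *(3) by auto
    have lt: "c t = d t" if "t < a - 1" for t
      using 0 fun_cong[OF r, of t] that by (cases "t = 0") auto
    have "{..<a} = insert (a - 1) {..<a - 1}" using a by auto
    then have "(\<Sum>t<a. f t) = f (a - 1) + (\<Sum>t<a - 1. f t)" for f :: "nat \<Rightarrow> 'k" by simp
    then have "c (a - 1) + (\<Sum>t<a - 1. c t) = d (a - 1) + (\<Sum>t<a - 1. d t)" using s by metis
    moreover have "(\<Sum>t<a - 1. c t) = (\<Sum>t<a - 1. d t)" using lt by (intro sum.cong) auto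
    ultimately have last: "c (a - 1) = d (a - 1)" by simp
    have "c t = d t" for t
    proof -
      consider "t < a - 1" | "t = a - 1" | "t \<ge> a" by linarith
      then show ?thesis using lt last * by cases (auto simp: coefs_def)
    qed
    then show "c = d" by blast
  qed
  show "finite (coefs a)" using inj im finT by (rule inj_on_finite)
  have "card (coefs a) \<le> card ?T" using inj im finT by (rule card_inj_on_le)
  also have "card ?T = (q - 1)\<^sup>2 * q ^ (a - 2)"
    by (simp add: card_cartesian_product card_PiE card_F power2_eq_square numeral_2_eq_2)
  finally show "card (coefs a) \<le> (q - 1)\<^sup>2 * q ^ (a - 2)" .
qed

text \<open>A generator \<open>C\<close> of a subfield \<open>K\<close> is determined by its minimal polynomial and the vectors
  \<open>C\<^sup>t e\<^sub>i\<close> for \<open>1 \<le> t < a\<close>, where \<open>i\<close> runs through the indices picked greedily so that the \<open>e\<^sub>i\<close> form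
  a \<open>K\<close>-basis of \<open>V\<close>; \<open>code\<close> lists these vectors.\<close>

fun kspan :: "(nat \<Rightarrow> nat \<Rightarrow> 'k) set \<Rightarrow> nat \<Rightarrow> (nat \<Rightarrow> 'k) set" where
  "kspan K 0 = {0}"
| "kspan K (Suc i) = {s + mv n f (unitv i) | s f. s \<in> kspan K i \<and> f \<in> K}"

fun code :: "(nat \<Rightarrow> nat \<Rightarrow> 'k) set \<Rightarrow> nat \<Rightarrow> (nat \<Rightarrow> nat \<Rightarrow> 'k) \<Rightarrow> nat \<Rightarrow> (nat \<Rightarrow> 'k) list" where
  "code K a C 0 = []"
| "code K a C (Suc i) = code K a C i @
     (if unitv i \<in> kspan K i then [] else map (\<lambda>t. mv n (mpow n C t) (unitv i)) [1..<a])"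

lemma code_prefix: "i \<le> m \<Longrightarrow> \<exists>zs. code K a C m = code K a C i @ zs"
  by (induction m rule: dec_induct) auto

lemma unitv_0_neq_0: "(unitv 0 :: nat \<Rightarrow> 'k) \<noteq> 0"
proof
  assume "(unitv 0 :: nat \<Rightarrow> 'k) = 0"
  from fun_cong[OF this, of 0] show False by (simp add: unitv_def)
qed

context
  fixes K :: "(nat \<Rightarrow> nat \<Rightarrow> 'k) set" and a :: nat and C :: "nat \<Rightarrow> nat \<Rightarrow> 'k"
  assumes K: "is_field K" and cardK: "card K = q ^ a" and a: "prime a" and C: "C \<in> K" "C \<notin> SC"
begin

lemma C_M: "C \<in> M" using is_fieldD(1)[OF K] C(1) by blast

text \<open>\<open>C - smat c (idm n)\<close> is a nonzero element of the field \<open>K\<close>,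
  hence invertible, and kills no nonzero vector. This removes \<open>q\<close> vectors from the
  possible heads of a code.\<close>

lemma C_not_eigen: "c \<in> F \<Longrightarrow> mv n C (unitv 0) \<noteq> svec c (unitv 0)"
proof
  note KD = is_fieldD[OF K]
  assume c: "c \<in> F" and eq: "mv n C (unitv 0) = svec c (unitv 0)"
  have u: "(unitv 0 :: nat \<Rightarrow> 'k) \<in> V" using unitv_V n_ge_1 by simp
  let ?D = "C - smat c (idm n)"
  have D: "?D \<in> K" using add_grpD(2)[OF KD(2) C(1) KD(3)[OF c]] .
  have "?D \<noteq> 0" using C(2) c by (auto simp: SC_def)
  then obtain E where "mm n E ?D = idm n" using KD(7) D by blast
  moreover have "mv n ?D (unitv 0) = 0" using eq u by (simp only: mv_diff_left mv_smat mv_idm diff_self)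
  ultimately have "mv n (idm n) (unitv 0) = (0 :: nat \<Rightarrow> 'k)" by (metis mv_mm mv_zero(2))
  then show False using u unitv_0_neq_0 by (simp only: mv_idm)
qed

text \<open>A root 0 or 1 of the minimal polynomial would split off a factor \<open>C\<close> or
  \<open>C - idm n\<close>, which is nonzero in a field, and leave a relation of degree
  \<open>a - 1\<close>.\<close>

lemma min_coefs: "\<exists>c\<in>coefs a. mpow n C a = comb n C c a"
proof -
  note KD = is_fieldD[OF K] and PAf = PA_field[OF K cardK a C]
  note unique = comb_unique[of a C, OF PAf(3)]
  obtain c' where c': "mpow n C a = comb n C c' a" "\<forall>t. c' t \<in> F" using PAf(2) by (auto simp: PA_def)
  define c where "c = (\<lambda>t. if t < a then c' t else 0)"
  have cF: "\<forall>t. c t \<in> F" and c0: "\<forall>t\<ge>a. c t = 0" using c' by (auto simp: c_def)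
  have c: "mpow n C a = comb n C c a" unfolding c'(1) by (rule comb_cong) (simp add: c_def)
  have a1: "a = Suc (a - 1)" using prime_ge_2_nat[OF a] by simp
  have Cnz: "C \<noteq> 0" using C(2) SC_0_1 by blast
  have "c 0 \<noteq> 0"
  proof
    assume "c 0 = 0"
    \<comment> \<open>Without a constant term the combination has a factor \<open>C\<close>.\<close>
    have "comb n C c (Suc m) = mm n C (comb n C (\<lambda>t. c (Suc t)) m)" for m
    proof (induction m)
      case 0 show ?case by (simp only: comb_Suc comb_0 \<open>c 0 = 0\<close> smat_simps add_0_left mm_zero)
    next
      case (Suc m)
      have "comb n C c (Suc (Suc m)) = comb n C c (Suc m) + smat (c (Suc m)) (mpow n C (Suc m))" by (rule comb_Suc)
      also have "\<dots> = mm n C (comb n C (\<lambda>t. c (Suc t)) m) + smat (c (Suc m)) (mm n C (mpow n C m))"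
        by (simp only: Suc.IH mpow.simps)
      finally show ?case by (simp only: comb_Suc mm_add_right mm_smat_right)
    qed
    then have "mm n C (mpow n C (a - 1)) = mm n C (comb n C (\<lambda>t. c (Suc t)) (a - 1))"
      using c a1 by (metis mpow.simps(2))
    then have 1: "mm n C (mpow n C (a - 1) - comb n C (\<lambda>t. c (Suc t)) (a - 1)) = 0"
      by (simp only: mm_diff_right diff_self)
    have 2: "mpow n C (a - 1) - comb n C (\<lambda>t. c (Suc t)) (a - 1) \<in> K"
      using add_grpD(2)[OF KD(2) mpow_K[OF K cardK a C] comb_K[OF K cardK a C]] cF by simp
    have "mpow n C (a - 1) - comb n C (\<lambda>t. c (Suc t)) (a - 1) = 0"
      using is_field_integral[OF K 2 C(1) 1] Cnz by blast
    then have "mpow n C (a - 1) = comb n C (\<lambda>t. c (Suc t)) (a - 1)" by (simp only: right_minus_eq)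
    then have "mpow n C (a - 1) \<in> PA C (a - 1)" using cF unfolding PA_def by blast
    then show False using PAf(3)[of "a - 1"] a1 by simp
  qed
  moreover have "(\<Sum>t<a. c t) \<noteq> 1"
  proof
    assume s1: "(\<Sum>t<a. c t) = 1"
    define D where "D = (\<lambda>m. \<Sum>t<m. c t)"
    let ?E = "C - idm n"
    \<comment> \<open>Division by \<open>C - idm n\<close>: the quotient has the partial sums
      \<open>D\<close> as coefficients, and the product telescopes. At \<open>m = a\<close> the
      right side vanishes, since \<open>D a = 1\<close>.\<close>
    have tele: "mm n ?E (comb n C (\<lambda>t. D (Suc t)) m) = smat (D m) (mpow n C m) - comb n C c m" for m
    proof (induction m)
      case 0 show ?case by (simp only: comb_0 D_def lessThan_0 sum.empty smat_simps mm_zero diff_self)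
    next
      case (Suc m)
      have P: "mpow n C m \<in> M" using mpow_K[OF K cardK a C] KD(1) by blast
      have EP: "mm n ?E (mpow n C m) = mpow n C (Suc m) - mpow n C m"
        by (simp only: mm_diff_left mm_idm[OF P] mpow.simps)
      have "mm n ?E (comb n C (\<lambda>t. D (Suc t)) (Suc m)) =
         (smat (D m) (mpow n C m) - comb n C c m) + smat (D (Suc m)) (mpow n C (Suc m) - mpow n C m)"
        by (simp only: comb_Suc mm_add_right Suc.IH mm_smat_right EP)
      moreover have "D (Suc m) = D m + c m" by (simp add: D_def)
      ultimately show ?case
        by (simp only: comb_Suc smat_diff smat_add) (simp only: algebra_simps)
    qed
    have DF: "\<forall>t. D (Suc t) \<in> F" using cF by (auto simp: D_def intro!: F_add F_sum)
    have "mm n ?E (comb n C (\<lambda>t. D (Suc t)) a) = 0"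
      using tele[of a] s1 c by (simp only: D_def smat_simps diff_self)
    moreover have "?E \<in> K" using add_grpD(2)[OF KD(2) C(1) KD(4)] .
    moreover have "?E \<noteq> 0" using C(2) SC_0_1 by auto
    moreover have "comb n C (\<lambda>t. D (Suc t)) a \<in> K" using DF by (rule comb_K[OF K cardK a C])
    ultimately have "comb n C (\<lambda>t. D (Suc t)) a = 0"
      using is_field_integral[OF K] KD(6) by metis
    also have "0 = comb n C (\<lambda>t. 0) a" by (simp only: comb_def smat_simps sum.neutral_const)
    \<comment> \<open>The coefficient of highest index is the full sum, which is 1.\<close>
    finally have "D (Suc (a - 1)) = 0" by (rule unique[OF _ DF, rotated 2]) (use a1 in auto)
    then show False using s1 a1 by (simp add: D_def)
  qed
  ultimately show ?thesis using c cF c0 by (auto simp: coefs_def intro!: bexI[of _ c])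
qed

text \<open>A picked index multiplies the order of the span by \<open>q ^ a\<close> and adds
  \<open>a - 1\<close> vectors to the code; exponent 0 is left out because it gives the unit vector
  itself.\<close>

lemma kspan_facts:
  assumes "i \<le> n" and KV: "KV = divop.submod K (mv n) V"
  shows "KV (kspan K i) \<and> (\<forall>j<i. unitv j \<in> kspan K i) \<and>
    (\<exists>r. card (kspan K i) = (q ^ a) ^ r \<and> length (code K a C i) = r * (a - 1))"
  using assms(1)
proof (induction i)
  interpret D: divop K "mv n" V by (rule divop_mv[OF K])
  case 0
  show ?case using D.submod_zero by (auto simp: KV intro: exI[of _ 0])
next
  interpret D: divop K "mv n" V by (rule divop_mv[OF K])
  case (Suc i)
  have ext: "kspan K (Suc i) = D.extend (unitv i) (kspan K i)" by (simp add: D.extend_def)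
  have u: "(unitv i :: nat \<Rightarrow> 'k) \<in> V" using Suc.prems unitv_V by simp
  have IH: "D.submod (kspan K i)" "\<forall>j<i. unitv j \<in> kspan K i"
    "\<exists>r. card (kspan K i) = (q ^ a) ^ r \<and> length (code K a C i) = r * (a - 1)"
    using Suc by (auto simp: KV)
  obtain r where r: "card (kspan K i) = (q ^ a) ^ r" "length (code K a C i) = r * (a - 1)" using IH(3) by blast
  note se = D.submod_extend[OF IH(1) u]
  have "\<exists>r. card (kspan K (Suc i)) = (q ^ a) ^ r \<and> length (code K a C (Suc i)) = r * (a - 1)"
  proof (cases "unitv i \<in> kspan K i")
    case True
    then have "kspan K (Suc i) = kspan K i"
      unfolding ext using se(2) D.extend_least[OF IH(1) order_refl True] by blast
    then show ?thesis using r True by auto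
  next
    case False
    then have "card (kspan K (Suc i)) = (q ^ a) ^ Suc r"
      unfolding ext using D.card_extend[OF IH(1) u False] r cardK by simp
    moreover have "length (code K a C (Suc i)) = Suc r * (a - 1)" using False r by simp
    ultimately show ?thesis by blast
  qed
  moreover have "\<forall>j<Suc i. unitv j \<in> kspan K (Suc i)"
    using se(2,3) IH(2) unfolding ext by (auto simp: less_Suc_eq)
  ultimately show ?case using se(1) unfolding ext KV by blast
qed

text \<open>The final span contains all unit vectors and is therefore \<open>V\<close>. Comparing
  orders, exactly \<open>n div a\<close> indices are picked, with \<open>a - 1\<close> vectors
  each.\<close>

lemma kspan_n: "kspan K n = V" and length_code: "length (code K a C n) = n - n div a"
proof -
  interpret D: divop K "mv n" V by (rule divop_mv[OF K])
  have sm: "D.submod (kspan K n)" and un: "\<forall>j<n. unitv j \<in> kspan K n"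
    and "\<exists>r. card (kspan K n) = (q ^ a) ^ r \<and> length (code K a C n) = r * (a - 1)"
    using kspan_facts[OF order_refl refl] by auto
  then obtain r where r: "card (kspan K n) = (q ^ a) ^ r" "length (code K a C n) = r * (a - 1)" by blast
  have sub: "kspan K n \<subseteq> V" and grp: "add_grp (kspan K n)" using sm by (auto simp: D.submod_def)
  have "v \<in> kspan K n" if v: "v \<in> V" for v
  proof -
    have "v = (\<Sum>j<n. svec (v j) (unitv j))"
    proof
      fix i
      have "(\<Sum>j<n. svec (v j) (unitv j)) i = (\<Sum>j<n. if j = i then v j else 0)"
        unfolding sum_fun_apply by (intro sum.cong) (auto simp: svec_def unitv_def)
      also have "\<dots> = v i" using v by (auto simp: V_def)
      finally show "v i = (\<Sum>j<n. svec (v j) (unitv j)) i" by simp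
    qed
    moreover have "svec (v j) (unitv j) \<in> kspan K n" if "j < n" for j
    proof -
      have "svec (v j) (unitv j) = mv n (smat (v j) (idm n)) (unitv j)"
        using unitv_V[OF that] by (simp only: mv_smat mv_idm)
      moreover have "smat (v j) (idm n) \<in> K" using is_fieldD(3)[OF K] v by (simp add: V_def)
      ultimately show ?thesis using sm un that by (simp add: D.submod_def)
    qed
    ultimately show ?thesis using add_grp_sum[OF grp, of "{..<n}" "\<lambda>j. svec (v j) (unitv j)"] by simp
  qed
  then show V: "kspan K n = V" using sub by blast
  have "q ^ n = q ^ (a * r)" using r(1) by (simp add: V card_V power_mult)
  then have nr: "n = a * r" using q_ge_2 by (simp add: power_inject_exp)
  then have "n div a = r" using prime_gt_0_nat[OF a] by simp
  then show "length (code K a C n) = n - n div a"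
    using r(2) nr by (simp add: diff_mult_distrib mult.commute diff_mult_distrib2)
qed

lemma code_in_V: "i \<le> n \<Longrightarrow> set (code K a C i) \<subseteq> V"
  by (induction i) (auto intro!: mv_V mpow_M C_M unitv_V)

text \<open>Index 0 is always picked, as the initial span is zero, and the exponents start at
  1.\<close>

lemma hd_code: "hd (code K a C n) = mv n C (unitv 0)"
proof -
  obtain zs where zs: "code K a C n = code K a C (Suc 0) @ zs" using code_prefix[of "Suc 0" n K a C] n_ge_1 by (auto simp del: code.simps)
  have "[1..<a] = 1 # [2..<a]" using prime_ge_2_nat[OF a] by (simp add: upt_conv_Cons numeral_2_eq_2)
  moreover have "mpow n C 1 = C" using mm_idm(2)[OF C_M] by simp
  ultimately show ?thesis using zs unitv_0_neq_0 by simp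
qed

end

end

section \<open>Counting subfields of prime degree\<close>

context fmat
begin

definition fields :: "nat \<Rightarrow> (nat \<Rightarrow> nat \<Rightarrow> 'k) set set" where
  "fields a = {K. is_field K \<and> card K = q ^ a}"

text \<open>For prime \<open>a\<close> every nonscalar element generates its field, so a field
  occurs once for each of its \<open>q ^ a - q\<close> generators.\<close>

definition pointed_fields :: "nat \<Rightarrow> ((nat \<Rightarrow> nat \<Rightarrow> 'k) set \<times> (nat \<Rightarrow> nat \<Rightarrow> 'k)) set" where
  "pointed_fields a = Sigma (fields a) (\<lambda>K. K - SC)"

lemma finite_fields: "finite (fields a)"
  by (rule finite_subset[of _ "Pow M"]) (auto simp: fields_def is_field_def finite_M)

lemma card_pointed_fields:
  shows "card (pointed_fields a) = card (fields a) * (q ^ a - q)"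
proof -
  have "card (K - SC) = q ^ a - q" if "K \<in> fields a" for K
  proof -
    have K: "is_field K" "card K = q ^ a" using that by (auto simp: fields_def)
    have "SC \<subseteq> K" using is_fieldD(3)[OF K(1)] by (auto simp: SC_def)
    then show ?thesis using card_Diff_subset[of SC K] K(2) card_SC by (simp add: SC_def)
  qed
  moreover have "finite K" if "K \<in> fields a" for K using that is_fieldD(8) by (auto simp: fields_def)
  ultimately show ?thesis unfolding pointed_fields_def using finite_fields by (subst card_SigmaI) auto
qed

text \<open>Induction over the indices: while the spans agree and \<open>C\<close>,
  \<open>C'\<close> coincide on them, both runs pick the same index. The code and the common
  relation then determine both matrices on the enlarged span.\<close>

lemma pointed_fields_inj:
  assumes a: "prime a" and KC: "(K, C) \<in> pointed_fields a" "(K', C') \<in> pointed_fields a"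
    and c: "c \<in> coefs a" "mpow n C a = comb n C c a" "mpow n C' a = comb n C' c a"
    and code: "code K a C n = code K' a C' n"
  shows "(K, C) = (K', C')"
proof -
  have K: "is_field K" "card K = q ^ a" and C: "C \<in> K" "C \<notin> SC"
    and K': "is_field K'" "card K' = q ^ a" and C': "C' \<in> K'" "C' \<notin> SC"
    using KC by (auto simp: pointed_fields_def fields_def)
  note F1 = K a C and F2 = K' a C'
  have KPA: "PA C a = K" "PA C' a = K'" by (rule PA_field[OF F1] PA_field[OF F2])+
  have "i \<le> n \<Longrightarrow> kspan K i = kspan K' i \<and> (\<forall>x\<in>kspan K i. mv n C x = mv n C' x) \<and> code K a C i = code K' a C' i" for i
  proof (induction i)
    case (Suc i)
    then have i: "i < n" and IH: "kspan K i = kspan K' i" "\<forall>x\<in>kspan K i. mv n C x = mv n C' x"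
      "code K a C i = code K' a C' i" by auto
    let ?p = "\<lambda>C. map (\<lambda>t. mv n (mpow n C t) (unitv i)) [1..<a]"
    obtain zs where zs: "code K a C n = code K a C (Suc i) @ zs" using code_prefix[of "Suc i" n K a C] Suc.prems by blast
    obtain zs' where zs': "code K' a C' n = code K' a C' (Suc i) @ zs'" using code_prefix[of "Suc i" n K' a C'] Suc.prems by blast
    \<comment> \<open>Equal lengths make these prefixes of the common code equal.\<close>
    have eq: "code K a C (Suc i) = code K' a C' (Suc i)"
    proof -
      have "length (code K a C (Suc i)) = length (code K' a C' (Suc i))" using IH by simp
      then show ?thesis using code unfolding zs zs' by (metis append_eq_append_conv)
    qed
    show ?case
    proof (cases "unitv i \<in> kspan K i")
      case True
      interpret D: divop K "mv n" V by (rule divop_mv[OF K(1)])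
      interpret D': divop K' "mv n" V by (rule divop_mv[OF K'(1)])
      have u: "(unitv i :: nat \<Rightarrow> 'k) \<in> V" using unitv_V[OF i] .
      have sm: "D.submod (kspan K i)" "D'.submod (kspan K' i)"
        using kspan_facts[OF F1 _ refl, of i] kspan_facts[OF F2 _ refl, of i] i by auto
      have "D.extend (unitv i) (kspan K i) = kspan K i"
        using D.submod_extend(2)[OF sm(1) u] D.extend_least[OF sm(1) order_refl True] by blast
      moreover have "D'.extend (unitv i) (kspan K' i) = kspan K' i"
        using D'.submod_extend(2)[OF sm(2) u] D'.extend_least[OF sm(2) order_refl] True IH(1) by blast
      ultimately have "kspan K (Suc i) = kspan K i" "kspan K' (Suc i) = kspan K' i"
        by (simp_all add: D.extend_def D'.extend_def)
      then show ?thesis using IH eq by simp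
    next
      case False
      then have "?p C = ?p C'" using eq IH by simp
      then have "mv n (mpow n C t) (unitv i) = mv n (mpow n C' t) (unitv i)" if "1 \<le> t" "t < a" for t
        using that by auto
      then have pw: "mv n (mpow n C t) (unitv i) = mv n (mpow n C' t) (unitv i)" if "t < a" for t
        using that by (cases "t = 0") auto
      have cb: "mv n (comb n C b a) (unitv i) = mv n (comb n C' b a) (unitv i)" for b
        unfolding mv_comb using pw by (intro sum.cong) auto
      \<comment> \<open>The power with exponent \<open>a\<close> is not in the code; the common
        relation supplies it.\<close>
      have pwa: "mv n (mpow n C t) (unitv i) = mv n (mpow n C' t) (unitv i)" if "t \<le> a" for t
        using that pw cb[of c] c(2,3) by (cases "t = a") auto
      have ccb: "mv n C (mv n (comb n C b a) (unitv i)) = mv n C' (mv n (comb n C' b a) (unitv i))" for b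
      proof -
        have "mv n X (mv n (comb n X b a) (unitv i)) = (\<Sum>t<a. svec (b t) (mv n (mpow n X (Suc t)) (unitv i)))" for X
          unfolding mv_mm[symmetric] by (simp only: comb_def mm_sum_right mv_sum_left mm_smat_right mv_smat mpow.simps)
        then show ?thesis using pwa by (simp del: mpow.simps)
      qed
      have ks: "kspan K (Suc i) = {s + mv n (comb n C b a) (unitv i) | s b. s \<in> kspan K i \<and> (\<forall>t. b t \<in> F)}"
        "kspan K' (Suc i) = {s + mv n (comb n C' b a) (unitv i) | s b. s \<in> kspan K' i \<and> (\<forall>t. b t \<in> F)}"
        unfolding KPA[symmetric] kspan.simps PA_def by blast+
      have "kspan K (Suc i) = kspan K' (Suc i)" unfolding ks IH(1) cb ..
      moreover have "mv n C x = mv n C' x" if "x \<in> kspan K (Suc i)" for x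
        using that IH(2) ccb cb unfolding ks by (auto simp: mv_add)
      ultimately show ?thesis using eq by blast
    qed
  qed simp
  then have agree: "\<forall>x\<in>kspan K n. mv n C x = mv n C' x" by blast
  have "C = C'"
    by (rule mat_eqI[OF C_M[OF F1] C_M[OF F2]]) (use agree kspan_n[OF F1] unitv_V in blast)
  then show ?thesis using KPA by simp
qed

lemma card_fields:
  assumes a: "prime a" "n \<ge> 2" and m: "m = n div a" "m < n"
  shows "(q ^ a - q) * card (fields a) \<le> (q - 1)\<^sup>2 * q ^ (a - 2) * ((q ^ n - q) * (q ^ n) ^ (n - m - 1))"
proof -
  define B where "B = V - (\<lambda>c. svec c (unitv 0)) ` F"
  let ?L = "{xs. length xs = Suc (n - m - 1) \<and> set xs \<subseteq> V \<and> hd xs \<in> B}"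
  have u0: "(unitv 0 :: nat \<Rightarrow> 'k) \<in> V" using unitv_V n_ge_1 by simp
  have inj0: "inj_on (\<lambda>c. svec c (unitv 0 :: nat \<Rightarrow> 'k)) F"
  proof (rule inj_onI)
    fix c d :: 'k assume "svec c (unitv 0) = svec d (unitv 0)"
    from fun_cong[OF this, of 0] show "c = d" by (simp add: svec_def unitv_def)
  qed
  have cardB: "card B = q ^ n - q"
    unfolding B_def using inj0 u0 svec_V
    by (subst card_Diff_subset) (auto simp: card_image card_F card_V)
  have BV: "B \<subseteq> V" by (auto simp: B_def)
  have cardL: "card ?L = (q ^ n - q) * (q ^ n) ^ (n - m - 1)" "finite ?L"
    using card_lists_hd[OF finite_V BV, of "n - m - 1"] cardB by (simp_all add: card_V)
  have "\<forall>x\<in>pointed_fields a. \<exists>c\<in>coefs a. mpow n (snd x) a = comb n (snd x) c a"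
    using min_coefs a by (auto simp: pointed_fields_def fields_def)
  then obtain co where co: "\<And>x. x \<in> pointed_fields a \<Longrightarrow> co x \<in> coefs a \<and> mpow n (snd x) a = comb n (snd x) (co x) a"
    by metis
  define g where "g = (\<lambda>x. (co x, code (fst x) a (snd x) n))"
  have "inj_on g (pointed_fields a)"
  proof (rule inj_onI)
    fix x y assume xy: "x \<in> pointed_fields a" "y \<in> pointed_fields a" "g x = g y"
    have g: "co x = co y" "code (fst x) a (snd x) n = code (fst y) a (snd y) n" using xy(3) by (auto simp: g_def)
    have "(fst x, snd x) = (fst y, snd y)"
      by (rule pointed_fields_inj[OF a(1), of _ _ _ _ "co x"]) (use xy co g in auto)
    then show "x = y" by (simp add: prod_eq_iff)
  qed
  moreover have "g ` pointed_fields a \<subseteq> coefs a \<times> ?L"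
  proof
    fix z assume "z \<in> g ` pointed_fields a"
    then obtain x where x: "x \<in> pointed_fields a" "z = g x" by blast
    obtain K C where KC: "x = (K, C)" by fastforce
    have K: "is_field K" "card K = q ^ a" and C: "C \<in> K" "C \<notin> SC"
      using x by (auto simp: pointed_fields_def fields_def KC)
    note F1 = K a(1) C
    have "length (code K a C n) = Suc (n - m - 1)" using length_code[OF F1] m by simp
    moreover have "hd (code K a C n) \<in> B"
      unfolding hd_code[OF F1] B_def using mv_V[OF C_M[OF F1] u0] C_not_eigen[OF F1] by auto
    ultimately show "z \<in> coefs a \<times> ?L"
      using co[OF x(1)] code_in_V[OF F1 order_refl] by (auto simp: x(2) g_def KC)
  qed
  moreover have a2: "a \<ge> 2" using prime_ge_2_nat[OF a(1)] .
  ultimately have "card (pointed_fields a) \<le> card (coefs a \<times> ?L)"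
    using cardL(2) card_coefs(1) by (intro card_inj_on_le) auto
  also have "\<dots> = card (coefs a) * card ?L" by (rule card_cartesian_product)
  also have "\<dots> \<le> (q - 1)\<^sup>2 * q ^ (a - 2) * card ?L" using card_coefs(2)[OF a2] by (rule mult_le_mono1)
  finally show ?thesis unfolding card_pointed_fields cardL(1) by (simp add: mult_ac)
qed

text \<open>For \<open>n > 2\<close> the fields take up at most the fraction
  \<open>(q - 1) / q\<close> of the bound and the subspaces at most \<open>1 / q\<close>. For
  \<open>n = 2\<close> this is too crude; there are at most \<open>(q - 1)\<^sup>2\<close> fields
  and \<open>q + 1\<close> lines.\<close>

lemma cover_count:
  assumes a: "prime a" "a dvd n" and n2: "n \<ge> 2"
  shows "card small_mods + card (fields a) \<le> q ^ (n * (n - n div a))"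
proof -
  define m h x y where "m = n div a" and "h = n div 2" and "x = card (fields a)" and "y = card small_mods"
  have a2: "a \<ge> 2" using prime_ge_2_nat[OF a(1)] .
  have nm: "n = a * m" using a(2) by (simp add: m_def)
  have m1: "m \<ge> 1" using nm n2 by (cases m) auto
  have "2 * m \<le> n" unfolding nm using a2 by (rule mult_le_mono1)
  then have mh: "m + h \<le> n" "m < n" using m1 unfolding h_def by linarith+
  have h1: "h \<ge> 1" using n2 by (simp add: h_def)
  have Fx: "(q ^ a - q) * x \<le> (q - 1)\<^sup>2 * q ^ (a - 2) * ((q ^ n - q) * (q ^ n) ^ (n - m - 1))"
    unfolding x_def by (rule card_fields[OF a(1) n2 m_def mh(2)])
  have Wy: "(q - 1) * q ^ (h - 1) * y \<le> (q ^ n - 1) * (q ^ n) ^ (h - 1)"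
    unfolding y_def by (rule card_small_mods[OF h_def h1])
  have q: "q \<ge> 2" by (rule q_ge_2)
  \<comment> \<open>Bounding \<open>q ^ a - q\<close> below by \<open>(q - 1) * q ^ (a - 1)\<close>
    lets the common factor \<open>(q - 1) * q ^ (a - 2)\<close> cancel.\<close>
  have Fx': "q * x \<le> (q - 1) * ((q ^ n - q) * (q ^ n) ^ (n - m - 1))"
  proof -
    have "q ^ 1 \<le> q ^ (a - 1)" using a2 q by (intro power_increasing) auto
    moreover have "q ^ a = q * q ^ (a - 1)" using a2 by (cases a) auto
    ultimately have "(q - 1) * q ^ (a - 1) \<le> q ^ a - q" by (simp add: diff_mult_distrib)
    then have "(q - 1) * q ^ (a - 1) * x \<le> (q ^ a - q) * x" by (rule mult_le_mono1)
    also note Fx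
    finally have "((q - 1) * q ^ (a - 2)) * (q * x) \<le> ((q - 1) * q ^ (a - 2)) * ((q - 1) * ((q ^ n - q) * (q ^ n) ^ (n - m - 1)))"
      using a2 power_Suc[of q "a - 2"] by (simp add: power2_eq_square mult_ac Suc_diff_Suc numeral_2_eq_2)
    then show ?thesis using q by simp
  qed
  have "x + y \<le> q ^ (n * (n - m))"
  proof (cases "n = 2")
    case True
    have "m = 1" "h = 1" using mh m1 True by (auto simp: h_def)
    obtain r where r: "q = Suc r" "r \<ge> 1" using q by (cases q) auto
    have "q * x \<le> r * (q ^ 2 - q)" using Fx' True \<open>m = 1\<close> r by simp
    also have "q ^ 2 - q = q * r" by (simp add: r power2_eq_square)
    finally have "x \<le> r * r" using q by simp
    moreover have "r * y \<le> q ^ 2 - 1" using Wy True \<open>h = 1\<close> r by simp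
    then have "r * y \<le> r * (r + 2)" by (simp add: r power2_eq_square)
    then have "y \<le> r + 2" by (rule mult_left_le_imp_le) (use r in simp)
    ultimately show ?thesis using True \<open>m = 1\<close> r by (simp add: power2_eq_square)
  next
    case False
    define X where "X = q ^ (n * (n - m))"
    have X: "X = q ^ n * (q ^ n) ^ (n - m - 1)"
    proof -
      have "n - m = Suc (n - m - 1)" using mh by simp
      then show ?thesis unfolding X_def power_mult by (metis power_Suc)
    qed
    have qx: "q * x \<le> (q - 1) * X"
      using Fx' unfolding X by (rule order_trans) (intro mult_le_mono diff_le_self order_refl)
    \<comment> \<open>For \<open>h = 1\<close> the factor \<open>q ^ (h - 1)\<close> gains nothing;
      with \<open>n \<noteq> 2\<close> this means \<open>n = 3\<close>, where
      \<open>X = q ^ 6\<close> is ample.\<close>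
    have qy: "q * y \<le> X"
    proof (cases "h = 1")
      case True
      then have n3: "n = 3" using n2 False by (simp add: h_def)
      have "m = 1" using m1 n3 \<open>2 * m \<le> n\<close> by simp
      have "1 * y \<le> (q - 1) * y" using q by (intro mult_le_mono1) auto
      also have "\<dots> \<le> q ^ 3" using Wy True n3 by simp
      finally have "q * y \<le> q ^ 4" by (simp add: numeral_eq_Suc)
      also have "\<dots> \<le> q ^ 6" using q by (intro power_increasing) auto
      finally show ?thesis unfolding X_def using n3 \<open>m = 1\<close> by simp
    next
      case False
      then have "q ^ 1 \<le> q ^ (h - 1)" using h1 q by (intro power_increasing) auto
      then have "1 * q \<le> (q - 1) * q ^ (h - 1)" using q by (intro mult_le_mono) auto
      then have "q * y \<le> (q - 1) * q ^ (h - 1) * y" by (intro mult_le_mono1) simp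
      also note Wy
      also have "(q ^ n - 1) * (q ^ n) ^ (h - 1) \<le> q ^ n * (q ^ n) ^ (h - 1)" by (intro mult_le_mono1) simp
      also have "\<dots> = (q ^ n) ^ h" using h1 by (cases h) auto
      also have "\<dots> \<le> (q ^ n) ^ (n - m)" using q mh by (intro power_increasing) auto
      finally show ?thesis by (simp add: X_def power_mult)
    qed
    have "q * (x + y) \<le> (q - 1) * X + X" using qx qy by (simp add: distrib_left)
    also have "\<dots> = q * X" using q by (cases q) auto
    finally show ?thesis using q by (simp add: X_def)
  qed
  then show ?thesis by (simp add: x_def y_def m_def add.commute)
qed

end

section \<open>Covers\<close>

lemma sigma_le: "is_cover C R \<Longrightarrow> finite C \<Longrightarrow> sigma R \<le> enat (card C)"
  unfolding sigma_def by (rule INF_lower2[of C]) auto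

lemma sigma_geI:
  assumes "\<And>C. is_cover C R \<Longrightarrow> finite C \<Longrightarrow> k \<le> enat (card C)"
  shows "k \<le> sigma R"
  unfolding sigma_def by (rule INF_greatest) (use assms in auto)

text \<open>Preimages of the members of a cover form a cover. The operations on both sides are kept
  abstract so that quotients by ideals are included.\<close>

lemma sigma_hom:
  assumes f: "f ` rcarrier R' = rcarrier R" and cl: "subrng (rcarrier R') R'"
    and add: "\<And>x y. x \<in> rcarrier R' \<Longrightarrow> y \<in> rcarrier R' \<Longrightarrow> f (radd R' x y) = radd R (f x) (f y)"
    and mul: "\<And>x y. x \<in> rcarrier R' \<Longrightarrow> y \<in> rcarrier R' \<Longrightarrow> f (rmult R' x y) = rmult R (f x) (f y)"
    and neg: "\<And>x. x \<in> rcarrier R' \<Longrightarrow> f (rneg R' x) = rneg R (f x)" and zero: "f (rzero R') = rzero R"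
  shows "sigma R' \<le> sigma R"
proof (rule sigma_geI)
  fix C assume C: "is_cover C R" "finite C"
  define g where "g = (\<lambda>S. {x \<in> rcarrier R'. f x \<in> S})"
  have sub: "subrng (g S) R' \<and> g S \<noteq> rcarrier R'" if "S \<in> C" for S
  proof
    have S: "subrng S R" "S \<noteq> rcarrier R" using conjunct1[OF C(1)[unfolded is_cover_def]] that by simp_all
    show "subrng (g S) R'"
      unfolding subrng_def
    proof (intro conjI ballI)
      show "g S \<subseteq> rcarrier R'" by (auto simp: g_def)
      show "rzero R' \<in> g S" using S(1) cl by (simp add: subrng_def g_def zero)
      fix x y assume "x \<in> g S" "y \<in> g S"
      then have x: "x \<in> rcarrier R'" "f x \<in> S" and y: "y \<in> rcarrier R'" "f y \<in> S" by (auto simp: g_def)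
      have "radd R' x y \<in> rcarrier R'" "rmult R' x y \<in> rcarrier R'" using cl x y by (auto simp: subrng_def)
      moreover have "f (radd R' x y) \<in> S" "f (rmult R' x y) \<in> S"
        using S(1) x y unfolding add[OF x(1) y(1)] mul[OF x(1) y(1)] by (auto simp: subrng_def)
      ultimately show "radd R' x y \<in> g S" "rmult R' x y \<in> g S" by (auto simp: g_def)
    next
      fix x assume "x \<in> g S"
      then have x: "x \<in> rcarrier R'" "f x \<in> S" by (auto simp: g_def)
      then show "rneg R' x \<in> g S" using S(1) cl neg[OF x(1)] by (simp add: subrng_def g_def)
    qed
    have "S \<subseteq> rcarrier R" using S by (simp add: subrng_def)
    then obtain y where "y \<in> rcarrier R" "y \<notin> S" using S(2) by blast
    then obtain x where "x \<in> rcarrier R'" "f x \<notin> S" unfolding f[symmetric] by (auto elim: imageE)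
    then show "g S \<noteq> rcarrier R'" by (auto simp: g_def)
  qed
  have "rcarrier R' \<subseteq> \<Union> (g ` C)"
  proof
    fix x assume x: "x \<in> rcarrier R'"
    then have "f x \<in> rcarrier R" unfolding f[symmetric] by (rule imageI)
    then have "f x \<in> \<Union> C" using C(1) unfolding is_cover_def by (elim conjE) (simp only:)
    then show "x \<in> \<Union> (g ` C)" using x by (auto simp: g_def)
  qed
  moreover have "\<Union> (g ` C) \<subseteq> rcarrier R'" by (auto simp: g_def)
  ultimately have "\<Union> (g ` C) = rcarrier R'" by (rule antisym[rotated])
  moreover have "subrng T R' \<and> T \<noteq> rcarrier R'" if "T \<in> g ` C" for T using that by (rule imageE) (simp add: sub)
  ultimately have "is_cover (g ` C) R'" by (simp add: is_cover_def)
  then have "sigma R' \<le> enat (card (g ` C))" using finite_imageI[OF C(2)] by (rule sigma_le)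
  also have "\<dots> \<le> enat (card C)" using card_image_le[OF C(2)] by simp
  finally show "sigma R' \<le> enat (card C)" .
qed

text \<open>A proper subring contains at most one element of \<open>Y\<close>.\<close>

lemma sigma_ge_card:
  assumes Y: "finite Y" "Y \<subseteq> rcarrier R"
    and gen: "\<And>x y T. x \<in> Y \<Longrightarrow> y \<in> Y \<Longrightarrow> x \<noteq> y \<Longrightarrow> subrng T R \<Longrightarrow> x \<in> T \<Longrightarrow> y \<in> T \<Longrightarrow> T = rcarrier R"
  shows "enat (card Y) \<le> sigma R"
proof (rule sigma_geI)
  fix C assume C: "is_cover C R" "finite C"
  have "\<forall>y\<in>Y. \<exists>T\<in>C. y \<in> T" using C Y by (auto simp: is_cover_def)
  then obtain t where t: "\<And>y. y \<in> Y \<Longrightarrow> t y \<in> C \<and> y \<in> t y" by metis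
  have "inj_on t Y"
  proof (rule inj_onI, rule ccontr)
    fix x y assume *: "x \<in> Y" "y \<in> Y" "t x = t y" "x \<noteq> y"
    have "t x = rcarrier R" by (rule gen[OF *(1,2,4)]) (use t * C in \<open>auto simp: is_cover_def\<close>)
    then show False using t[OF *(1)] C by (auto simp: is_cover_def)
  qed
  then have "card Y \<le> card C" using C t by (intro card_inj_on_le[of t]) auto
  then show "enat (card Y) \<le> enat (card C)" by simp
qed

lemma mat_rng_on_sel [simp]:
  "rcarrier (mat_rng_on m S) = S" "rmult (mat_rng_on m S) = mm m" "rzero (mat_rng_on m S) = 0"
  "radd (mat_rng_on m S) A B = A + B" "rneg (mat_rng_on m S) A = - A"
  by (simp_all add: mat_rng_on_def mm_def zero_fun_def plus_fun_def fun_Compl_def fun_eq_iff)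

lemma subrng_mat_rng_on:
  "subrng T (mat_rng_on m S) \<longleftrightarrow> T \<subseteq> S \<and> add_grp T \<and> (\<forall>A\<in>T. \<forall>B\<in>T. mm m A B \<in> T)"
proof
  assume "subrng T (mat_rng_on m S)"
  then have *: "T \<subseteq> S" "0 \<in> T" "\<And>x y. x \<in> T \<Longrightarrow> y \<in> T \<Longrightarrow> x + y \<in> T \<and> mm m x y \<in> T" "\<And>x. x \<in> T \<Longrightarrow> - x \<in> T"
    unfolding subrng_def mat_rng_on_sel by blast+
  then show "T \<subseteq> S \<and> add_grp T \<and> (\<forall>A\<in>T. \<forall>B\<in>T. mm m A B \<in> T)"
    using add_grpI[of T] by blast
next
  assume *: "T \<subseteq> S \<and> add_grp T \<and> (\<forall>A\<in>T. \<forall>B\<in>T. mm m A B \<in> T)"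
  then have "add_grp T" by blast
  note g = add_grpD[OF this]
  show "subrng T (mat_rng_on m S)"
    unfolding subrng_def mat_rng_on_sel using * g(1,3,4) by blast
qed

section \<open>A cover of the full matrix ring by stabilizers and centralizers\<close>

context fmat
begin

interpretation FV: divop F svec V by (rule divop_F_V)

definition stab :: "(nat \<Rightarrow> 'k) set \<Rightarrow> (nat \<Rightarrow> nat \<Rightarrow> 'k) set" where
  "stab W = {X \<in> M. \<forall>w\<in>W. mv n X w \<in> W}"

definition cent :: "(nat \<Rightarrow> nat \<Rightarrow> 'k) set \<Rightarrow> (nat \<Rightarrow> nat \<Rightarrow> 'k) set" where
  "cent K = {X \<in> M. \<forall>C\<in>K. mm n X C = mm n C X}"

lemma stab_proper:
  assumes W: "W \<in> small_mods"
  shows "subrng (stab W) (mat_rng_on n M)" "stab W \<noteq> M"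
proof -
  have sm: "FV.submod W" and W0: "W \<noteq> {0}" and le: "card W ^ 2 \<le> q ^ n" using W by (auto simp: small_mods_def)
  have WV: "W \<subseteq> V" and g: "add_grp W" using sm by (auto simp: FV.submod_def)
  show "subrng (stab W) (mat_rng_on n M)"
    unfolding subrng_mat_rng_on using add_grpD[OF grp_M] add_grpD[OF g]
    by (auto simp: stab_def add_grp_def mv_diff_left mv_mm mm_M)
  obtain w where w: "w \<in> W" "w \<noteq> 0" using W0 add_grpD(1)[OF g] by blast
  then obtain i where i: "w i \<noteq> 0" by (auto simp: fun_eq_iff)
  then have "i < n" using w WV by (auto simp: V_def subset_eq)
  have "W \<noteq> V"
  proof
    assume "W = V"
    then have "q ^ (n * 2) \<le> q ^ n" using le card_V by (simp add: power_mult)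
    then show False using q_ge_2 n_ge_1 by (simp add: power_increasing_iff)
  qed
  then obtain u where u: "u \<in> V" "u \<notin> W" using WV by blast
  \<comment> \<open>All columns but the \<open>i\<close>-th are zero, and the scaling makes
    \<open>X\<close> send \<open>w\<close> to \<open>u\<close>, out of \<open>W\<close>.\<close>
  define X where "X = (\<lambda>r s. if s = i then inverse (w i) * u r else 0)"
  have XM: "X \<in> M" using u \<open>i < n\<close> w WV by (auto simp: M_def X_def V_def F_mult F_inverse)
  have "mv n X w = u"
  proof
    fix r
    have "mv n X w r = (\<Sum>k<n. if k = i then u r else 0)"
      unfolding mv_def X_def by (intro sum.cong) (use i in auto)
    then show "mv n X w r = u r" using \<open>i < n\<close> by simp
  qed
  then have "X \<notin> stab W" using u w by (auto simp: stab_def)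
  then show "stab W \<noteq> M" using XM by blast
qed

text \<open>Commuting with the matrix units in column 0 equates the diagonal entries; commuting with
  the diagonal matrix units kills the others.\<close>

lemma commutes_all:
  assumes C: "C \<in> M" and comm: "\<And>X. X \<in> M \<Longrightarrow> mm n X C = mm n C X"
  shows "C \<in> SC"
proof -
  have e: "mm n (unitm i j) C r s = (if r = i then C j s else 0)" if "i < n" "j < n" for i j r s
  proof -
    have "mm n (unitm i j) C r s = (\<Sum>k<n. if k = j then (if r = i then C j s else 0) else 0)"
      unfolding mm_def unitm_def by (intro sum.cong) auto
    then show ?thesis using that by simp
  qed
  have e': "mm n C (unitm i j) r s = (if s = j then C r i else 0)" if "i < n" "j < n" for i j r s
  proof -
    have "mm n C (unitm i j) r s = (\<Sum>k<n. if k = i then (if s = j then C r i else 0) else 0)"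
      unfolding mm_def unitm_def by (intro sum.cong) auto
    then show ?thesis using that by simp
  qed
  have eq: "(if r = i then C j s else 0) = (if s = j then C r i else 0)" if "i < n" "j < n" for i j r s
    unfolding e[OF that, symmetric] e'[OF that, symmetric] by (simp only: comm[OF unitm_M[OF that]])
  have "C = smat (C 0 0) (idm n)"
  proof (intro ext)
    fix r s
    show "C r s = smat (C 0 0) (idm n) r s"
    proof (cases "r < n \<and> s < n")
      case True
      show ?thesis
      proof (cases "r = s")
        case True
        then show ?thesis using eq[of r 0 r 0] \<open>r < n \<and> s < n\<close> by (auto simp: smat_def idm_def)
      next
        case False
        then show ?thesis using eq[of s s r s] True by (auto simp: smat_def idm_def)
      qed
    next
      case False
      then show ?thesis using C by (auto simp: M_def smat_def idm_def)
    qed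
  qed
  moreover have "C 0 0 \<in> F" using C by (simp add: M_def)
  ultimately show ?thesis unfolding SC_def by blast
qed

text \<open>Only scalar matrices commute with everything, and \<open>K\<close> has more than
  \<open>q\<close> elements.\<close>

lemma cent_proper:
  assumes K: "K \<in> fields a" and a: "a \<ge> 2"
  shows "subrng (cent K) (mat_rng_on n M)" "cent K \<noteq> M"
proof -
  have KM: "K \<subseteq> M" and cK: "card K = q ^ a" using K by (auto simp: fields_def is_field_def)
  show "subrng (cent K) (mat_rng_on n M)"
    unfolding subrng_mat_rng_on add_grp_def
  proof (intro conjI ballI)
    show "cent K \<subseteq> M" by (auto simp: cent_def)
    show "0 \<in> cent K" using add_grpD(1)[OF grp_M] by (simp add: cent_def)
    fix A B assume AB: "A \<in> cent K" "B \<in> cent K"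
    then show "A - B \<in> cent K" using add_grpD(2)[OF grp_M] by (auto simp: cent_def mm_diff_left mm_diff_right)
    show "mm n A B \<in> cent K" using AB mm_M by (auto simp: cent_def) (metis mm_assoc)
  qed
  show "cent K \<noteq> M"
  proof
    assume "cent K = M"
    then have "mm n X C = mm n C X" if "C \<in> K" "X \<in> M" for C X
      using that by (auto simp: cent_def)
    then have "K \<subseteq> SC" using commutes_all KM by blast
    then have "q ^ a \<le> q ^ 1" using card_mono[of SC K] cK card_SC by (auto simp: SC_def)
    then show False using a q_ge_2 by (simp only: power_increasing_iff)
  qed
qed

lemma sigma_full_mat_le:
  assumes a: "prime a" "a dvd n" and n2: "n \<ge> 2"
    and q: "q = CHAR('k) ^ e" and Fq: "\<And>c. c \<in> F \<Longrightarrow> c ^ q = c" and ch: "CHAR('k) > 0"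
  shows "sigma (mat_rng_on n M) \<le> enat (q ^ (n * (n - n div a)))"
proof -
  have a2: "a \<ge> 2" using prime_ge_2_nat[OF a(1)] .
  let ?C = "stab ` small_mods \<union> cent ` fields a"
  have fin: "finite small_mods"
    by (rule finite_subset[of _ "Pow V"]) (auto simp: small_mods_def FV.submod_def finite_V)
  have "A \<in> \<Union> ?C" if A: "A \<in> M" for A
  proof (cases "\<exists>W\<in>small_mods. \<forall>w\<in>W. mv n A w \<in> W")
    case True then show ?thesis using A by (auto simp: stab_def)
  next
    case False
    then obtain K where "is_field K" "card K = q ^ a" "\<forall>C\<in>K. mm n A C = mm n C A"
      using subfield_of_centralizer[OF A _ _ a(2) q Fq ch] a2 by auto
    then show ?thesis using A by (auto simp: cent_def fields_def)
  qed
  moreover have "\<Union> ?C \<subseteq> M" by (auto simp: stab_def cent_def)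
  ultimately have "\<Union> ?C = M" by blast
  moreover have "subrng T (mat_rng_on n M) \<and> T \<noteq> M" if "T \<in> ?C" for T
    using that stab_proper cent_proper[OF _ a2] by (elim UnE imageE) simp_all
  ultimately have "is_cover ?C (mat_rng_on n M)" by (simp add: is_cover_def)
  then have "sigma (mat_rng_on n M) \<le> enat (card ?C)" using fin finite_fields by (intro sigma_le) auto
  also have "card ?C \<le> card small_mods + card (fields a)"
    using card_Un_le[of "stab ` small_mods" "cent ` fields a"] card_image_le[OF fin, of stab]
      card_image_le[OF finite_fields, of cent a] by linarith
  also have "\<dots> \<le> q ^ (n * (n - n div a))" by (rule cover_count[OF a n2])
  finally show ?thesis by simp
qed

end

section \<open>Block triangular rings with n at least 2\<close>

lemma rrep_in: "x \<in> X \<Longrightarrow> rrep X \<in> X"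
  unfolding rrep_def by (rule someI)

text \<open>Representatives of a coset differ by elements of \<open>I\<close>, which
  \<open>h\<close> kills. Evaluating \<open>h\<close> at the chosen representative is thus a
  homomorphism from the quotient onto the image.\<close>

lemma sigma_quot_le:
  assumes h: "h ` S = S'" and S: "subrng S (mat_rng_on m S)" and I: "I \<subseteq> S" "add_grp I"
    and add: "\<And>x y. x \<in> S \<Longrightarrow> y \<in> S \<Longrightarrow> h (x + y) = h x + h y"
    and mul: "\<And>x y. x \<in> S \<Longrightarrow> y \<in> S \<Longrightarrow> h (mm m x y) = mm m' (h x) (h y)"
    and ker: "\<And>x. x \<in> I \<Longrightarrow> h x = 0"
  shows "sigma (rquot (mat_rng_on m S) I) \<le> sigma (mat_rng_on m' S')"
proof (rule sigma_hom[where f = "\<lambda>X. h (rrep X)"])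
  let ?R = "mat_rng_on m S"
  have gS: "add_grp S" and mS: "\<And>x y. x \<in> S \<Longrightarrow> y \<in> S \<Longrightarrow> mm m x y \<in> S"
    using S by (auto simp: subrng_mat_rng_on)
  have hneg: "h (- x) = - h x" if "x \<in> S" for x
  proof -
    have "h x + h (- x) = h 0" using add[OF that add_grpD(3)[OF gS that]] by (simp only: right_minus)
    also have "\<dots> = 0" using ker add_grpD(1)[OF I(2)] by blast
    finally show ?thesis by (simp only: add_eq_0_iff)
  qed
  have rep: "rrep (rcoset ?R I x) \<in> S \<and> h (rrep (rcoset ?R I x)) = h x" if "x \<in> S" for x
  proof -
    have "x + 0 \<in> rcoset ?R I x" unfolding rcoset_def mat_rng_on_sel using add_grpD(1)[OF I(2)] by blast
    then have "rrep (rcoset ?R I x) \<in> rcoset ?R I x" by (rule rrep_in)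
    then obtain i where i: "i \<in> I" "rrep (rcoset ?R I x) = x + i" by (auto simp: rcoset_def)
    then have "h (x + i) = h x" using add[of x i] that I(1) ker[OF i(1)] by (simp only: subset_iff add_0_right)
    moreover have "x + i \<in> S" using add_grpD(4)[OF gS that] I(1) i(1) by blast
    ultimately show ?thesis using i by simp
  qed
  have I0: "I = rcoset ?R I 0" by (simp only: rcoset_def mat_rng_on_sel add_0_left) simp
  have carr: "rcarrier (rquot ?R I) = rcoset ?R I ` S" by (auto simp: rquot_def)
  have repS: "rrep X \<in> S" if "X \<in> rcarrier (rquot ?R I)" for X using that rep by (auto simp: carr)
  show "(\<lambda>X. h (rrep X)) ` rcarrier (rquot ?R I) = rcarrier (mat_rng_on m' S')"
    unfolding carr image_image mat_rng_on_sel h[symmetric] using rep by (intro image_cong refl) blast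
  show "subrng (rcarrier (rquot ?R I)) (rquot ?R I)"
    unfolding subrng_def
  proof (intro conjI ballI)
    show "rzero (rquot ?R I) \<in> rcarrier (rquot ?R I)"
      unfolding carr using I0 add_grpD(1)[OF gS] by (auto simp: rquot_def)
    fix X Y assume XY: "X \<in> rcarrier (rquot ?R I)" "Y \<in> rcarrier (rquot ?R I)"
    show "radd (rquot ?R I) X Y \<in> rcarrier (rquot ?R I)" "rmult (rquot ?R I) X Y \<in> rcarrier (rquot ?R I)"
      unfolding carr using repS[OF XY(1)] repS[OF XY(2)] add_grpD(4)[OF gS] mS by (auto simp: rquot_def)
  next
    fix X assume X: "X \<in> rcarrier (rquot ?R I)"
    show "rneg (rquot ?R I) X \<in> rcarrier (rquot ?R I)"
      unfolding carr using repS[OF X] add_grpD(3)[OF gS] by (auto simp: rquot_def)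
  qed simp
  fix X Y assume XY: "X \<in> rcarrier (rquot ?R I)" "Y \<in> rcarrier (rquot ?R I)"
  show "h (rrep (radd (rquot ?R I) X Y)) = radd (mat_rng_on m' S') (h (rrep X)) (h (rrep Y))"
    using rep[OF add_grpD(4)[OF gS repS[OF XY(1)] repS[OF XY(2)]]] add[OF repS[OF XY(1)] repS[OF XY(2)]]
    by (simp add: rquot_def)
  show "h (rrep (rmult (rquot ?R I) X Y)) = rmult (mat_rng_on m' S') (h (rrep X)) (h (rrep Y))"
    using rep[OF mS[OF repS[OF XY(1)] repS[OF XY(2)]]] mul[OF repS[OF XY(1)] repS[OF XY(2)]]
    by (simp add: rquot_def)
  show "h (rrep (rneg (rquot ?R I) X)) = rneg (mat_rng_on m' S') (h (rrep X))"
    using rep[OF add_grpD(3)[OF gS repS[OF XY(1)]]] hneg[OF repS[OF XY(1)]]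
    by (simp add: rquot_def)
next
  show "h (rrep (rzero (rquot (mat_rng_on m S) I))) = rzero (mat_rng_on m' S')"
  proof -
    have "rrep I \<in> I" using add_grpD(1)[OF I(2)] by (rule rrep_in)
    then show ?thesis using ker by (simp add: rquot_def)
  qed
qed

definition blk :: "nat \<Rightarrow> (nat \<Rightarrow> nat \<Rightarrow> 'k::field) \<Rightarrow> (nat \<Rightarrow> 'k) \<Rightarrow> 'k \<Rightarrow> nat \<Rightarrow> nat \<Rightarrow> 'k" where
  "blk n A v b = (\<lambda>i j. if i < n then if j < n then A i j else if j = n then v i else 0
     else if i = n \<and> j = n then b else 0)"

definition cut :: "nat \<Rightarrow> (nat \<Rightarrow> nat \<Rightarrow> 'k::field) \<Rightarrow> nat \<Rightarrow> nat \<Rightarrow> 'k" where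
  "cut n X = (\<lambda>i j. if i < n \<and> j < n then X i j else 0)"

lemma blk_add: "blk n A v b + blk n A' v' b' = blk n (A + A') (v + v') (b + b')"
  by (simp add: blk_def fun_eq_iff)

lemma blk_diff: "blk n A v b - blk n A' v' b' = blk n (A - A') (v - v') (b - b')"
  by (simp add: blk_def fun_eq_iff)

lemma blk_0: "blk n 0 0 0 = 0"
  by (simp add: blk_def fun_eq_iff)

lemma blk_mm: "mm (n + 1) (blk n A v b) (blk n A' v' b') = blk n (mm n A A') (mv n A v' + svec b' v) (b * b')"
  by (intro ext) (simp add: mm_def mv_def blk_def svec_def mult.commute)

lemma cut_add: "cut n (X + Y) = cut n X + cut n Y"
  and cut_diff: "cut n (X - Y) = cut n X - cut n Y"
  by (simp_all add: cut_def fun_eq_iff)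

definition colsp :: "nat \<Rightarrow> (nat \<Rightarrow> 'k::field) set" where
  "colsp n = {v. \<forall>i\<ge>n. v i = 0}"

lemma colsp_closed:
  "0 \<in> colsp n" "v \<in> colsp n \<Longrightarrow> w \<in> colsp n \<Longrightarrow> v + w \<in> colsp n" "v \<in> colsp n \<Longrightarrow> w \<in> colsp n \<Longrightarrow> v - w \<in> colsp n"
  "v \<in> colsp n \<Longrightarrow> svec c v \<in> colsp n" "i < n \<Longrightarrow> unitv i \<in> colsp n"
  by (simp_all add: colsp_def svec_def unitv_def)

lemma card_colsp:
  assumes "n \<ge> 1"
  shows "card (colsp n :: (nat \<Rightarrow> 'k::{finite,field}) set) = card (UNIV :: 'k set) ^ n" "finite (colsp n :: (nat \<Rightarrow> 'k) set)"
proof -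
  interpret fmat "UNIV :: 'k set" "card (UNIV :: 'k set)" n by standard (use assms in auto)
  have "V = colsp n" by (simp add: V_def colsp_def)
  then show "card (colsp n :: (nat \<Rightarrow> 'k) set) = card (UNIV :: 'k set) ^ n" "finite (colsp n :: (nat \<Rightarrow> 'k) set)"
    using card_V finite_V by auto
qed

text \<open>\<open>FG\<close> says that multiplication by \<open>F\<close> and \<open>G\<close>
  leaves no proper nonzero subgroup of the ambient field stable. In this form the least common
  multiple in the order of that field is used; \<open>subfields_span\<close> derives it.\<close>

locale blkring = fmat F q n for F :: "'k::{finite,field} set" and q n +
  fixes G :: "'k set" and b0 :: 'k
  assumes n2: "n \<ge> 2" and b0: "b0 \<noteq> 0" "G = insert 0 {b0 ^ i | i::nat. True}"
    and G_add: "x \<in> G \<Longrightarrow> y \<in> G \<Longrightarrow> x + y \<in> G" and G_minus: "x \<in> G \<Longrightarrow> - x \<in> G"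
    and G_mult: "x \<in> G \<Longrightarrow> y \<in> G \<Longrightarrow> x * y \<in> G" and G_inverse: "x \<in> G \<Longrightarrow> inverse x \<in> G"
    and FG: "\<And>Z c. add_grp Z \<Longrightarrow> (\<And>x z. x \<in> F \<union> G \<Longrightarrow> z \<in> Z \<Longrightarrow> x * z \<in> Z) \<Longrightarrow> c \<in> Z \<Longrightarrow> c \<noteq> 0 \<Longrightarrow> Z = UNIV"
begin

definition BR :: "(nat \<Rightarrow> nat \<Rightarrow> 'k) set" where
  "BR = {blk n A v b | A v b. A \<in> M \<and> v \<in> colsp n \<and> b \<in> G}"

lemma BRI: "A \<in> M \<Longrightarrow> v \<in> colsp n \<Longrightarrow> b \<in> G \<Longrightarrow> blk n A v b \<in> BR"
  by (auto simp: BR_def)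

lemma BRE: assumes "X \<in> BR" obtains A v b where "X = blk n A v b" "A \<in> M" "v \<in> colsp n" "b \<in> G"
  using assms by (auto simp: BR_def)

lemma G_0: "0 \<in> G" by (simp add: b0)

lemma b0_G: "b0 \<in> G"
proof -
  have "b0 ^ 1 \<in> G" unfolding b0(2) by blast
  then show ?thesis by simp
qed

lemma G_diff: "x \<in> G \<Longrightarrow> y \<in> G \<Longrightarrow> x - y \<in> G"
  using G_add[of x "- y"] G_minus by simp

lemma mv_colsp: "A \<in> M \<Longrightarrow> mv n A v \<in> colsp n"
  by (auto simp: M_def mv_def colsp_def)

lemma subrng_BR: "subrng BR (mat_rng_on (n + 1) BR)"
  unfolding subrng_mat_rng_on add_grp_def
proof (intro conjI ballI)
  show "0 \<in> BR" using BRI[OF add_grpD(1)[OF grp_M] colsp_closed(1) G_0] by (simp only: blk_0)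
  fix X Y assume "X \<in> BR" "Y \<in> BR"
  then obtain A v b A' v' b' where X: "X = blk n A v b" "A \<in> M" "v \<in> colsp n" "b \<in> G"
    and Y: "Y = blk n A' v' b'" "A' \<in> M" "v' \<in> colsp n" "b' \<in> G" by (elim BRE)
  show "X - Y \<in> BR" unfolding X(1) Y(1) blk_diff
    by (intro BRI add_grpD(2)[OF grp_M] colsp_closed G_diff X Y)
  show "mm (n + 1) X Y \<in> BR" unfolding X(1) Y(1) blk_mm
    by (intro BRI mm_M colsp_closed mv_colsp G_mult X Y)
qed simp

lemma cut_blk: "A \<in> M \<Longrightarrow> cut n (blk n A v b) = A"
  by (auto simp: cut_def blk_def M_def fun_eq_iff)

lemma cut_BR: "cut n ` BR = M"
proof
  show "cut n ` BR \<subseteq> M" by (auto elim!: BRE simp: cut_blk)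
  show "M \<subseteq> cut n ` BR"
  proof
    fix A assume "A \<in> M"
    then show "A \<in> cut n ` BR"
      using BRI[OF _ colsp_closed(1) G_0, of A] cut_blk[of A 0 0] by (metis imageI)
  qed
qed

lemma cut_mult: "X \<in> BR \<Longrightarrow> Y \<in> BR \<Longrightarrow> cut n (mm (n + 1) X Y) = mm n (cut n X) (cut n Y)"
  by (elim BRE) (simp only: blk_mm cut_blk mm_M)

text \<open>The kernel of the projection to the matrix block; the corner entries belong to it as
  well as the columns.\<close>

definition ker :: "(nat \<Rightarrow> nat \<Rightarrow> 'k) set" where
  "ker = {blk n 0 v b | v b. v \<in> colsp n \<and> b \<in> G}"

lemma ker_ideal: "rideal ker (mat_rng_on (n + 1) BR)" "ker \<noteq> {0}" "ker \<subseteq> BR" "add_grp ker" "x \<in> ker \<Longrightarrow> cut n x = 0"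
proof -
  have M0: "0 \<in> M" using add_grpD(1)[OF grp_M] .
  show sub: "ker \<subseteq> BR" using BRI[OF M0] by (auto simp: ker_def)
  show grp: "add_grp ker"
    unfolding add_grp_def
  proof (intro conjI ballI)
    show "0 \<in> ker" unfolding ker_def using blk_0[of n] colsp_closed(1) G_0 by (metis (mono_tags, lifting) mem_Collect_eq)
    fix X Y assume "X \<in> ker" "Y \<in> ker"
    then obtain v b v' b' where "X = blk n 0 v b" "v \<in> colsp n" "b \<in> G" "Y = blk n 0 v' b'" "v' \<in> colsp n" "b' \<in> G"
      by (auto simp: ker_def)
    then have "X - Y = blk n 0 (v - v') (b - b') \<and> v - v' \<in> colsp n \<and> b - b' \<in> G"
      by (simp only: blk_diff diff_0_right colsp_closed G_diff simp_thms)
    then show "X - Y \<in> ker" unfolding ker_def by blast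
  qed
  have mul: "mm (n + 1) X Y \<in> ker \<and> mm (n + 1) Y X \<in> ker" if XY: "X \<in> BR" "Y \<in> ker" for X Y
  proof -
    obtain A v b where X: "X = blk n A v b" "A \<in> M" "v \<in> colsp n" "b \<in> G" using XY(1) by (rule BRE)
    obtain v' b' where Y: "Y = blk n 0 v' b'" "v' \<in> colsp n" "b' \<in> G" using XY(2) by (auto simp: ker_def)
    have "mm (n + 1) X Y = blk n 0 (mv n A v' + svec b' v) (b * b')"
      "mm (n + 1) Y X = blk n 0 (svec b v') (b' * b)"
      unfolding X(1) Y(1) blk_mm by (simp_all only: mm_zero mv_zero add_0_left)
    moreover have "mv n A v' + svec b' v \<in> colsp n" "svec b v' \<in> colsp n" "b * b' \<in> G" "b' * b \<in> G"
      by (intro colsp_closed mv_colsp G_mult X Y)+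
    ultimately show ?thesis unfolding ker_def by blast
  qed
  show "rideal ker (mat_rng_on (n + 1) BR)"
    unfolding rideal_def subrng_mat_rng_on mat_rng_on_sel using sub grp mul by blast
  have "blk n 0 0 b0 \<in> ker" unfolding ker_def using colsp_closed(1) b0_G by blast
  moreover have "blk n 0 0 b0 n n = b0" by (simp add: blk_def)
  then have "blk n 0 0 b0 \<noteq> 0" using b0(1) by (metis zero_fun_apply)
  ultimately show "ker \<noteq> {0}" by blast
  show "cut n x = 0" if "x \<in> ker" using that cut_blk[OF M0] by (auto simp: ker_def)
qed

lemma sigma_quot_ker: "sigma (rquot (mat_rng_on (n + 1) BR) ker) \<le> sigma (mat_rng_on n M)"
  by (rule sigma_quot_le[where h = "cut n"])
    (use cut_BR subrng_BR ker_ideal(3-5) cut_add cut_mult in auto)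

lemma sigma_BR_le: "sigma (mat_rng_on (n + 1) BR) \<le> sigma (mat_rng_on n M)"
proof (rule sigma_hom[where f = "cut n"])
  show "cut n (rneg (mat_rng_on (n + 1) BR) x) = rneg (mat_rng_on n M) (cut n x)" for x
    by (simp add: cut_def fun_eq_iff)
  show "cut n (rzero (mat_rng_on (n + 1) BR)) = rzero (mat_rng_on n M)"
    by (simp add: cut_def fun_eq_iff)
qed (use cut_BR subrng_BR cut_add cut_mult in auto)

lemma sum_unitm: "A \<in> M \<Longrightarrow> A = (\<Sum>i<n. \<Sum>j<n. smat (A i j) (unitm i j))"
proof (intro ext)
  fix r s assume A: "A \<in> M"
  have "(\<Sum>i<n. \<Sum>j<n. smat (A i j) (unitm i j)) r s = (\<Sum>i<n. \<Sum>j<n. if j = s then (if i = r then A i j else 0) else 0)"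
    unfolding sum_fun_apply by (intro sum.cong) (auto simp: smat_def unitm_def)
  also have "\<dots> = (\<Sum>i<n. if i = r then (if s < n then A i s else 0) else 0)"
    by (intro sum.cong) auto
  also have "\<dots> = A r s" using A by (auto simp: M_def)
  finally show "A r s = (\<Sum>i<n. \<Sum>j<n. smat (A i j) (unitm i j)) r s" by simp
qed

lemma sum_unitv: "v \<in> colsp n \<Longrightarrow> v = (\<Sum>j<n. svec (v j) (unitv j))"
proof
  fix i assume v: "v \<in> colsp n"
  have "(\<Sum>j<n. svec (v j) (unitv j)) i = (\<Sum>j<n. if j = i then v j else 0)"
    unfolding sum_fun_apply by (intro sum.cong) (auto simp: svec_def unitv_def)
  also have "\<dots> = v i" using v by (auto simp: colsp_def)
  finally show "v i = (\<Sum>j<n. svec (v j) (unitv j)) i" by simp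
qed

lemma unitm_mm: "j < n \<Longrightarrow> mm n (unitm i j) (unitm k l) = (if j = k then unitm i l else 0)"
proof (intro ext)
  fix r s assume j: "j < n"
  have "mm n (unitm i j) (unitm k l) r s = (\<Sum>t<n. if t = j then unitm k l j s * (if r = i then 1 else 0) else 0)"
    unfolding mm_def by (intro sum.cong) (auto simp: unitm_def)
  also have "\<dots> = unitm k l j s * (if r = i then 1 else 0)" using j by simp
  also have "\<dots> = (if j = k then unitm i l else 0) r s" by (simp add: unitm_def)
  finally show "mm n (unitm i j) (unitm k l) r s = (if j = k then unitm i l else 0) r s" .
qed

end

section \<open>Subrings that project onto the whole matrix ring\<close>

context blkring
begin

text \<open>If \<open>T\<close> contains one nonzero column, it contains all of them, because the column space is an
  irreducible bimodule. As \<open>n \<ge> 2\<close>, off-diagonal matrix units are nilpotent and generate the matrix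
  ring, so the corner entry is not a function of the matrix block and \<open>T\<close> is everything.\<close>

lemma subring_col_trivial:
  assumes T: "subrng T (mat_rng_on (n + 1) BR)" "T \<noteq> BR" and proj: "cut n ` T = M"
    and A0: "blk n A0 v0 b0 \<in> T" "A0 \<in> M" "v0 \<in> colsp n"
    and w: "blk n 0 w 0 \<in> T" "w \<in> colsp n"
  shows "w = 0"
proof (rule ccontr)
  assume w0: "w \<noteq> 0"
  have TB: "T \<subseteq> BR" and gT: "add_grp T" and mT: "\<And>X Y. X \<in> T \<Longrightarrow> Y \<in> T \<Longrightarrow> mm (n + 1) X Y \<in> T"
    using T(1) by (auto simp: subrng_mat_rng_on)
  have lift: "\<exists>v b. blk n A v b \<in> T \<and> v \<in> colsp n \<and> b \<in> G" if AM: "A \<in> M" for A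
  proof -
    obtain X where X: "A = cut n X" "X \<in> T" using AM unfolding proj[symmetric] by (rule imageE)
    obtain A' v b where *: "X = blk n A' v b" "A' \<in> M" "v \<in> colsp n" "b \<in> G"
      using subsetD[OF TB X(2)] by (rule BRE)
    have "A = A'" unfolding X(1) *(1) by (rule cut_blk[OF *(2)])
    then show ?thesis using X(2) * by auto
  qed
  \<comment> \<open>The columns in \<open>T\<close>. Matrices act on them from the left because
    \<open>T\<close> projects onto \<open>M\<close>, and powers of \<open>b0\<close>, hence all of
    \<open>G\<close>, from the right.\<close>
  define W where "W = {u \<in> colsp n. blk n 0 u 0 \<in> T}"
  have gW: "add_grp W"
    unfolding add_grp_def
  proof (intro conjI ballI)
    show "0 \<in> W" using add_grpD(1)[OF gT] colsp_closed(1) by (simp add: W_def blk_0)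
    fix x y assume "x \<in> W" "y \<in> W"
    then have "x \<in> colsp n" "y \<in> colsp n" "blk n 0 x 0 - blk n 0 y 0 \<in> T"
      using add_grpD(2)[OF gT] by (auto simp: W_def)
    then show "x - y \<in> W" by (simp add: W_def blk_diff colsp_closed)
  qed
  have WM: "mv n A u \<in> W" if "A \<in> M" "u \<in> W" for A u
  proof -
    obtain v b where "blk n A v b \<in> T" using lift[OF \<open>A \<in> M\<close>] by blast
    then have "mm (n + 1) (blk n A v b) (blk n 0 u 0) \<in> T" using mT that by (simp add: W_def)
    then have "blk n 0 (mv n A u) 0 \<in> T" by (simp only: blk_mm mm_zero svec_simps add_0_right mult_zero_right)
    then show ?thesis using mv_colsp[OF that(1)] by (simp add: W_def)
  qed
  have Wb: "svec b0 u \<in> W" if "u \<in> W" for u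
  proof -
    have "mm (n + 1) (blk n 0 u 0) (blk n A0 v0 b0) \<in> T" using mT that A0 by (simp add: W_def)
    then have "blk n 0 (svec b0 u) 0 \<in> T" by (simp only: blk_mm mm_zero mv_zero add_0_left mult_zero_left)
    then show ?thesis using that by (simp add: W_def colsp_closed)
  qed
  have Wbk: "svec (b0 ^ k) u \<in> W" if "u \<in> W" for u k
  proof (induction k)
    case (Suc k) then show ?case using Wb[of "svec (b0 ^ k) u"] by (simp add: svec_svec)
  qed (use that in simp)
  have WG: "svec g u \<in> W" if "g \<in> G" "u \<in> W" for g u
    using that Wbk add_grpD(1)[OF gW] by (auto simp: b0(2))
  have WF: "svec c u \<in> W" if "c \<in> F" "u \<in> W" for c u
  proof -
    have "mv n (smat c (idm n)) u = svec c u"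
    proof
      fix i
      show "mv n (smat c (idm n)) u i = svec c u i"
        using that sum_idm(1)[of i u] by (auto simp: mv_def smat_def svec_def W_def colsp_def mult.assoc sum_distrib_left[symmetric])
    qed
    then show ?thesis using WM[OF smat_M[OF that(1) idm_M] that(2)] by simp
  qed
  obtain i where i: "w i \<noteq> 0" using w0 by (auto simp: fun_eq_iff)
  have wW: "w \<in> W" using w by (simp add: W_def)
  have iN: "i < n" using w(2) i not_le by (auto simp: colsp_def)
  have unit: "svec c (unitv j) \<in> W" if j: "j < n" for c j
  proof -
    have "mv n (unitm j i) w = svec (w i) (unitv j)"
    proof
      fix r
      have "mv n (unitm j i) w r = (\<Sum>k<n. if k = i then (if r = j then w i else 0) else 0)"
        unfolding mv_def by (intro sum.cong) (auto simp: unitm_def)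
      then show "mv n (unitm j i) w r = svec (w i) (unitv j) r" using iN by (simp add: svec_def unitv_def)
    qed
    then have wi: "svec (w i) (unitv j) \<in> W" using WM[OF unitm_M[OF j iN] wW] by simp
    \<comment> \<open>The possible entries at position \<open>j\<close>: a nonzero set stable under
      \<open>F\<close> and \<open>G\<close>, hence everything by \<open>FG\<close>.\<close>
    define Z where "Z = {c. svec c (unitv j) \<in> W}"
    have "Z = UNIV"
    proof (rule FG[where c = "w i"])
      show "add_grp Z" using add_grpD[OF gW] by (simp add: Z_def add_grp_def svec_diff)
      show "x * z \<in> Z" if "x \<in> F \<union> G" "z \<in> Z" for x z
        using that WF[of x "svec z (unitv j)"] WG[of x "svec z (unitv j)"] by (auto simp: Z_def svec_svec)
    qed (use wi i in \<open>simp_all add: Z_def\<close>)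
    then show ?thesis by (auto simp: Z_def)
  qed
  have col: "blk n 0 u 0 \<in> T" if u: "u \<in> colsp n" for u
  proof -
    have "(\<Sum>j<n. svec (u j) (unitv j)) \<in> W" by (intro add_grp_sum[OF gW] unit) simp
    then show ?thesis using sum_unitv[OF u] by (simp add: W_def)
  qed
  have nocol: "blk n A 0 b \<in> T" if "blk n A v b \<in> T" "v \<in> colsp n" for A v b
    using add_grpD(2)[OF gT that(1) col[OF that(2)]] by (simp add: blk_diff)
  have lift0: "\<exists>b\<in>G. blk n A 0 b \<in> T" if "A \<in> M" for A
    using lift[OF that] nocol by blast
  \<comment> \<open>Otherwise the matrix block determines the corner entry, and the one belonging to
    \<open>A0\<close> turns out to be 0 as well as \<open>b0\<close>.\<close>
  have "\<exists>b\<in>G. b \<noteq> 0 \<and> blk n 0 0 b \<in> T"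
  proof (rule ccontr)
    assume "\<not> ?thesis"
    then have N: "b = 0" if "b \<in> G" "blk n 0 0 b \<in> T" for b using that by blast
    define Q where "Q = {A. blk n A 0 0 \<in> T}"
    have gQ: "add_grp Q"
      unfolding add_grp_def
    proof (intro conjI ballI)
      show "0 \<in> Q" using add_grpD(1)[OF gT] by (simp add: Q_def blk_0)
      fix x y assume "x \<in> Q" "y \<in> Q"
      then have "blk n x 0 0 - blk n y 0 0 \<in> T" using add_grpD(2)[OF gT] by (auto simp: Q_def)
      then show "x - y \<in> Q" by (simp add: Q_def blk_diff)
    qed
    have QQ: "mm n A B \<in> Q" if "A \<in> Q" "B \<in> Q" for A B
    proof -
      have "mm (n + 1) (blk n A 0 0) (blk n B 0 0) \<in> T" using that mT by (simp add: Q_def)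
      then have "blk n (mm n A B) 0 0 \<in> T" by (simp only: blk_mm mv_zero svec_simps add_0_left mult_zero_left)
      then show ?thesis by (simp add: Q_def)
    qed
    have off: "smat c (unitm i j) \<in> Q" if ij: "i < n" "j < n" "i \<noteq> j" and c: "c \<in> F" for i j c
    proof -
      have "smat c (unitm i j) \<in> M" using smat_M[OF c unitm_M] ij by simp
      then obtain b where b: "b \<in> G" "blk n (smat c (unitm i j)) 0 b \<in> T" using lift0 by blast
      then have "mm (n + 1) (blk n (smat c (unitm i j)) 0 b) (blk n (smat c (unitm i j)) 0 b) \<in> T" using mT by blast
      \<comment> \<open>An off-diagonal unit squares to zero, so the square of its corner entry
        belongs to the zero block.\<close>
      moreover have "mm n (smat c (unitm i j)) (smat c (unitm i j)) = 0"
        using not_sym[OF ij(3)] by (simp only: mm_smat_left mm_smat_right smat_simps unitm_mm[OF ij(2)] if_False)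
      ultimately have "blk n 0 0 (b * b) \<in> T" by (simp only: blk_mm mv_zero svec_simps add_0_left)
      then have "b * b = 0" using N[of "b * b"] G_mult b by blast
      then show ?thesis using b by (simp add: Q_def)
    qed
    have "smat c (unitm i j) \<in> Q" if ij: "i < n" "j < n" and c: "c \<in> F" for i j c
    proof (cases "i = j")
      case True
      \<comment> \<open>Any index other than \<open>i\<close>; a diagonal unit is then a product of
        two off-diagonal ones.\<close>
      define k where "k = (if i = 0 then 1 else 0 :: nat)"
      have k: "k < n" "k \<noteq> i" using n2 by (auto simp: k_def)
      have "mm n (smat c (unitm i k)) (smat 1 (unitm k i)) \<in> Q" using k ij c by (intro QQ off) auto
      then show ?thesis using True by (simp only: mm_smat_left smat_simps unitm_mm[OF k(1)] simp_thms if_True)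
    qed (use off ij c in blast)
    then have "(\<Sum>i<n. \<Sum>j<n. smat (A0 i j) (unitm i j)) \<in> Q"
      using A0(2) by (intro add_grp_sum[OF gQ]) (auto simp: M_def)
    then have "blk n A0 0 0 \<in> T" using sum_unitm[OF A0(2)] by (simp add: Q_def)
    from add_grpD(2)[OF gT nocol[OF A0(1,3)] this] have "blk n 0 0 b0 \<in> T" by (simp add: blk_diff)
    then show False using N b0_G b0(1) by blast
  qed
  then obtain b where b: "b \<in> G" "b \<noteq> 0" "blk n 0 0 b \<in> T" by blast
  \<comment> \<open>Repeated multiplication by the element with corner \<open>b0\<close> reaches
    every nonzero corner entry in \<open>G\<close>.\<close>
  have bk: "blk n 0 0 (b * b0 ^ k) \<in> T" for k
  proof (induction k)
    case 0 show ?case using b(3) by (simp only: power_0 mult_1_right)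
  next
    case (Suc k)
    have "mm (n + 1) (blk n 0 0 (b * b0 ^ k)) (blk n A0 v0 b0) \<in> T" using mT Suc A0 by blast
    then show ?case by (simp only: blk_mm mm_zero mv_zero svec_simps add_0_left mult.assoc power_Suc2)
  qed
  have gs: "blk n 0 0 g \<in> T" if g: "g \<in> G" for g
  proof (cases "g = 0")
    case True then show ?thesis using add_grpD(1)[OF gT] by (simp add: blk_0)
  next
    case False
    have "inverse b * g \<in> G" "inverse b * g \<noteq> 0" using G_mult[OF G_inverse[OF b(1)] g] b(2) False by auto
    then obtain k where "inverse b * g = b0 ^ k" unfolding b0(2) by blast
    then have "g = b * b0 ^ k" using b(2) by (metis left_inverse mult.assoc mult.left_commute mult_1 mult.commute)
    then show ?thesis using bk by simp
  qed
  have "BR \<subseteq> T"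
  proof
    fix X assume "X \<in> BR"
    then obtain A v g where X: "X = blk n A v g" "A \<in> M" "v \<in> colsp n" "g \<in> G" by (rule BRE)
    obtain c where c: "c \<in> G" "blk n A 0 c \<in> T" using lift0[OF X(2)] by blast
    have "blk n A 0 c - blk n 0 0 c \<in> T" using add_grpD(2)[OF gT c(2) gs[OF c(1)]] .
    then have "blk n A 0 c - blk n 0 0 c + blk n 0 v 0 + blk n 0 0 g \<in> T"
      using add_grpD(4)[OF gT] col[OF X(3)] gs[OF X(4)] by blast
    then show "X \<in> T" by (simp add: X(1) blk_diff blk_add)
  qed
  then show False using TB T(2) by blast
qed

lemma sigma_BR_ge:
  assumes "sigma (mat_rng_on n M) \<le> enat (card (UNIV :: 'k set) ^ n)"
  shows "sigma (mat_rng_on n M) \<le> sigma (mat_rng_on (n + 1) BR)"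
proof (rule sigma_geI)
  fix C assume C: "is_cover C (mat_rng_on (n + 1) BR)" "finite C"
  have CS: "\<And>T. T \<in> C \<Longrightarrow> subrng T (mat_rng_on (n + 1) BR) \<and> T \<noteq> BR" and CU: "\<Union> C = BR"
    using C(1) by (simp_all add: is_cover_def)
  define P where "P = {cut n ` T | T. T \<in> C \<and> cut n ` T \<noteq> M}"
  have Pimg: "P \<subseteq> (`) (cut n) ` C" by (auto simp: P_def)
  have finP: "finite P" using Pimg C(2) by (meson finite_imageI finite_subset)
  have cardP: "card P \<le> card C"
    using card_mono[OF finite_imageI[OF C(2)] Pimg] card_image_le[OF C(2), of "(`) (cut n)"] by linarith
  show "sigma (mat_rng_on n M) \<le> enat (card C)"
  proof (cases "M \<subseteq> \<Union> P")
    case True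
    have PS: "subrng S (mat_rng_on n M) \<and> S \<noteq> M" if SP: "S \<in> P" for S
    proof -
      obtain T where T: "S = cut n ` T" "T \<in> C" "S \<noteq> M" using SP by (auto simp: P_def)
      have TB: "T \<subseteq> BR" and gT: "add_grp T" and mT: "\<And>X Y. X \<in> T \<Longrightarrow> Y \<in> T \<Longrightarrow> mm (n + 1) X Y \<in> T"
        using CS[OF T(2)] by (auto simp: subrng_mat_rng_on)
      have "subrng S (mat_rng_on n M)"
        unfolding subrng_mat_rng_on add_grp_def T(1)
      proof (intro conjI ballI)
        show "cut n ` T \<subseteq> M" using TB cut_BR by blast
        have "cut n 0 = (0 :: nat \<Rightarrow> nat \<Rightarrow> 'k)" by (simp add: cut_def fun_eq_iff)
        then show "0 \<in> cut n ` T" using add_grpD(1)[OF gT] by (metis imageI)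
        fix x y assume "x \<in> cut n ` T" "y \<in> cut n ` T"
        then obtain X Y where XY: "X \<in> T" "Y \<in> T" "x = cut n X" "y = cut n Y" by blast
        show "x - y \<in> cut n ` T" unfolding XY cut_diff[symmetric] using add_grpD(2)[OF gT XY(1,2)] by (rule imageI)
        have "cut n (mm (n + 1) X Y) = mm n x y" using cut_mult[of X Y] TB XY by blast
        then show "mm n x y \<in> cut n ` T" using mT[OF XY(1,2)] by (metis imageI)
      qed
      then show ?thesis using T by blast
    qed
    moreover have "\<Union> P \<subseteq> M" using PS by (auto simp: subrng_mat_rng_on)
    ultimately have "is_cover P (mat_rng_on n M)" using True by (simp add: is_cover_def antisym)
    then have "sigma (mat_rng_on n M) \<le> enat (card P)" using finP by (rule sigma_le)
    then show ?thesis using cardP by (meson enat_ord_simps(1) order_trans)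
  next
    case False
    then obtain A where A: "A \<in> M" "A \<notin> \<Union> P" by blast
    have "\<forall>v\<in>colsp n. \<exists>T\<in>C. blk n A v b0 \<in> T"
      using BRI[OF A(1) _ b0_G] CU by blast
    then obtain t where t: "\<And>v. v \<in> colsp n \<Longrightarrow> t v \<in> C \<and> blk n A v b0 \<in> t v" by metis
    have tM: "cut n ` t v = M" if v: "v \<in> colsp n" for v
    proof (rule ccontr)
      assume "cut n ` t v \<noteq> M"
      then have "cut n ` t v \<in> P" using t[OF v] by (auto simp: P_def)
      moreover have "A \<in> cut n ` t v" using t[OF v] cut_blk[OF A(1)] by (metis imageI)
      ultimately show False using A(2) by blast
    qed
    have "inj_on t (colsp n)"
    proof (rule inj_onI)
      fix u v assume uv: "u \<in> colsp n" "v \<in> colsp n" "t u = t v"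
      have T: "subrng (t u) (mat_rng_on (n + 1) BR)" "t u \<noteq> BR" using CS t[OF uv(1)] by auto
      have "blk n A u b0 - blk n A v b0 \<in> t u"
        using T(1) t[OF uv(1)] t[OF uv(2)] uv(3) add_grpD(2)[of "t u"] by (simp add: subrng_mat_rng_on)
      then have "blk n 0 (u - v) 0 \<in> t u" by (simp add: blk_diff)
      then have "u - v = 0"
        using subring_col_trivial[OF T tM[OF uv(1)] _ A(1) uv(1)] t[OF uv(1)] colsp_closed(3)[OF uv(1,2)] by blast
      then show "u = v" by simp
    qed
    then have "card (colsp n :: (nat \<Rightarrow> 'k) set) \<le> card C" using t C(2) by (intro card_inj_on_le[of t]) auto
    then have "enat (card (UNIV :: 'k set) ^ n) \<le> enat (card C)" using card_colsp(1)[OF n_ge_1, where 'k='k] by simp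
    then show ?thesis using assms by (rule order_trans[rotated])
  qed
qed

end

section \<open>From the abstract setting to the rings of the theorem\<close>

lemma divop_scalar:
  assumes "fsub F q" "add_grp Z" "\<And>x z. x \<in> F \<Longrightarrow> z \<in> Z \<Longrightarrow> x * z \<in> Z"
  shows "divop F (*) (Z :: 'k::{finite,field} set)"
proof -
  interpret fsub F q by fact
  show ?thesis
  proof
    show "\<exists>h\<in>F. \<forall>x\<in>Z. h * (f * x - g * x) = x" if "f \<in> F" "g \<in> F" "f \<noteq> g" for f g
      using that F_inverse[OF F_diff[of f g]]
      by (intro bexI[of _ "inverse (f - g)"]) (auto simp: left_diff_distrib[symmetric] mult.assoc[symmetric])
    show "\<exists>h\<in>F. \<forall>x\<in>Z. h * x = f * x - g * x" if "f \<in> F" "g \<in> F" for f g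
      using that F_diff by (auto simp: left_diff_distrib[symmetric])
    show "\<exists>h\<in>F. \<forall>x\<in>Z. h * x = f * (g * x)" if "f \<in> F" "g \<in> F" for f g
      using that F_mult by (auto simp: mult.assoc[symmetric])
  qed (use assms in \<open>auto simp: distrib_left\<close>)
qed

text \<open>\<open>Z\<close> is a vector space over both fields, so the exponent of \<open>p\<close>
  in its order is a positive common multiple of \<open>d1\<close> and \<open>d2\<close>.\<close>

lemma subfields_span:
  fixes Z :: "'k::{finite,field} set"
  assumes p: "prime p" and card: "card (UNIV :: 'k set) = p ^ lcm d1 d2" "d1 \<ge> 1" "d2 \<ge> 1"
    and F: "fsub F (p ^ d1)" and G: "fsub G (p ^ d2)"
    and Z: "add_grp Z" "\<And>x z. x \<in> F \<union> G \<Longrightarrow> z \<in> Z \<Longrightarrow> x * z \<in> Z" "c \<in> Z" "c \<noteq> 0"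
  shows "Z = UNIV"
proof -
  interpret DF: divop F "(*)" Z using F Z(1,2) by (intro divop_scalar) auto
  interpret DG: divop G "(*)" Z using G Z(1,2) by (intro divop_scalar) auto
  obtain s t where "card Z = card F ^ s" "card Z = card G ^ t"
    using DF.card_submod[OF DF.submod_U] DG.card_submod[OF DG.submod_U] by blast
  then have s: "card Z = p ^ (d1 * s)" and t: "card Z = p ^ (d2 * t)"
    using fsub.card_F[OF F] fsub.card_F[OF G] by (simp_all add: power_mult)
  have p1: "p > 1" using prime_gt_1_nat[OF p] .
  then have eq: "d1 * s = d2 * t" using s t by (simp add: power_inject_exp)
  have "card {0, c} \<le> card Z" using Z(3) add_grpD(1)[OF Z(1)] by (intro card_mono) auto
  then have "d1 * s \<noteq> 0" using s Z(4) by (intro notI) simp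
  moreover have "lcm d1 d2 dvd d1 * s" using eq by (intro lcm_least) (metis dvd_triv_left)+
  ultimately have "lcm d1 d2 \<le> d1 * s" by (simp add: dvd_imp_le)
  then have "card (UNIV :: 'k set) \<le> card Z" unfolding card(1) s using p1 by (intro power_increasing) auto
  then show ?thesis by (intro card_seteq) auto
qed

lemma fsub_subfield_of_order:
  assumes "card (UNIV :: 'k::{finite,field} set) = p ^ e" "prime p" "d dvd e" "d \<ge> 1"
  shows "fsub (subfield_of_order (p ^ d) :: 'k set) (p ^ d)"
  using subfield_of_order_props[OF assms refl] by unfold_locales auto

lemma full_mat_eq:
  assumes "fmat F q n" "F = subfield_of_order q"
  shows "full_mat n q = mat_rng_on n (fmat.M F n)"
proof -
  interpret fmat F q n by fact
  have "{M. (\<forall>i j. (i \<ge> n \<or> j \<ge> n) \<longrightarrow> M i j = 0) \<and> (\<forall>i<n. \<forall>j<n. M i j \<in> F)} = M"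
    unfolding M_def using F_0 by (metis not_le)
  then show ?thesis unfolding full_mat_def assms(2) by simp
qed

lemma A_rng_eq:
  assumes "blkring F q n G b0" "F = subfield_of_order q" "G = subfield_of_order r"
  shows "A_rng n q r = mat_rng_on (n + 1) (blkring.BR F n G)"
proof -
  interpret blkring F q n G b0 by fact
  have "{M. (\<forall>i j. (i > n \<or> j > n) \<longrightarrow> M i j = 0) \<and> (\<forall>i<n. \<forall>j<n. M i j \<in> F) \<and> (\<forall>j<n. M n j = 0) \<and> M n n \<in> G} = BR"
  proof (intro equalityI subsetI)
    fix X assume X: "X \<in> {M. (\<forall>i j. (i > n \<or> j > n) \<longrightarrow> M i j = 0) \<and> (\<forall>i<n. \<forall>j<n. M i j \<in> F) \<and> (\<forall>j<n. M n j = 0) \<and> M n n \<in> G}"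
    have eq: "X = blk n (cut n X) (\<lambda>i. if i < n then X i n else 0) (X n n)"
      using X by (auto simp: blk_def cut_def fun_eq_iff) (metis linorder_neqE_nat)+
    have "cut n X \<in> M" using X by (auto simp: cut_def M_def)
    moreover have "(\<lambda>i. if i < n then X i n else 0) \<in> colsp n" by (simp add: colsp_def)
    moreover have "X n n \<in> G" using X by blast
    ultimately have "blk n (cut n X) (\<lambda>i. if i < n then X i n else 0) (X n n) \<in> BR" by (rule BRI)
    then show "X \<in> BR" by (simp only: eq[symmetric])
  next
    fix X assume "X \<in> BR"
    then obtain A v b where X: "X = blk n A v b" "A \<in> M" "v \<in> colsp n" "b \<in> G" by (rule BRE)
    then show "X \<in> {M. (\<forall>i j. (i > n \<or> j > n) \<longrightarrow> M i j = 0) \<and> (\<forall>i<n. \<forall>j<n. M i j \<in> F) \<and> (\<forall>j<n. M n j = 0) \<and> M n n \<in> G}"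
      by (auto simp: blk_def M_def)
  qed
  then show ?thesis unfolding A_rng_def assms(2,3) by simp
qed

lemma smallest_prime_divisor:
  assumes "n \<ge> 2"
  shows "prime (smallest_prime_divisor n)" "smallest_prime_divisor n dvd n"
proof -
  have "finite {a. prime a \<and> a dvd n}" using assms by (intro finite_subset[OF _ finite_divisors_nat[of n]]) auto
  moreover have "{a. prime a \<and> a dvd n} \<noteq> {}" using prime_factor_nat[of n] assms by auto
  ultimately have "Min {a. prime a \<and> a dvd n} \<in> {a. prime a \<and> a dvd n}" by (rule Min_in)
  then show "prime (smallest_prime_divisor n)" "smallest_prime_divisor n dvd n"
    by (auto simp: smallest_prime_divisor_def)
qed

lemma A_rng_ge_2:
  assumes p: "prime p" and d12: "d1 \<ge> 1" "d2 \<ge> 1" and card: "card (UNIV :: 'k::{finite,field} set) = p ^ lcm d1 d2"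
    and d: "p ^ lcm d1 d2 = (p ^ d1) ^ d" and n: "n \<ge> 2" "d \<ge> n - n div smallest_prime_divisor n"
  shows "\<not> sigma_elementary (A_rng n (p^d1) (p^d2) :: (nat \<Rightarrow> nat \<Rightarrow> 'k) rng_struct) \<and>
    sigma (A_rng n (p^d1) (p^d2) :: (nat \<Rightarrow> nat \<Rightarrow> 'k) rng_struct)
      = sigma (full_mat n (p^d1) :: (nat \<Rightarrow> nat \<Rightarrow> 'k) rng_struct)"
proof -
  define F G where "F = (subfield_of_order (p ^ d1) :: 'k set)" and "G = (subfield_of_order (p ^ d2) :: 'k set)"
  have F: "fsub F (p ^ d1)" and G: "fsub G (p ^ d2)"
    unfolding F_def G_def using fsub_subfield_of_order[OF card p] d12 by auto
  interpret GG: fsub G "p ^ d2" by fact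
  obtain b0 where b0: "b0 \<noteq> 0" "G = insert 0 {b0 ^ i | i::nat. True}"
    using subfield_of_order_props(2)[OF card p _ d12(2) refl] unfolding G_def by auto
  interpret fm: fmat F "p ^ d1" n using F n(1) by (intro fmat.intro fmat_axioms.intro) auto
  interpret B: blkring F "p ^ d1" n G b0
  proof (intro blkring.intro blkring_axioms.intro)
    show "fmat F (p ^ d1) n" by (rule fm.fmat_axioms)
  qed (use n b0 GG.F_add GG.F_minus GG.F_mult GG.F_inverse subfields_span[OF p card d12 F G] in auto)
  define a where "a = smallest_prime_divisor n"
  have a: "prime a" "a dvd n" using smallest_prime_divisor[OF n(1)] by (auto simp: a_def)
  have ch: "CHAR('k) = p" using CHAR_finite_field[OF card p] .
  have "sigma (mat_rng_on n fm.M) \<le> enat ((p ^ d1) ^ (n * (n - n div a)))"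
    by (rule fm.sigma_full_mat_le[OF a n(1), of d1]) (use ch prime_gt_0_nat[OF p] in \<open>auto simp: F_def subfield_of_order_def\<close>)
  \<comment> \<open>The hypothesis on \<open>d\<close> enters here:
    \<open>(p ^ d1) ^ (n * d)\<close> is the number of columns over the ambient field.\<close>
  also have "(p ^ d1) ^ (n * (n - n div a)) \<le> (p ^ d1) ^ (n * d)"
    using n(2) prime_gt_0_nat[OF p] unfolding a_def by (intro power_increasing mult_le_mono) auto
  then have "enat ((p ^ d1) ^ (n * (n - n div a))) \<le> enat (card (UNIV :: 'k set) ^ n)"
    unfolding card d by (simp add: power_mult[symmetric] mult_ac)
  finally have "sigma (mat_rng_on n fm.M) \<le> sigma (mat_rng_on (n + 1) B.BR)" by (rule B.sigma_BR_ge)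
  then have eq: "sigma (mat_rng_on (n + 1) B.BR) = sigma (mat_rng_on n fm.M)" using B.sigma_BR_le by (rule antisym[rotated])
  have "\<not> sigma_elementary (mat_rng_on (n + 1) B.BR)"
    using B.ker_ideal(1,2) B.sigma_quot_ker eq unfolding sigma_elementary_def by (metis mat_rng_on_sel(3) not_le)
  then show ?thesis
    using eq A_rng_eq[OF B.blkring_axioms F_def G_def] full_mat_eq[OF fm.fmat_axioms F_def] by simp
qed

section \<open>The case n = 1\<close>

definition pclosed :: "('k::field \<times> 'k) set \<Rightarrow> bool" where
  "pclosed S \<longleftrightarrow> (\<forall>x y x' y'. (x, y) \<in> S \<longrightarrow> (x', y') \<in> S \<longrightarrow> (x - x', y - y') \<in> S \<and> (x * x', y * y') \<in> S)"

lemma pclosedD: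
  assumes "pclosed S" "(x, y) \<in> S"
  shows "(x', y') \<in> S \<Longrightarrow> (x - x', y - y') \<in> S" "(x', y') \<in> S \<Longrightarrow> (x * x', y * y') \<in> S"
    "(x', y') \<in> S \<Longrightarrow> (x + x', y + y') \<in> S" "(- x, - y) \<in> S" "(0, 0) \<in> S" "(x ^ Suc i, y ^ Suc i) \<in> S"
proof -
  have d: "(x - x', y - y') \<in> S" and m: "(x * x', y * y') \<in> S" if "(x, y) \<in> S" "(x', y') \<in> S" for x y x' y'
    using assms(1) that unfolding pclosed_def by blast+
  show "(x', y') \<in> S \<Longrightarrow> (x - x', y - y') \<in> S" "(x', y') \<in> S \<Longrightarrow> (x * x', y * y') \<in> S"
    using d m assms(2) by blast+
  show 0: "(0, 0) \<in> S" using d[OF assms(2,2)] by simp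
  have n: "(- x, - y) \<in> S" if "(x, y) \<in> S" for x y using d[OF 0 that] by simp
  show "(- x, - y) \<in> S" using n assms(2) .
  show "(x', y') \<in> S \<Longrightarrow> (x + x', y + y') \<in> S" using d[OF assms(2) n] by fastforce
  show "(x ^ Suc i, y ^ Suc i) \<in> S"
    by (induction i) (use assms(2) m[OF assms(2)] in auto)
qed

text \<open>Multiplying \<open>(0, c)\<close> by powers of \<open>(a, b)\<close> fills the second
  factor, as \<open>b\<close> generates the units of \<open>G\<close>; subtracting
  \<open>(0, b)\<close> leaves \<open>(a, 0)\<close>, whose powers fill the first.\<close>

lemma pclosed_full:
  assumes S: "pclosed S" and ab: "(a, b) \<in> S" and c: "(0, c) \<in> S" "c \<noteq> 0" "c \<in> G"
    and F: "fsub F q1" "F = insert 0 {a ^ i | i::nat. True}" "a \<noteq> 0"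
    and G: "fsub G q2" "G = insert 0 {b ^ i | i::nat. True}" "b \<noteq> 0"
  shows "F \<times> G \<subseteq> S"
proof -
  note mult = pclosedD(2)[OF S] and diff = pclosedD(1)[OF S] and add = pclosedD(3)[OF S]
  have mem: "a \<in> F" "b \<in> G"
  proof -
    have "a ^ 1 \<in> F" "b ^ 1 \<in> G" unfolding F(2) G(2) by blast+
    then show "a \<in> F" "b \<in> G" by auto
  qed
  have cb: "(0, c * b ^ i) \<in> S" for i
  proof (induction i)
    case (Suc i)
    then show ?case using mult[OF Suc ab] by (simp add: mult_ac)
  qed (use c in simp)
  have right: "(0, y) \<in> S" if "y \<in> G" for y
  proof (cases "y = 0")
    case False
    have "inverse c * y \<in> G" "inverse c * y \<noteq> 0"
      using fsub.F_mult[OF G(1)] fsub.F_inverse[OF G(1)] that c False by auto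
    then obtain i where i: "inverse c * y = b ^ i" unfolding G(2) by blast
    have "c * (inverse c * y) = y" using c(2) by (simp add: mult.assoc[symmetric])
    then show ?thesis using cb[of i] i by simp
  qed (use pclosedD(5)[OF S ab] in simp)
  have a0: "(a, 0) \<in> S" using diff[OF ab right[OF mem(2)]] by simp
  have left: "(x, 0) \<in> S" if "x \<in> F" for x
  proof (cases "x = 0")
    case False
    have "inverse a * x \<in> F" "inverse a * x \<noteq> 0"
      using fsub.F_mult[OF F(1)] fsub.F_inverse[OF F(1)] that mem F(3) False by auto
    then obtain i where i: "inverse a * x = a ^ i" unfolding F(2) by blast
    have "a * (inverse a * x) = x" using F(3) by (simp add: mult.assoc[symmetric])
    then have "x = a ^ Suc i" using i by simp
    then show ?thesis using pclosedD(6)[OF S a0, of i] by simp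
  qed (use pclosedD(5)[OF S ab] in simp)
  show ?thesis
  proof
    fix z assume "z \<in> F \<times> G"
    then obtain x y where "z = (x, y)" "x \<in> F" "y \<in> G" by blast
    then show "z \<in> S" using add[OF left right] by fastforce
  qed
qed

section \<open>Pairs that generate the product of two subfields\<close>

locale twosub =
  fixes F G :: "'k::{finite,field} set" and q1 q2 :: nat and g1 g2 :: 'k
  assumes F: "fsub F q1" and G: "fsub G q2"
    and Fq: "F = {x. x ^ q1 = x}" and Gq: "G = {x. x ^ q2 = x}"
    and g1: "F = insert 0 {g1 ^ i | i::nat. True}" "g1 \<noteq> 0"
    and g2: "G = insert 0 {g2 ^ i | i::nat. True}" "g2 \<noteq> 0"
    and FG: "\<And>Z c. add_grp Z \<Longrightarrow> (\<And>x z. x \<in> F \<union> G \<Longrightarrow> z \<in> Z \<Longrightarrow> x * z \<in> Z) \<Longrightarrow> c \<in> Z \<Longrightarrow> c \<noteq> 0 \<Longrightarrow> Z = UNIV"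
begin

sublocale F: fsub F q1 by (rule F)
sublocale G: fsub G q2 by (rule G)

definition generating :: "'k \<Rightarrow> 'k \<Rightarrow> bool" where
  "generating a b \<longleftrightarrow> a \<in> F \<and> b \<in> G \<and> (\<forall>S. pclosed S \<longrightarrow> (a, b) \<in> S \<longrightarrow> F \<times> G \<subseteq> S)"

lemma generating_neq: "generating a b \<Longrightarrow> a \<noteq> b"
proof
  assume "generating a b" "a = b"
  then have "F \<times> G \<subseteq> {(x, x) | x. True}" by (auto simp: generating_def pclosed_def)
  then have "(1, 0) \<in> {(x :: 'k, x) | x. True}" using F.F_1 G.F_0 by blast
  then show False by auto
qed

lemma mem_gen: "g1 \<in> F" "g2 \<in> G"
proof -
  have "g1 ^ 1 \<in> F" "g2 ^ 1 \<in> G" unfolding g1(1) g2(1) by blast+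
  then show "g1 \<in> F" "g2 \<in> G" by auto
qed

text \<open>The power with exponent \<open>q1\<close> fixes \<open>g1\<close> but moves
  \<open>g2\<close>, as otherwise the larger field \<open>G\<close> would lie in \<open>F\<close>.
  Subtracting the pair from its power thus gives \<open>(0, c)\<close> with
  \<open>c \<noteq> 0\<close>.\<close>

lemma generating_less: "q1 < q2 \<Longrightarrow> generating g1 g2"
  unfolding generating_def
proof (intro conjI allI impI mem_gen)
  fix S assume q: "q1 < q2" and S: "pclosed S" "(g1, g2) \<in> S"
  obtain i where i: "q1 = Suc i" using F.q_ge_2 by (cases q1) auto
  have "(g1 ^ q1 - g1, g2 ^ q1 - g2) \<in> S"
    using pclosedD(1)[OF S(1) pclosedD(6)[OF S, of i] S(2)] i by simp
  moreover have "g1 ^ q1 = g1" using mem_gen(1) Fq by simp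
  ultimately have c: "(0, g2 ^ q1 - g2) \<in> S" by simp
  have "g2 ^ q1 \<noteq> g2"
  proof
    assume eq: "g2 ^ q1 = g2"
    have "(g2 ^ i) ^ q1 = g2 ^ i" for i by (metis eq mult.commute power_mult)
    then have "x ^ q1 = x" if "x \<in> G" for x
      using that F.q_ge_2 unfolding g2(1) by (auto simp: power_0_left)
    then have "G \<subseteq> F" using Fq by blast
    then have "q2 \<le> q1" using card_mono[of F G] F.card_F G.card_F by simp
    then show False using q by simp
  qed
  moreover have "g2 ^ q1 \<in> G" unfolding g2(1) by blast
  then have "g2 ^ q1 - g2 \<in> G" using G.F_diff mem_gen(2) by blast
  ultimately show "F \<times> G \<subseteq> S" using pclosed_full[OF S c _ _ F g1 G g2] by simp
qed

text \<open>If no element of the form \<open>(0, c)\<close> with \<open>c \<noteq> 0\<close> were generated, inversion would be additive on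
  \<open>F\<close>, so every \<open>y\<close> other than \<open>0\<close> and \<open>-1\<close> would be a root of \<open>y\<^sup>2 + y + 1\<close>.\<close>

lemma generating_eq:
  assumes q: "q1 = q2" "q1 \<ge> 5"
  shows "generating g1 (inverse g1)"
  unfolding generating_def
proof (intro conjI allI impI mem_gen)
  have GF: "G = F" using q Fq Gq by simp
  show inv: "inverse g1 \<in> G" using F.F_inverse mem_gen(1) GF by simp
  fix S assume S: "pclosed S" "(g1, inverse g1) \<in> S"
  have gen: "G = insert 0 {inverse g1 ^ i | i::nat. True}"
  proof (intro equalityI subsetI)
    fix x assume x: "x \<in> G"
    show "x \<in> insert 0 {inverse g1 ^ i | i::nat. True}"
    proof (cases "x = 0")
      case False
      have "inverse x \<in> F" using x G.F_inverse GF by simp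
      then obtain i where "inverse x = g1 ^ i" using g1(1) False by auto
      then have "x = inverse g1 ^ i" by (metis inverse_inverse_eq power_inverse)
      then show ?thesis by blast
    qed simp
  next
    fix x assume "x \<in> insert 0 {inverse g1 ^ i | i::nat. True}"
    moreover have "inverse g1 ^ i \<in> G" for i by (induction i) (use inv G.F_mult in auto)
    ultimately show "x \<in> G" by auto
  qed
  have "inverse g1 \<in> F" using inv GF by simp
  then obtain N where "inverse g1 = g1 ^ N" using g1 by auto
  then have "g1 ^ Suc N = 1" using right_inverse[OF g1(2)] by simp
  moreover from this have "inverse g1 ^ Suc N = 1" by (metis inverse_1 power_inverse)
  ultimately have one: "(1, 1) \<in> S" using pclosedD(6)[OF S, of N] by simp
  have pw: "(x, inverse x) \<in> S" if x: "x \<in> F" "x \<noteq> 0" for x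
  proof -
    obtain i where i: "x = g1 ^ i" using x g1(1) by auto
    show ?thesis
    proof (cases i)
      case 0 then show ?thesis using i one by simp
    next
      case (Suc j) then show ?thesis using i pclosedD(6)[OF S, of j] by (simp add: power_inverse)
    qed
  qed
  \<comment> \<open>At most four elements are excluded: 0, -1 and two roots. This is why the order
    must be at least 5.\<close>
  let ?B = "{0, - 1 :: 'k} \<union> {x. poly [:1, 1, 1:] x = 0}"
  have "card {x :: 'k. poly [:1, 1, 1:] x = 0} \<le> degree [:1, 1, 1 :: 'k:]" by (rule card_poly_roots_bound) simp
  then have "card {x :: 'k. poly [:1, 1, 1:] x = 0} \<le> 2" by simp
  moreover have "card {0, - 1 :: 'k} \<le> 2" by (simp add: card_insert_if)
  ultimately have "card ?B \<le> 4" using card_Un_le[of "{0, - 1 :: 'k}" "{x. poly [:1, 1, 1:] x = 0}"] by linarith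
  then have "\<not> F \<subseteq> ?B" using card_mono[of ?B F] F.card_F q(2) by auto
  then obtain y where y: "y \<in> F" "y \<noteq> 0" "y \<noteq> - 1" "poly [:1, 1, 1:] y \<noteq> 0" by blast
  have y1: "y + 1 \<noteq> 0" "y + 1 \<in> F" using y F.F_add by (auto simp: eq_neg_iff_add_eq_0)
  \<comment> \<open>Second coordinate of \<open>(y, 1/y) + (1, 1) - (y + 1, 1/(y + 1))\<close>; its
    numerator is \<open>y\<^sup>2 + y + 1\<close>.\<close>
  define c where "c = inverse y + 1 - inverse (y + 1)"
  have "(y + 1 - (y + 1), c) \<in> S"
    unfolding c_def by (rule pclosedD(1)[OF S(1) pclosedD(3)[OF S(1) pw[OF y(1,2)] one] pw[OF y1(2,1)]])
  then have c: "(0, c) \<in> S" by simp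
  have "c * (y * (y + 1)) = (inverse y * y) * (y + 1) + y * (y + 1) - (inverse (y + 1) * (y + 1)) * y"
    unfolding c_def by (simp only: algebra_simps mult_1_left)
  also have "\<dots> = poly [:1, 1, 1:] y"
    unfolding left_inverse[OF y(2)] left_inverse[OF y1(1)] by (simp add: algebra_simps)
  finally have "c * (y * (y + 1)) = poly [:1, 1, 1:] y" .
  then have "c \<noteq> 0" using y(4) by auto
  moreover have "c \<in> G" unfolding GF c_def using y y1 by (intro F.F_diff F.F_add F.F_inverse F.F_1)
  ultimately show "F \<times> G \<subseteq> S" using pclosed_full[OF S c _ _ F g1 G gen] g1(2) by simp
qed

text \<open>Squaring gives \<open>(1, 1)\<close>, and
  \<open>(1, -1) - (1, 1) = (0, -2) = (0, 1)\<close> in characteristic 3.\<close>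

lemma generating_3:
  assumes q: "q1 = 3" "q2 = 3"
  shows "generating 1 (- 1)"
  unfolding generating_def
proof (intro conjI allI impI)
  have GF: "G = F" using q Fq Gq by simp
  show "1 \<in> F" "- 1 \<in> G" using G.F_minus by simp_all
  fix S :: "('k \<times> 'k) set" assume S: "pclosed S" "(1, - 1) \<in> S"
  have card: "card F = 3" using F.card_F q by simp
  \<comment> \<open>If 1 and -1 were equal, \<open>0, 1, z, z + 1\<close> would be four elements of
    \<open>F\<close>.\<close>
  have ne: "(1 :: 'k) \<noteq> - 1"
  proof
    assume eq: "(1 :: 'k) = - 1"
    have "\<not> F \<subseteq> {0, 1}" using card card_mono[of "{0, 1 :: 'k}" F] by auto
    then obtain z where z: "z \<in> F" "z \<noteq> 0" "z \<noteq> 1" by blast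
    have "z + 1 \<noteq> 0" using z(3) eq by (metis add_eq_0_iff2)
    then have "card {0, 1, z, z + 1} = 4" using z by (auto simp: card_insert_if)
    moreover have "{0, 1, z, z + 1} \<subseteq> F" using z F.F_add by auto
    ultimately show False using card_mono[of F "{0, 1, z, z + 1}"] card by simp
  qed
  have F3: "F = {0, 1, - 1}"
    by (rule card_subset_eq[symmetric]) (use ne card F.F_minus in \<open>auto simp: card_insert_if\<close>)
  have "1 + 1 \<in> F" by (intro F.F_add) auto
  moreover have "1 + 1 \<noteq> (0 :: 'k)" using ne by (metis add_eq_0_iff)
  moreover have "1 + 1 \<noteq> (1 :: 'k)" by (metis add_cancel_right_right one_neq_zero)
  ultimately have two: "1 + 1 = (- 1 :: 'k)" unfolding F3 by blast
  have one: "(1, 1) \<in> S" using pclosedD(2)[OF S S(2)] by simp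
  have "- 1 - 1 = - (1 + 1 :: 'k)" by (simp only: minus_add_distrib diff_conv_add_uminus)
  then have "(- 1 - 1 :: 'k) = 1" by (simp only: two minus_minus)
  then have r: "(0, 1) \<in> S" using pclosedD(1)[OF S one] by (simp only: diff_self)
  have l: "(1, 0) \<in> S" using pclosedD(1)[OF S(1) one r] by simp
  have L: "(x, 0) \<in> S" "(0, x) \<in> S" if "x \<in> F" for x
    using that pclosedD(4)[OF S(1) l] pclosedD(4)[OF S(1) r] pclosedD(5)[OF S] l r unfolding F3 by auto
  show "F \<times> G \<subseteq> S"
  proof
    fix z assume "z \<in> F \<times> G"
    then obtain x y where "z = (x, y)" "x \<in> F" "y \<in> F" using GF by blast
    then show "z \<in> S" using pclosedD(3)[OF S(1) L(1) L(2)] by fastforce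
  qed
qed

end

lemma generating_exists:
  assumes T: "twosub F G q1 q2 g1 g2" and q: "(q1, q2) \<noteq> (2, 2)" "(q1, q2) \<noteq> (4, 4)"
  shows "\<exists>a b. twosub.generating F G a b"
proof -
  interpret twosub F G q1 q2 g1 g2 by fact
  consider "q1 < q2" | "q2 < q1" | "q1 = q2" "q1 = 3" | "q1 = q2" "q1 \<ge> 5"
    using q F.q_ge_2 by fastforce
  then show ?thesis
  proof cases
    case 2
    interpret S: twosub G F q2 q1 g2 g1
      by (rule twosub.intro[OF G F Gq Fq g2 g1]) (rule FG, simp_all add: Un_commute)
    have gen: "S.generating g2 g1" using S.generating_less 2 by simp
    have "generating g1 g2"
      unfolding generating_def
    proof (intro conjI allI impI mem_gen)
      fix X assume X: "pclosed X" "(g1, g2) \<in> X"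
      have "pclosed {(x, y). (y, x) \<in> X}" "(g2, g1) \<in> {(x, y). (y, x) \<in> X}"
        using X unfolding pclosed_def by auto
      then have "G \<times> F \<subseteq> {(x, y). (y, x) \<in> X}" using gen unfolding S.generating_def by blast
      then show "F \<times> G \<subseteq> X" by blast
    qed
    then show ?thesis by blast
  qed (use generating_less generating_eq generating_3 in blast)+
qed

section \<open>Upper triangular matrices of size 2\<close>

definition tri :: "'k::field \<Rightarrow> 'k \<Rightarrow> 'k \<Rightarrow> nat \<Rightarrow> nat \<Rightarrow> 'k" where
  "tri a v b = (\<lambda>i j. if i = 0 \<and> j = 0 then a else if i = 0 \<and> j = 1 then v else if i = 1 \<and> j = 1 then b else 0)"

lemma tri_add: "tri a v b + tri a' v' b' = tri (a + a') (v + v') (b + b')"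
  by (simp add: tri_def fun_eq_iff)

lemma tri_diff: "tri a v b - tri a' v' b' = tri (a - a') (v - v') (b - b')"
  by (simp add: tri_def fun_eq_iff)

lemma tri_minus: "- tri a v b = tri (- a) (- v) (- b)"
  by (simp add: tri_def fun_eq_iff)

lemma tri_0: "tri 0 0 0 = 0"
  by (simp add: tri_def fun_eq_iff)

lemma tri_mm: "mm 2 (tri a v b) (tri a' v' b') = tri (a * a') (a * v' + v * b') (b * b')"
  by (intro ext) (simp add: mm_def tri_def numeral_2_eq_2)

lemma tri_eq_iff: "tri a v b = tri a' v' b' \<longleftrightarrow> a = a' \<and> v = v' \<and> b = b'"
proof
  assume eq: "tri a v b = tri a' v' b'"
  have "tri a v b i j = tri a' v' b' i j" for i j by (simp only: eq)
  from this[of 0 0] this[of 0 1] this[of 1 1] show "a = a' \<and> v = v' \<and> b = b'" by (simp add: tri_def)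
qed simp

lemma tri_eq_0_iff: "tri a v b = 0 \<longleftrightarrow> a = 0 \<and> v = 0 \<and> b = 0"
  using tri_eq_iff[of a v b 0 0 0] by (simp only: tri_0)

text \<open>The quotient operations act on chosen representatives, which differ from the given
  elements by members of \<open>I\<close>; the ideal property puts the resulting error terms into
  \<open>I\<close>, where they do not change the coset.\<close>

lemma subrng_quot_preimage:
  assumes S: "subrng S (mat_rng_on m S)" and I: "rideal I (mat_rng_on m S)"
    and X: "subrng X (rquot (mat_rng_on m S) I)"
  shows "subrng {x \<in> S. rcoset (mat_rng_on m S) I x \<in> X} (mat_rng_on m S)"
proof -
  let ?R = "mat_rng_on m S" and ?c = "rcoset (mat_rng_on m S) I"
  have gS: "add_grp S" and mS: "\<And>x y. x \<in> S \<Longrightarrow> y \<in> S \<Longrightarrow> mm m x y \<in> S"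
    using S by (auto simp: subrng_mat_rng_on)
  have gI: "add_grp I" and IS: "I \<subseteq> S"
    using I by (auto simp: rideal_def subrng_mat_rng_on)
  have Im: "mm m x i \<in> I" "mm m i x \<in> I" if "x \<in> S" "i \<in> I" for x i
    using I that by (auto simp: rideal_def)
  have eq: "?c (x + i) = ?c x" if "i \<in> I" for x i
  proof (intro equalityI subsetI)
    fix y assume "y \<in> ?c (x + i)"
    then obtain j where "j \<in> I" "y = x + (i + j)" by (auto simp: rcoset_def add.assoc)
    then show "y \<in> ?c x" using add_grpD(4)[OF gI that] unfolding rcoset_def mat_rng_on_sel by blast
  next
    fix y assume "y \<in> ?c x"
    then obtain j where j: "j \<in> I" "y = x + j" by (auto simp: rcoset_def)
    have "y = x + i + (j - i)" using j(2) by (simp only: algebra_simps)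
    then show "y \<in> ?c (x + i)" using add_grpD(2)[OF gI j(1) that] unfolding rcoset_def mat_rng_on_sel by blast
  qed
  have rep: "\<exists>i\<in>I. rrep (?c x) = x + i" for x
  proof -
    have "x + 0 \<in> ?c x" unfolding rcoset_def mat_rng_on_sel using add_grpD(1)[OF gI] by blast
    then have "rrep (?c x) \<in> ?c x" by (rule rrep_in)
    then show ?thesis by (auto simp: rcoset_def)
  qed
  have I0: "?c 0 = I" by (simp only: rcoset_def mat_rng_on_sel add_0_left) simp
  have sel: "rzero (rquot ?R I) = I" "radd (rquot ?R I) Y Z = ?c (rrep Y + rrep Z)"
    "rmult (rquot ?R I) Y Z = ?c (mm m (rrep Y) (rrep Z))" "rneg (rquot ?R I) Y = ?c (- rrep Y)" for Y Z
    by (simp_all add: rquot_def)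
  have X0: "I \<in> X" and Xadd: "\<And>Y Z. Y \<in> X \<Longrightarrow> Z \<in> X \<Longrightarrow> ?c (rrep Y + rrep Z) \<in> X"
    and Xmul: "\<And>Y Z. Y \<in> X \<Longrightarrow> Z \<in> X \<Longrightarrow> ?c (mm m (rrep Y) (rrep Z)) \<in> X"
    and Xneg: "\<And>Y. Y \<in> X \<Longrightarrow> ?c (- rrep Y) \<in> X"
    using X unfolding subrng_def sel by blast+
  show ?thesis
    unfolding subrng_mat_rng_on
  proof (intro conjI ballI)
    show "add_grp {x \<in> S. ?c x \<in> X}"
    proof (rule add_grpI)
      show "0 \<in> {x \<in> S. ?c x \<in> X}" using add_grpD(1)[OF gS] X0 I0 by simp
      fix x assume "x \<in> {x \<in> S. ?c x \<in> X}"
      then have x: "x \<in> S" "?c x \<in> X" by auto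
      obtain i where i: "i \<in> I" "rrep (?c x) = x + i" using rep by blast
      have "- (x + i) = - x + (- i)" by simp
      then have "?c (- x) \<in> X" using Xneg[OF x(2)] eq[OF add_grpD(3)[OF gI i(1)], of "- x"] i(2) by (simp only:)
      then show "- x \<in> {x \<in> S. ?c x \<in> X}" using x add_grpD(3)[OF gS] by simp
      fix y assume "y \<in> {x \<in> S. ?c x \<in> X}"
      then have y: "y \<in> S" "?c y \<in> X" by auto
      obtain j where j: "j \<in> I" "rrep (?c y) = y + j" using rep by blast
      have "x + i + (y + j) = x + y + (i + j)" by (simp only: algebra_simps)
      then have "?c (x + y) \<in> X"
        using Xadd[OF x(2) y(2)] eq[OF add_grpD(4)[OF gI i(1) j(1)], of "x + y"] i(2) j(2) by (simp only:)
      then show "x + y \<in> {x \<in> S. ?c x \<in> X}" using x y add_grpD(4)[OF gS] by simp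
    qed
    fix x y assume "x \<in> {x \<in> S. ?c x \<in> X}" "y \<in> {x \<in> S. ?c x \<in> X}"
    then have x: "x \<in> S" "?c x \<in> X" and y: "y \<in> S" "?c y \<in> X" by auto
    obtain i where i: "i \<in> I" "rrep (?c x) = x + i" using rep by blast
    obtain j where j: "j \<in> I" "rrep (?c y) = y + j" using rep by blast
    have "y + j \<in> S" using add_grpD(4)[OF gS y(1)] j(1) IS by blast
    then have k: "mm m x j + mm m i (y + j) \<in> I"
      using add_grpD(4)[OF gI] Im(1)[OF x(1) j(1)] Im(2)[of "y + j" i] i(1) by blast
    have "mm m (x + i) (y + j) = mm m x y + (mm m x j + mm m i (y + j))"
      by (simp only: mm_add_left mm_add_right add_ac)
    then have "?c (mm m x y) \<in> X" using Xmul[OF x(2) y(2)] eq[OF k, of "mm m x y"] i(2) j(2) by (simp only:)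
    then show "mm m x y \<in> {x \<in> S. ?c x \<in> X}" using x y mS by simp
  qed auto
qed

context twosub
begin

definition TR :: "(nat \<Rightarrow> nat \<Rightarrow> 'k) set" where
  "TR = {tri a v b | a v b. a \<in> F \<and> b \<in> G}"

lemma TRI: "a \<in> F \<Longrightarrow> b \<in> G \<Longrightarrow> tri a v b \<in> TR"
  by (auto simp: TR_def)

lemma TRE: assumes "X \<in> TR" obtains a v b where "X = tri a v b" "a \<in> F" "b \<in> G"
  using assms by (auto simp: TR_def)

lemma tri_TR_iff: "tri a v b \<in> TR \<longleftrightarrow> a \<in> F \<and> b \<in> G"
  by (auto simp: TR_def tri_eq_iff)

lemma subrng_triI:
  assumes "\<And>X. X \<in> T \<Longrightarrow> \<exists>a v b. X = tri a v b \<and> a \<in> F \<and> b \<in> G" and "tri 0 0 0 \<in> T"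
    and "\<And>a v b a' v' b'. tri a v b \<in> T \<Longrightarrow> tri a' v' b' \<in> T \<Longrightarrow> tri (a - a') (v - v') (b - b') \<in> T"
    and "\<And>a v b a' v' b'. tri a v b \<in> T \<Longrightarrow> tri a' v' b' \<in> T \<Longrightarrow> tri (a * a') (a * v' + v * b') (b * b') \<in> T"
    and "T \<subseteq> R"
  shows "subrng T (mat_rng_on 2 R)"
  unfolding subrng_mat_rng_on add_grp_def
proof (intro conjI ballI assms(5))
  show "0 \<in> T" using assms(2) by (simp only: tri_0)
  fix X Y assume XY: "X \<in> T" "Y \<in> T"
  obtain a v b where X: "X = tri a v b" using assms(1)[OF XY(1)] by blast
  obtain a' v' b' where Y: "Y = tri a' v' b'" using assms(1)[OF XY(2)] by blast
  show "X - Y \<in> T" "mm 2 X Y \<in> T" using XY assms(3,4) unfolding X Y tri_diff tri_mm by blast+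
qed

lemma subrng_TR: "subrng TR (mat_rng_on 2 TR)"
proof (rule subrng_triI)
  show "\<exists>a v b. X = tri a v b \<and> a \<in> F \<and> b \<in> G" if "X \<in> TR" for X using that by (auto simp: TR_def)
qed (simp_all add: tri_TR_iff F.F_diff G.F_diff F.F_mult G.F_mult)

lemma subrng_triD:
  assumes "subrng T (mat_rng_on 2 TR)" "tri a v b \<in> T" "tri a' v' b' \<in> T"
  shows "tri (a - a') (v - v') (b - b') \<in> T" "tri (a + a') (v + v') (b + b') \<in> T"
    "tri (a * a') (a * v' + v * b') (b * b') \<in> T"
  using assms add_grpD(2,4)[of T "tri a v b" "tri a' v' b'"]
  by (auto simp: subrng_mat_rng_on tri_diff tri_add tri_mm[symmetric])

text \<open>The upper right entries of elements of \<open>T\<close> with zero diagonal are stable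
  under \<open>F\<close> and \<open>G\<close>, hence arbitrary by \<open>FG\<close>; they correct
  any element with the right diagonal, which \<open>proj\<close> supplies.\<close>

lemma TR_full:
  assumes T: "subrng T (mat_rng_on 2 TR)" and proj: "\<And>a b. a \<in> F \<Longrightarrow> b \<in> G \<Longrightarrow> \<exists>v. tri a v b \<in> T"
    and c: "tri 0 c 0 \<in> T" "c \<noteq> 0"
  shows "T = TR"
proof
  show "T \<subseteq> TR" using T by (auto simp: subrng_mat_rng_on)
  define Z where "Z = {c. tri 0 c 0 \<in> T}"
  have "Z = UNIV"
  proof (rule FG[where c = c])
    have "tri 0 0 0 \<in> T" using subrng_triD(1)[OF T c(1) c(1)] by simp
    then show "add_grp Z" using subrng_triD(1)[OF T, of 0 _ 0 0 _ 0] by (auto simp: Z_def add_grp_def)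
    fix x z assume x: "x \<in> F \<union> G" and z: "z \<in> Z"
    show "x * z \<in> Z"
    proof (cases "x \<in> F")
      case True
      then obtain v where "tri x v 0 \<in> T" using proj G.F_0 by blast
      from subrng_triD(3)[OF T this, of 0 z 0] z show ?thesis by (simp add: Z_def)
    next
      case False
      then obtain v where "tri 0 v x \<in> T" using proj F.F_0 x by blast
      from subrng_triD(3)[OF T _ this, of 0 z 0] z show ?thesis by (simp add: Z_def mult.commute)
    qed
  qed (use c in \<open>simp_all add: Z_def\<close>)
  then have Z: "tri 0 c 0 \<in> T" for c by (auto simp: Z_def)
  show "TR \<subseteq> T"
  proof
    fix X assume "X \<in> TR"
    then obtain a v b where X: "X = tri a v b" "a \<in> F" "b \<in> G" by (rule TRE)
    then obtain v' where "tri a v' b \<in> T" using proj by blast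
    from subrng_triD(2)[OF T this Z[of "v - v'"]] show "X \<in> T" by (simp add: X)
  qed
qed

text \<open>For each \<open>u\<close> the map \<open>(x, y) \<mapsto> tri x ((x - y) * u) y\<close> is a ring homomorphism, namely the
  diagonal embedding conjugated by a unipotent matrix.\<close>

lemma generating_conj:
  assumes gen: "generating a b" and T: "subrng T (mat_rng_on 2 TR)" and v: "tri a v b \<in> T"
    and xy: "x \<in> F" "y \<in> G"
  shows "\<exists>w. tri x w y \<in> T"
proof -
  \<comment> \<open>Chosen so that the pair \<open>(a, b)\<close> goes to the given element
    \<open>tri a v b\<close>.\<close>
  define u where "u = v / (a - b)"
  define S where "S = {(x, y). tri x ((x - y) * u) y \<in> T}"
  have "a - b \<noteq> 0" using generating_neq[OF gen] by simp
  then have "(a, b) \<in> S" using v by (simp add: S_def u_def)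
  moreover have "pclosed S"
    unfolding pclosed_def
  proof (intro allI impI conjI)
    fix x y x' y' assume "(x, y) \<in> S" "(x', y') \<in> S"
    then have *: "tri x ((x - y) * u) y \<in> T" "tri x' ((x' - y') * u) y' \<in> T" by (auto simp: S_def)
    show "(x - x', y - y') \<in> S" using subrng_triD(1)[OF T *] by (simp add: S_def algebra_simps)
    have "x * ((x' - y') * u) + (x - y) * u * y' = (x * x' - y * y') * u" by (simp add: algebra_simps)
    then show "(x * x', y * y') \<in> S" using subrng_triD(3)[OF T *] by (simp add: S_def)
  qed
  ultimately have "(x, y) \<in> S" using gen xy unfolding generating_def by blast
  then show ?thesis by (auto simp: S_def)
qed

lemma generating_full:
  assumes "generating a b" "subrng T (mat_rng_on 2 TR)" "tri a v b \<in> T" "tri 0 c 0 \<in> T" "c \<noteq> 0"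
  shows "T = TR"
  by (rule TR_full[OF assms(2) _ assms(4,5)]) (rule generating_conj[OF assms(1-3)])

text \<open>Any two members of \<open>?Y\<close> yield an element with diagonal
  \<open>(a, b)\<close> and a nonzero \<open>tri 0 c 0\<close>, so they generate the ring.\<close>

lemma sigma_TR_ge:
  assumes gen: "generating a b"
  shows "enat (card (UNIV :: 'k set) + 1) \<le> sigma (mat_rng_on 2 TR)"
proof -
  let ?Y = "insert (tri 0 1 0) ((\<lambda>v. tri a v b) ` UNIV)"
  have ab: "a \<in> F" "b \<in> G" "a \<noteq> b" using gen generating_neq by (auto simp: generating_def)
  have "card ((\<lambda>v. tri a v b) ` UNIV) = card (UNIV :: 'k set)"
    by (rule card_image) (simp add: inj_on_def tri_eq_iff)
  moreover have "tri 0 1 0 \<notin> (\<lambda>v. tri a v b) ` UNIV" using ab by (auto simp: tri_eq_iff)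
  ultimately have "card ?Y = card (UNIV :: 'k set) + 1" by simp
  moreover have "enat (card ?Y) \<le> sigma (mat_rng_on 2 TR)"
  proof (rule sigma_ge_card)
    show "?Y \<subseteq> rcarrier (mat_rng_on 2 TR)" using ab by (auto simp: tri_TR_iff)
    fix x y T assume xy: "x \<in> ?Y" "y \<in> ?Y" "x \<noteq> y" and T: "subrng T (mat_rng_on 2 TR)" "x \<in> T" "y \<in> T"
    have "\<exists>v c. tri a v b \<in> T \<and> tri 0 c 0 \<in> T \<and> c \<noteq> 0"
    proof (cases "x = tri 0 1 0 \<or> y = tri 0 1 0")
      case True
      then obtain v where "tri a v b \<in> T" using xy T by auto
      moreover have "tri 0 1 0 \<in> T" using True T by auto
      ultimately show ?thesis using one_neq_zero by blast
    next
      case False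
      then obtain v w where *: "x = tri a v b" "y = tri a w b" using xy by auto
      then have "tri 0 (v - w) 0 \<in> T" "v - w \<noteq> 0"
        using subrng_triD(1)[OF T(1), of a v b a w b] T xy(3) by (auto simp: tri_eq_iff)
      then show ?thesis using T * by blast
    qed
    then show "T = rcarrier (mat_rng_on 2 TR)" using generating_full[OF gen T(1)] by auto
  qed simp
  ultimately show ?thesis by simp
qed

text \<open>The rings \<open>Du u\<close> are the conjugates of the diagonal ring by unipotent
  matrices; they reach every element with distinct diagonal entries, and \<open>N\<close> takes the
  rest.\<close>

lemma sigma_TR_le: "sigma (mat_rng_on 2 TR) \<le> enat (card (UNIV :: 'k set) + 1)"
proof -
  define Du where "Du = (\<lambda>u. {tri a ((a - b) * u) b | a b. a \<in> F \<and> b \<in> G})"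
  define N where "N = {tri a v a | a v. a \<in> F \<and> a \<in> G}"
  have memD: "tri a v b \<in> Du u \<longleftrightarrow> a \<in> F \<and> b \<in> G \<and> v = (a - b) * u" for a v b u
    by (auto simp: Du_def tri_eq_iff)
  have Du: "subrng (Du u) (mat_rng_on 2 TR) \<and> Du u \<noteq> TR" for u
  proof
    show "subrng (Du u) (mat_rng_on 2 TR)"
    proof (rule subrng_triI)
      show "\<exists>a v b. X = tri a v b \<and> a \<in> F \<and> b \<in> G" if "X \<in> Du u" for X using that by (auto simp: Du_def)
      show "Du u \<subseteq> TR" by (auto simp: Du_def tri_TR_iff)
    qed (auto simp: memD F.F_diff G.F_diff F.F_mult G.F_mult, simp_all add: algebra_simps)
    have "tri 0 1 0 \<in> TR" "tri 0 1 0 \<notin> Du u" by (simp_all add: tri_TR_iff memD)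
    then show "Du u \<noteq> TR" by metis
  qed
  have memN: "tri a v b \<in> N \<longleftrightarrow> a \<in> F \<and> a \<in> G \<and> a = b" for a v b
    by (auto simp: N_def tri_eq_iff)
  have N: "subrng N (mat_rng_on 2 TR) \<and> N \<noteq> TR"
  proof
    show "subrng N (mat_rng_on 2 TR)"
    proof (rule subrng_triI)
      show "\<exists>a v b. X = tri a v b \<and> a \<in> F \<and> b \<in> G" if "X \<in> N" for X using that by (auto simp: N_def)
      show "N \<subseteq> TR" by (auto simp: N_def tri_TR_iff)
    qed (auto simp: memN F.F_diff G.F_diff F.F_mult G.F_mult)
    have "tri 1 0 0 \<in> TR" "tri 1 0 0 \<notin> N" by (simp_all add: tri_TR_iff memN)
    then show "N \<noteq> TR" by metis
  qed
  let ?C = "insert N (range Du)"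
  have "X \<in> \<Union> ?C" if "X \<in> TR" for X
  proof -
    obtain a v b where X: "X = tri a v b" "a \<in> F" "b \<in> G" using \<open>X \<in> TR\<close> by (rule TRE)
    show ?thesis
    proof (cases "a = b")
      case True then show ?thesis using X memN by auto
    next
      case False
      then have "X \<in> Du (v / (a - b))" using X by (simp add: memD)
      then show ?thesis by blast
    qed
  qed
  moreover have sub: "subrng T (mat_rng_on 2 TR) \<and> T \<noteq> TR" if "T \<in> ?C" for T
    using that Du N by (elim insertE rangeE) simp_all
  then have "\<Union> ?C \<subseteq> TR" unfolding subrng_mat_rng_on by blast
  ultimately have "\<Union> ?C = TR" by blast
  then have "is_cover ?C (mat_rng_on 2 TR)" using sub by (simp add: is_cover_def)
  then have "sigma (mat_rng_on 2 TR) \<le> enat (card ?C)" by (rule sigma_le) simp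
  also have "card ?C \<le> Suc (card (range Du))" by (rule card_insert_le_m1[of "Suc _", simplified]) simp
  also have "\<dots> \<le> card (UNIV :: 'k set) + 1" using card_image_le[of UNIV Du] by simp
  finally show ?thesis by simp
qed

text \<open>Multiplication by \<open>tri 0 1 0\<close> on either side moves a diagonal entry to the
  upper right.\<close>

lemma ideal_meets_corner:
  assumes I: "rideal I (mat_rng_on 2 TR)" "I \<noteq> {0}"
  shows "\<exists>c. c \<noteq> 0 \<and> tri 0 c 0 \<in> I"
proof -
  have "0 \<in> I" and IT: "I \<subseteq> TR" using I(1) add_grpD(1)[of I] by (auto simp: rideal_def subrng_mat_rng_on)
  then obtain X where X: "X \<in> I" "X \<noteq> 0" using I(2) by blast
  then obtain a v b where t: "X = tri a v b" using IT TRE by blast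
  have J: "tri 0 1 0 \<in> TR" by (simp add: tri_TR_iff)
  have "mm 2 X (tri 0 1 0) \<in> I" "mm 2 (tri 0 1 0) X \<in> I" using I(1) X(1) J by (auto simp: rideal_def)
  then have "tri 0 a 0 \<in> I" "tri 0 b 0 \<in> I" by (simp_all add: t tri_mm)
  moreover have "a \<noteq> 0 \<or> b \<noteq> 0 \<or> v \<noteq> 0" using X(2) by (auto simp: t tri_eq_0_iff)
  ultimately show ?thesis using X(1) t by (cases "a = 0 \<and> b = 0") auto
qed

text \<open>Some member of a cover of the quotient contains the class of \<open>tri a 0 b\<close>.
  Its preimage also contains \<open>I\<close>, hence some nonzero \<open>tri 0 c 0\<close>, and is
  the whole ring; so the quotient has no cover.\<close>

lemma sigma_elementary_TR:
  assumes gen: "generating a b"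
  shows "sigma_elementary (mat_rng_on 2 TR)"
  unfolding sigma_elementary_def
proof (intro allI impI)
  let ?R = "mat_rng_on 2 TR"
  fix I assume "rideal I ?R \<and> I \<noteq> {rzero ?R}"
  then have I: "rideal I ?R" "I \<noteq> {0}" by auto
  have gI: "add_grp I" using I(1) by (auto simp: rideal_def subrng_mat_rng_on)
  obtain c where c: "c \<noteq> 0" "tri 0 c 0 \<in> I" using ideal_meets_corner[OF I] by blast
  have ab: "tri a 0 b \<in> TR" using gen by (simp add: generating_def tri_TR_iff)
  have "\<infinity> \<le> sigma (rquot ?R I)"
  proof (rule sigma_geI)
    fix C assume "is_cover C (rquot ?R I)"
    then have CS: "\<And>X. X \<in> C \<Longrightarrow> subrng X (rquot ?R I) \<and> X \<noteq> rcarrier (rquot ?R I)"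
      and CU: "\<Union> C = rcarrier (rquot ?R I)" by (simp_all add: is_cover_def)
    have carr: "rcarrier (rquot ?R I) = rcoset ?R I ` TR" by (auto simp: rquot_def)
    have "rcoset ?R I (tri a 0 b) \<in> \<Union> C" unfolding CU carr using ab by blast
    then obtain X where X: "X \<in> C" "rcoset ?R I (tri a 0 b) \<in> X" by blast
    let ?T = "{x \<in> TR. rcoset ?R I x \<in> X}"
    have XS: "subrng X (rquot ?R I)" using CS X by blast
    have T: "subrng ?T ?R" by (rule subrng_quot_preimage[OF subrng_TR I(1) XS])
    have "rcoset ?R I (tri 0 c 0) = I"
    proof (intro equalityI subsetI)
      fix y assume "y \<in> rcoset ?R I (tri 0 c 0)"
      then show "y \<in> I" using add_grpD(4)[OF gI c(2)] by (auto simp: rcoset_def)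
    next
      fix y assume "y \<in> I"
      then have "y = tri 0 c 0 + (y - tri 0 c 0) \<and> y - tri 0 c 0 \<in> I" using add_grpD(2)[OF gI _ c(2)] by simp
      then show "y \<in> rcoset ?R I (tri 0 c 0)" unfolding rcoset_def mat_rng_on_sel by blast
    qed
    moreover have "I \<in> X" using XS by (simp add: subrng_def rquot_def)
    ultimately have "tri 0 c 0 \<in> ?T" by (simp add: tri_TR_iff)
    moreover have "tri a 0 b \<in> ?T" using X ab by simp
    ultimately have "?T = TR" using generating_full[OF gen T] c(1) by blast
    then have "rcoset ?R I ` TR \<subseteq> X" by blast
    moreover have "X \<subseteq> rcarrier (rquot ?R I)" using XS by (simp add: subrng_def)
    ultimately have "X = rcarrier (rquot ?R I)" unfolding carr by blast
    then show "\<infinity> \<le> enat (card C)" using CS X(1) by blast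
  qed
  moreover have "sigma ?R < \<infinity>" using order_le_less_trans[OF sigma_TR_le, of "\<infinity>"] by simp
  ultimately show "sigma ?R < sigma (rquot ?R I)" by simp
qed

end

text \<open>By the factorization \<open>x ^ 4 - x = x * (x - 1) * (x\<^sup>2 + x + 1)\<close>, the
  elements other than 0 and 1 are roots of the last factor.\<close>

lemma card_4_cases:
  fixes a b :: "'k::{finite,field}"
  assumes "card (UNIV :: 'k set) = 4" "CHAR('k) = 2" "\<And>x :: 'k. x ^ 4 = x"
  shows "x + x = (0 :: 'k)" and "a \<noteq> 0 \<Longrightarrow> a \<noteq> 1 \<Longrightarrow> a * a = a + 1"
    and "a \<noteq> 0 \<Longrightarrow> a \<noteq> 1 \<Longrightarrow> b = 0 \<or> b = 1 \<or> b = a \<or> b = a * a"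
proof -
  have "of_nat 2 = (0 :: 'k)" using assms(2) by (metis of_nat_CHAR)
  then have "(2 :: 'k) = 0" by simp
  then show two: "x + x = (0 :: 'k)" for x by (metis mult_2 mult_zero_left)
  have sq: "a * a = a + 1" if "a \<noteq> 0" "a \<noteq> 1" for a :: 'k
  proof -
    have "a * ((a - 1) * (a * a + a + 1)) = a ^ 4 - a" by (simp add: algebra_simps power_def numeral_eq_Suc)
    then have "a * ((a - 1) * (a * a + a + 1)) = 0" by (simp only: assms(3) diff_self)
    then have "a * a + (a + 1) = 0" using that by (simp add: add.assoc)
    then have "a * a = - (a + 1)" by (simp only: eq_neg_iff_add_eq_0)
    also have "\<dots> = a + 1" using two[of "a + 1"] by (metis add_eq_0_iff)
    finally show ?thesis .
  qed
  show "a \<noteq> 0 \<Longrightarrow> a \<noteq> 1 \<Longrightarrow> a * a = a + 1" by (rule sq)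
  show "b = 0 \<or> b = 1 \<or> b = a \<or> b = a * a" if a: "a \<noteq> 0" "a \<noteq> 1"
  proof (rule ccontr)
    assume b: "\<not> ?thesis"
    have "a * a \<noteq> 0" "a * a \<noteq> a" using a by auto
    moreover have "a * a \<noteq> 1" using sq[OF a] a(1) by simp
    ultimately have "card {b, 0, 1, a, a * a} = 5" using a b by (auto simp: card_insert_if)
    moreover have "card {b, 0, 1, a, a * a} \<le> card (UNIV :: 'k set)" by (rule card_mono) auto
    ultimately show False using assms(1) by simp
  qed
qed

section \<open>The exceptional orders 2 and 4\<close>

context twosub
begin

definition DR :: "(nat \<Rightarrow> nat \<Rightarrow> 'k) set" where
  "DR = {tri a 0 b | a b. a \<in> F \<and> b \<in> G}"

definition diag :: "(nat \<Rightarrow> nat \<Rightarrow> 'k) \<Rightarrow> nat \<Rightarrow> nat \<Rightarrow> 'k" where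
  "diag X = tri (X 0 0) 0 (X 1 1)"

definition radTR :: "(nat \<Rightarrow> nat \<Rightarrow> 'k) set" where
  "radTR = range (\<lambda>v. tri 0 v 0)"

lemma diag_tri: "diag (tri a v b) = tri a 0 b"
  by (simp add: diag_def tri_def[of a v b])

lemma tri_DR_iff: "tri a v b \<in> DR \<longleftrightarrow> a \<in> F \<and> v = 0 \<and> b \<in> G"
  by (auto simp: DR_def tri_eq_iff)

lemma diag_hom:
  "diag ` TR = DR" "X \<in> TR \<Longrightarrow> Y \<in> TR \<Longrightarrow> diag (X + Y) = diag X + diag Y"
  "X \<in> TR \<Longrightarrow> Y \<in> TR \<Longrightarrow> diag (mm 2 X Y) = mm 2 (diag X) (diag Y)"
proof -
  show "diag ` TR = DR"
  proof (intro equalityI subsetI)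
    fix X assume "X \<in> DR"
    then obtain a b where "X = diag (tri a 0 b)" "a \<in> F" "b \<in> G" by (auto simp: DR_def diag_tri)
    then show "X \<in> diag ` TR" using TRI by blast
  qed (auto elim!: TRE simp: diag_tri tri_DR_iff)
qed (auto elim!: TRE simp: diag_tri tri_add tri_mm)

lemma sigma_TR_le_DR: "sigma (mat_rng_on 2 TR) \<le> sigma (mat_rng_on 2 DR)"
proof (rule sigma_hom[where f = diag])
  show "diag (rneg (mat_rng_on 2 TR) x) = rneg (mat_rng_on 2 DR) (diag x)" if "x \<in> rcarrier (mat_rng_on 2 TR)" for x
    by (simp add: diag_def tri_minus)
  show "diag (rzero (mat_rng_on 2 TR)) = rzero (mat_rng_on 2 DR)"
    by (simp add: diag_def tri_0)
qed (use diag_hom subrng_TR in auto)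

text \<open>The diagonal ring is an image of the quotient by \<open>radTR\<close>, so that quotient
  has covering number at most that of the diagonal ring.\<close>

lemma not_sigma_elementary_TR:
  assumes "sigma (mat_rng_on 2 DR) \<le> sigma (mat_rng_on 2 TR)"
  shows "\<not> sigma_elementary (mat_rng_on 2 TR)"
proof
  assume e: "sigma_elementary (mat_rng_on 2 TR)"
  have sub: "radTR \<subseteq> TR" by (auto simp: radTR_def tri_TR_iff)
  have g: "add_grp radTR"
  proof (rule add_grpI)
    show "0 \<in> radTR" unfolding radTR_def using tri_0 by (metis rangeI)
    show "x + y \<in> radTR" if "x \<in> radTR" "y \<in> radTR" for x y
      using that by (auto simp: radTR_def tri_add)
    show "- x \<in> radTR" if "x \<in> radTR" for x using that by (auto simp: radTR_def tri_minus)
  qed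
  have m: "mm 2 X Y \<in> radTR" "mm 2 Y X \<in> radTR" if "X \<in> TR" "Y \<in> radTR" for X Y
    using that by (auto simp: radTR_def tri_mm elim!: TRE)
  have id: "rideal radTR (mat_rng_on 2 TR)"
    using sub g m by (auto simp: rideal_def subrng_mat_rng_on)
  have "tri 0 1 0 \<in> radTR" "tri 0 1 0 \<noteq> (0 :: nat \<Rightarrow> nat \<Rightarrow> 'k)" by (auto simp: radTR_def tri_eq_0_iff)
  then have "radTR \<noteq> {rzero (mat_rng_on 2 TR)}" unfolding mat_rng_on_sel by blast
  then have "sigma (mat_rng_on 2 TR) < sigma (rquot (mat_rng_on 2 TR) radTR)"
    using e id unfolding sigma_elementary_def by blast
  also have "\<dots> \<le> sigma (mat_rng_on 2 DR)"
  proof (rule sigma_quot_le[where h = diag])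
    show "diag x = 0" if "x \<in> radTR" for x using that by (auto simp: radTR_def diag_tri tri_0)
  qed (use diag_hom subrng_TR sub g in auto)
  finally show False using assms by simp
qed

lemma DR_cover:
  assumes "finite P" and cov: "\<And>a b. a \<in> F \<Longrightarrow> b \<in> G \<Longrightarrow> \<exists>S\<in>P. (a, b) \<in> S"
    and P: "\<And>S. S \<in> P \<Longrightarrow> pclosed S \<and> S \<subseteq> F \<times> G \<and> S \<noteq> F \<times> G"
  shows "sigma (mat_rng_on 2 DR) \<le> enat (card P)"
proof -
  define f where "f = (\<lambda>S. {tri a 0 b | a b. (a, b) \<in> (S :: ('k \<times> 'k) set)})"
  have mem: "tri a v b \<in> f S \<longleftrightarrow> v = 0 \<and> (a, b) \<in> S" for a v b S by (auto simp: f_def tri_eq_iff)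
  have sub: "subrng (f S) (mat_rng_on 2 DR) \<and> f S \<noteq> DR" if S: "S \<in> P" and ne: "S \<noteq> {}" for S
  proof
    have SP: "pclosed S" "S \<subseteq> F \<times> G" "S \<noteq> F \<times> G" using P[OF S] by auto
    obtain a b where ab: "(a, b) \<in> S" using ne by auto
    show "subrng (f S) (mat_rng_on 2 DR)"
    proof (rule subrng_triI)
      show "\<exists>a v b. X = tri a v b \<and> a \<in> F \<and> b \<in> G" if "X \<in> f S" for X using that SP(2) by (auto simp: f_def)
      show "f S \<subseteq> DR" using SP(2) by (auto simp: f_def tri_DR_iff)
    qed (use pclosedD[OF SP(1) ab] SP(1) in \<open>auto simp: mem pclosed_def\<close>)
    obtain a b where "a \<in> F" "b \<in> G" "(a, b) \<notin> S" using SP(2,3) by blast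
    then have "tri a 0 b \<in> DR" "tri a 0 b \<notin> f S" by (simp_all add: mem tri_DR_iff)
    then show "f S \<noteq> DR" by blast
  qed
  \<comment> \<open>The empty set satisfies \<open>pclosed\<close> but is no subring, so it is
    dropped.\<close>
  let ?C = "f ` (P - {{}})"
  have "X \<in> \<Union> ?C" if "X \<in> DR" for X
  proof -
    obtain a b where X: "X = tri a 0 b" "a \<in> F" "b \<in> G" using \<open>X \<in> DR\<close> by (auto simp: DR_def)
    then obtain S where "S \<in> P" "(a, b) \<in> S" using cov by blast
    then have "X \<in> f S" "S \<in> P - {{}}" using X by (auto simp: mem)
    then show ?thesis by blast
  qed
  moreover have sC: "subrng T (mat_rng_on 2 DR) \<and> T \<noteq> DR" if "T \<in> ?C" for T
    using that sub by (elim imageE) simp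
  then have "\<Union> ?C \<subseteq> DR" unfolding subrng_mat_rng_on by blast
  ultimately have "\<Union> ?C = DR" by blast
  then have "is_cover ?C (mat_rng_on 2 DR)" using sC by (simp add: is_cover_def)
  then have "sigma (mat_rng_on 2 DR) \<le> enat (card ?C)" by (rule sigma_le) (use assms(1) in simp)
  also have "card ?C \<le> card P"
    using card_image_le[of "P - {{}}" f] card_mono[OF assms(1), of "P - {{}}"] assms(1) by simp
  finally show ?thesis by simp
qed

text \<open>Over the field of order 2 the product is the union of the diagonal and the two axes. For
  the lower bound, \<open>?Y\<close> consists of two idempotents and their sum: any two give all
  three, and the product of the idempotents is \<open>tri 0 1 0\<close>.\<close>

lemma case_2:
  assumes q: "q1 = 2" "q2 = 2" and card: "card (UNIV :: 'k set) = 2"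
  shows "sigma (mat_rng_on 2 TR) = 3" "\<not> sigma_elementary (mat_rng_on 2 TR)"
proof -
  have FU: "F = UNIV" and GU: "G = UNIV"
    using card_subset_eq[of UNIV F] card_subset_eq[of UNIV G] F.card_F G.card_F q card by auto
  have mem: "x \<in> F" "x \<in> G" for x using FU GU by auto
  have "{0, 1 :: 'k} = UNIV" by (rule card_subset_eq) (use card in auto)
  then have two: "x = 0 \<or> x = 1" for x :: 'k by blast
  let ?P = "{{(a, b). a = b}, {(a, b). a = 0}, {(a, b). b = 0} :: ('k \<times> 'k) set}"
  have "sigma (mat_rng_on 2 DR) \<le> enat (card ?P)"
  proof (rule DR_cover)
    show "\<exists>S\<in>?P. (a, b) \<in> S" for a b using two[of a] two[of b] by auto
    show "pclosed S \<and> S \<subseteq> F \<times> G \<and> S \<noteq> F \<times> G" if "S \<in> ?P" for S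
    proof -
      have "pclosed S" using that by (auto simp: pclosed_def)
      moreover have "(1, 0) \<notin> S \<or> (0, 1) \<notin> S" using that by auto
      ultimately show ?thesis unfolding FU GU by auto
    qed
  qed simp
  moreover have "card ?P \<le> 3" by (simp add: card_insert_if)
  ultimately have up: "sigma (mat_rng_on 2 DR) \<le> 3"
    by (metis (no_types, lifting) enat_ord_simps(1) numeral_eq_enat order_trans)
  let ?Y = "{tri 1 0 0, tri 0 1 1, tri 1 1 1 :: nat \<Rightarrow> nat \<Rightarrow> 'k}"
  have "enat (card ?Y) \<le> sigma (mat_rng_on 2 TR)"
  proof (rule sigma_ge_card)
    show "?Y \<subseteq> rcarrier (mat_rng_on 2 TR)" by (simp add: tri_TR_iff mem)
    fix x y T assume xy: "x \<in> ?Y" "y \<in> ?Y" "x \<noteq> y" and T: "subrng T (mat_rng_on 2 TR)" "x \<in> T" "y \<in> T"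
    note D = subrng_triD[OF T(1)]
    have a: "tri 1 0 0 \<in> T \<and> tri 0 1 1 \<in> T"
      using xy T(2,3) D(1)[of 1 1 1 1 0 0] D(1)[of 1 1 1 0 1 1] by auto
    then have b: "tri 0 1 0 \<in> T" using D(3)[of 1 0 0 0 1 1] by simp
    have z: "tri 0 0 0 \<in> T" using D(1)[OF b b] by simp
    have o: "tri 1 1 1 \<in> T" using D(2)[of 1 0 0 0 1 1] a by simp
    have "T = TR"
    proof (rule TR_full[OF T(1) _ b])
      show "\<exists>v. tri a v b \<in> T" for a b
        using two[of a] two[of b] a z o by blast
    qed simp
    then show "T = rcarrier (mat_rng_on 2 TR)" by simp
  qed simp
  moreover have "card ?Y = 3" by (simp add: tri_eq_iff)
  ultimately have low: "3 \<le> sigma (mat_rng_on 2 TR)" by (simp add: numeral_eq_enat)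
  show "sigma (mat_rng_on 2 TR) = 3" using low up sigma_TR_le_DR by (meson antisym order_trans)
  show "\<not> sigma_elementary (mat_rng_on 2 TR)"
    by (rule not_sigma_elementary_TR) (use up low in \<open>rule order_trans\<close>)
qed

text \<open>Lower bound: four elements, any two of which generate the ring.\<close>

lemma case_4:
  assumes q: "q1 = 4" "q2 = 4" and card: "card (UNIV :: 'k set) = 4" and ch: "CHAR('k) = 2"
  shows "sigma (mat_rng_on 2 TR) = 4" "\<not> sigma_elementary (mat_rng_on 2 TR)"
proof -
  have FU: "F = UNIV" and GU: "G = UNIV"
    using card_subset_eq[of UNIV F] card_subset_eq[of UNIV G] F.card_F G.card_F q card by auto
  have mem: "x \<in> F" "x \<in> G" for x using FU GU by auto
  have p4: "x ^ 4 = x" for x :: 'k using Fq FU q by auto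
  note c4 = card_4_cases[OF card ch p4]
  have tw: "x + x = 0" for x :: 'k by (rule c4(1))
  have mi: "- x = x" for x :: 'k using tw[of x] by (metis add_eq_0_iff)
  have subadd: "x - y = x + y" for x y :: 'k using mi[of y] by (metis diff_conv_add_uminus)
  \<comment> \<open>If neither coordinate is 0 or 1, the coordinates are equal or the second is the
    square of the first; the last two sets are the graphs of the two field automorphisms.\<close>
  let ?P = "{{(a, b). a \<in> {0, 1}}, {(a, b). b \<in> {0, 1}}, {(a, b). b = a}, {(a, b). b = a * a} :: ('k \<times> 'k) set}"
  have "\<not> (UNIV :: 'k set) \<subseteq> {0, 1}" using card card_mono[of "{0, 1 :: 'k}" UNIV] by auto
  then obtain w :: 'k where w: "w \<noteq> 0" "w \<noteq> 1" by blast
  have "sigma (mat_rng_on 2 DR) \<le> enat (card ?P)"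
  proof (rule DR_cover)
    show "\<exists>S\<in>?P. (a, b) \<in> S" for a b using c4(3)[of a b] by auto
    show "pclosed S \<and> S \<subseteq> F \<times> G \<and> S \<noteq> F \<times> G" if "S \<in> ?P" for S
    proof -
      have "(a + b) * (a + b) = a * a + b * b + (a * b + a * b)" for a b :: 'k by (simp add: algebra_simps)
      then have sq: "(a + b) * (a + b) = a * a + b * b" for a b :: 'k by (simp add: tw)
      have "pclosed S"
        using that unfolding pclosed_def by (auto simp: subadd tw sq mult_ac)
      moreover have "(w, 0) \<notin> S \<or> (0, w) \<notin> S" using that w by auto
      ultimately show ?thesis unfolding FU GU by auto
    qed
  qed simp
  moreover have "card ?P \<le> 4" by (simp add: card_insert_if)
  ultimately have up: "sigma (mat_rng_on 2 DR) \<le> 4"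
    by (metis (no_types, lifting) enat_ord_simps(1) numeral_eq_enat order_trans)
  have ww: "w * w = w + 1" using c4(2) w by simp
  have ww1: "w * (w + 1) = 1" using ww tw[of w] by (simp add: distrib_left add.assoc[symmetric])
  have w2: "w + 1 \<noteq> 0" "w + 1 \<noteq> 1" using w mi[of 1] by (auto simp: add_eq_0_iff2)
  \<comment> \<open>A common criterion for all six pairs: the diagonals \<open>(0, 1)\<close>,
    \<open>(0, t)\<close> and \<open>(w, y)\<close> generate every diagonal, and
    \<open>tri 0 c 0\<close> does the rest.\<close>
  have full: "T = TR"
    if T: "subrng T (mat_rng_on 2 TR)" and c: "tri 0 c 0 \<in> T" "c \<noteq> 0"
      and e: "tri 0 v 1 \<in> T" and t: "tri 0 v' t \<in> T" "t \<noteq> 0" "t \<noteq> 1" and y: "tri w v'' y \<in> T"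
    for T c v v' t v'' y
  proof -
    note D = subrng_triD[OF T]
    define S where "S = {(a, b). \<exists>v. tri a v b \<in> T}"
    have S: "pclosed S" unfolding pclosed_def S_def using D(1,3) by blast
    note SD = pclosedD[OF S]
    have 1: "(0, 1) \<in> S" "(0, t) \<in> S" "(w, y) \<in> S" using e t y by (auto simp: S_def)
    have "(0, b) \<in> S" for b
      using c4(3)[OF t(2,3), of b] SD(5)[OF 1(1)] 1(1,2) SD(2)[OF 1(2,2)] by auto
    note r = this
    have l1: "(w, 0) \<in> S" using SD(1)[OF 1(3) r[of y]] by simp
    have l2: "(w * w, 0) \<in> S" using SD(2)[OF l1 l1] by simp
    have l3: "(1, 0) \<in> S" using SD(3)[OF l1 l2] tw[of w] by (simp add: ww add.assoc[symmetric])
    have l: "(a, 0) \<in> S" for a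
      using c4(3)[OF w, of a] SD(5)[OF 1(1)] l1 l2 l3 by auto
    have "(a, b) \<in> S" for a b using SD(3)[OF l[of a] r[of b]] by simp
    then show ?thesis using c by (intro TR_full[OF T _ c]) (simp add: S_def)
  qed
  let ?x1 = "tri w 0 1" and ?x2 = "tri 1 1 w" and ?x3 = "tri w 1 w" and ?x4 = "tri w 1 (w + 1)"
  let ?Y = "{?x1, ?x2, ?x3, ?x4}"
  have "enat (card ?Y) \<le> sigma (mat_rng_on 2 TR)"
  proof (rule sigma_ge_card)
    show "?Y \<subseteq> rcarrier (mat_rng_on 2 TR)" by (simp add: tri_TR_iff mem)
    fix x y T assume xy: "x \<in> ?Y" "y \<in> ?Y" "x \<noteq> y" and T: "subrng T (mat_rng_on 2 TR)" "x \<in> T" "y \<in> T"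
    note D = subrng_triD[OF T(1)]
    \<comment> \<open>The square of \<open>?x1\<close> minus \<open>?x1\<close> is
      \<open>tri 1 0 0\<close>, and its cube is the identity.\<close>
    have x1: "tri 1 0 0 \<in> T \<and> tri 0 0 1 \<in> T" if "?x1 \<in> T"
    proof -
      have a: "tri (w + 1) 0 1 \<in> T" using D(3)[OF that that] by (simp add: ww)
      then have "tri 1 0 0 \<in> T" using D(1)[OF a that] by simp
      moreover have "tri 1 0 1 \<in> T" using D(3)[OF that a] by (simp add: ww1)
      ultimately show ?thesis using D(1)[of 1 0 1 1 0 0] by simp
    qed
    \<comment> \<open>This is the square of \<open>?x2\<close> minus \<open>?x2\<close>.\<close>
    have x2: "tri 0 w 1 \<in> T" if "?x2 \<in> T"
    proof -
      have "tri 1 (1 + w) (w + 1) \<in> T" using D(3)[OF that that] by (simp add: ww)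
      from D(1)[OF this that] show ?thesis by simp
    qed
    have w11: "w + 1 + 1 = w" using tw[of 1] by (simp add: add.assoc)
    have 12: "T = TR" if "?x1 \<in> T" "?x2 \<in> T"
    proof -
      note x = x1[OF that(1)]
      have "tri 1 1 0 \<in> T" using D(3)[OF conjunct1[OF x] that(2)] by simp
      from D(1)[OF this conjunct1[OF x]] have c: "tri 0 1 0 \<in> T" by simp
      have "tri 0 0 w \<in> T" using D(3)[OF conjunct2[OF x] that(2)] by simp
      from full[OF T(1) c _ conjunct2[OF x] this w that(1)] show ?thesis by simp
    qed
    have 13: "T = TR" if "?x1 \<in> T" "tri w 1 t \<in> T" "t \<noteq> 0" "t \<noteq> 1" for t
    proof -
      note x = x1[OF that(1)]
      have a: "tri w 1 0 \<in> T" using D(3)[OF conjunct1[OF x] that(2)] by simp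
      have b: "tri w 0 0 \<in> T" using D(3)[OF conjunct1[OF x] that(1)] by simp
      from D(1)[OF a b] have c: "tri 0 1 0 \<in> T" by simp
      have "tri 0 0 t \<in> T" using D(3)[OF conjunct2[OF x] that(2)] by simp
      from full[OF T(1) c _ conjunct2[OF x] this that(3,4) that(1)] show ?thesis by simp
    qed
    have 23: "T = TR" if "?x2 \<in> T" "?x3 \<in> T"
    proof -
      note e = x2[OF that(1)]
      have a: "tri 0 w w \<in> T" using D(3)[OF that(2) e] by (simp add: ww w11)
      have b: "tri 0 (w + 1) w \<in> T" using D(3)[OF e that(2)] by (simp add: ww)
      from D(1)[OF b a] have c: "tri 0 1 0 \<in> T" by simp
      from full[OF T(1) c _ e a w that(2)] show ?thesis by simp
    qed
    have 24: "T = TR" if "?x2 \<in> T" "?x4 \<in> T"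
    proof -
      note e = x2[OF that(1)]
      have a: "tri 0 w (w + 1) \<in> T" using D(3)[OF that(2) e] by (simp add: ww w11)
      have b: "tri 0 1 (w + 1) \<in> T" using D(3)[OF e that(2)] by (simp add: ww1)
      from D(1)[OF b a] have c: "tri 0 (1 - w) 0 \<in> T" by simp
      from full[OF T(1) c _ e a w2 that(2)] show ?thesis using w(2) by simp
    qed
    have 34: "T = TR" if "?x3 \<in> T" "?x4 \<in> T"
    proof -
      have e: "tri 0 0 1 \<in> T" using D(1)[OF that(2,1)] by simp
      have a: "tri 0 1 w \<in> T" using D(3)[OF that(1) e] by simp
      have b: "tri 0 0 w \<in> T" using D(3)[OF e that(1)] by simp
      from D(1)[OF a b] have c: "tri 0 1 0 \<in> T" by simp
      from full[OF T(1) c _ e b w that(1)] show ?thesis by simp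
    qed
    have "T = TR" using xy T(2,3) 12 13[OF _ _ w] 13[OF _ _ w2] 23 24 34 by auto
    then show "T = rcarrier (mat_rng_on 2 TR)" by simp
  qed simp
  moreover have "card ?Y = 4" using w by (simp add: tri_eq_iff card_insert_if)
  ultimately have low: "4 \<le> sigma (mat_rng_on 2 TR)" by (simp add: numeral_eq_enat)
  show "sigma (mat_rng_on 2 TR) = 4" using low up sigma_TR_le_DR by (meson antisym order_trans)
  show "\<not> sigma_elementary (mat_rng_on 2 TR)"
    by (rule not_sigma_elementary_TR) (use up low in \<open>rule order_trans\<close>)
qed

end

section \<open>Assembly of the cases\<close>

lemma A_rng_1_eq:
  assumes "twosub F G q1 q2 g1 g2" "F = subfield_of_order q1" "G = subfield_of_order q2"
  shows "A_rng 1 q1 q2 = mat_rng_on 2 (twosub.TR F G)"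
proof -
  interpret twosub F G q1 q2 g1 g2 by fact
  have "{M. (\<forall>i j. (i > 1 \<or> j > 1) \<longrightarrow> M i j = 0) \<and> (\<forall>i<1. \<forall>j<1. M i j \<in> F) \<and> (\<forall>j<1. M 1 j = 0) \<and> M 1 1 \<in> G} = TR"
    (is "?A = TR")
  proof (intro equalityI subsetI)
    fix X assume X: "X \<in> ?A"
    have "X i j = tri (X 0 0) (X 0 1) (X 1 1) i j" for i j
    proof -
      consider "i > 1" | "j > 1" | "i = 0" "j = 0" | "i = 0" "j = 1" | "i = 1" "j = 0" | "i = 1" "j = 1"
        by linarith
      then show ?thesis using X by cases (auto simp: tri_def)
    qed
    then have eq: "X = tri (X 0 0) (X 0 1) (X 1 1)" by (intro ext)
    have "tri (X 0 0) (X 0 1) (X 1 1) \<in> TR" using X by (intro TRI) auto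
    then show "X \<in> TR" by (simp only: eq[symmetric])
  next
    fix X assume "X \<in> TR"
    then obtain a v b where "X = tri a v b" "a \<in> F" "b \<in> G" by (rule TRE)
    then show "X \<in> ?A" by (auto simp: tri_def)
  qed
  then show ?thesis unfolding A_rng_def assms(2,3) one_add_one by simp
qed

lemma A_rng_1:
  fixes p d1 d2 :: nat
  assumes p: "prime p" and d12: "d1 \<ge> 1" "d2 \<ge> 1" and card: "card (UNIV :: 'k::{finite,field} set) = p ^ lcm d1 d2"
  defines "R \<equiv> A_rng 1 (p^d1) (p^d2) :: (nat \<Rightarrow> nat \<Rightarrow> 'k) rng_struct"
  shows "(p^d1, p^d2) = (2, 2) \<Longrightarrow> sigma R = 3 \<and> \<not> sigma_elementary R"
    and "(p^d1, p^d2) = (4, 4) \<Longrightarrow> sigma R = 4 \<and> \<not> sigma_elementary R"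
    and "(p^d1, p^d2) \<noteq> (2, 2) \<Longrightarrow> (p^d1, p^d2) \<noteq> (4, 4) \<Longrightarrow>
      sigma R = enat (p ^ lcm d1 d2 + 1) \<and> sigma_elementary R"
proof -
  define F G where "F = (subfield_of_order (p ^ d1) :: 'k set)" and "G = (subfield_of_order (p ^ d2) :: 'k set)"
  have F: "fsub F (p ^ d1)" and G: "fsub G (p ^ d2)"
    unfolding F_def G_def using fsub_subfield_of_order[OF card p] d12 by auto
  obtain g1 where g1: "F = insert 0 {g1 ^ i | i::nat. True}" "g1 \<noteq> 0"
    using subfield_of_order_props(2)[OF card p _ d12(1) refl] unfolding F_def by auto
  obtain g2 where g2: "G = insert 0 {g2 ^ i | i::nat. True}" "g2 \<noteq> 0"
    using subfield_of_order_props(2)[OF card p _ d12(2) refl] unfolding G_def by auto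
  interpret twosub F G "p ^ d1" "p ^ d2" g1 g2
    by (rule twosub.intro[OF F G _ _ g1 g2])
      (use subfields_span[OF p card d12 F G] in \<open>auto simp: F_def G_def subfield_of_order_def\<close>)
  have R: "R = mat_rng_on 2 TR" unfolding R_def by (rule A_rng_1_eq[OF twosub_axioms F_def G_def])
  \<comment> \<open>In the exceptional cases the exponents agree, so the ambient field itself has
    order 2 or 4.\<close>
  have lcm: "d1 = d2" if "p ^ d1 = p ^ d2" using that prime_gt_1_nat[OF p] by (simp add: power_inject_exp)
  show "sigma R = 3 \<and> \<not> sigma_elementary R" if "(p^d1, p^d2) = (2, 2)"
    using case_2 that lcm card by (simp add: R)
  show "sigma R = 4 \<and> \<not> sigma_elementary R" if q: "(p^d1, p^d2) = (4, 4)"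
  proof -
    have c: "card (UNIV :: 'k set) = 4" using q lcm card by simp
    have "p dvd 2 ^ 2" using q d12(1) dvd_power[of d1 p] by simp
    then have "p = 2" using p by (metis prime_dvd_power primes_dvd_imp_eq two_is_prime_nat)
    then show ?thesis using case_4 q c CHAR_finite_field[OF card p] by (simp add: R)
  qed
  assume "(p^d1, p^d2) \<noteq> (2, 2)" "(p^d1, p^d2) \<noteq> (4, 4)"
  then obtain a b where "generating a b" using generating_exists[OF twosub_axioms] by blast
  then show "sigma R = enat (p ^ lcm d1 d2 + 1) \<and> sigma_elementary R"
    using sigma_TR_ge sigma_TR_le sigma_elementary_TR unfolding R card[symmetric] by (blast intro: antisym)
qed

theorem theorem3p5:
  fixes p d1 d2 n d :: nat
  assumes "prime p" and "d1 \<ge> 1" and "d2 \<ge> 1" and "n \<ge> 1"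
    and "card (UNIV :: 'k set) = p ^ lcm d1 d2"
    and "p ^ lcm d1 d2 = (p ^ d1) ^ d"
  shows
   "(n = 1 \<longrightarrow>
      (sigma_elementary (A_rng n (p^d1) (p^d2) :: (nat \<Rightarrow> nat \<Rightarrow> 'k::{finite,field}) rng_struct)
         \<longleftrightarrow> (p^d1, p^d2) \<noteq> (2, 2) \<and> (p^d1, p^d2) \<noteq> (4, 4)) \<and>
      ((p^d1, p^d2) = (2, 2) \<longrightarrow>
         sigma (A_rng n (p^d1) (p^d2) :: (nat \<Rightarrow> nat \<Rightarrow> 'k) rng_struct) = 3) \<and>
      ((p^d1, p^d2) = (4, 4) \<longrightarrow>
         sigma (A_rng n (p^d1) (p^d2) :: (nat \<Rightarrow> nat \<Rightarrow> 'k) rng_struct) = 4) \<and>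
      ((p^d1, p^d2) \<noteq> (2, 2) \<and> (p^d1, p^d2) \<noteq> (4, 4) \<longrightarrow>
         sigma (A_rng n (p^d1) (p^d2) :: (nat \<Rightarrow> nat \<Rightarrow> 'k) rng_struct)
           = enat (p ^ lcm d1 d2 + 1)))
    \<and> (n \<ge> 2 \<and> d \<ge> n - n div smallest_prime_divisor n \<longrightarrow>
        \<not> sigma_elementary (A_rng n (p^d1) (p^d2) :: (nat \<Rightarrow> nat \<Rightarrow> 'k) rng_struct) \<and>
        sigma (A_rng n (p^d1) (p^d2) :: (nat \<Rightarrow> nat \<Rightarrow> 'k) rng_struct)
          = sigma (full_mat n (p^d1) :: (nat \<Rightarrow> nat \<Rightarrow> 'k) rng_struct))
    \<and> (n = 2 \<longrightarrow>
        \<not> sigma_elementary (A_rng n (p^d1) (p^d2) :: (nat \<Rightarrow> nat \<Rightarrow> 'k) rng_struct))"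
proof (intro conjI impI)
  let ?R = "A_rng n (p^d1) (p^d2) :: (nat \<Rightarrow> nat \<Rightarrow> 'k) rng_struct"
  note one = A_rng_1[OF assms(1,2,3,5)]
  note two = A_rng_ge_2[OF assms(1,2,3,5,6)]
  show "sigma_elementary ?R \<longleftrightarrow> (p^d1, p^d2) \<noteq> (2, 2) \<and> (p^d1, p^d2) \<noteq> (4, 4)" if "n = 1"
    using one that by blast
  show "sigma ?R = 3" if "n = 1" "(p^d1, p^d2) = (2, 2)" using one(1) that by blast
  show "sigma ?R = 4" if "n = 1" "(p^d1, p^d2) = (4, 4)" using one(2) that by blast
  show "sigma ?R = enat (p ^ lcm d1 d2 + 1)" if "n = 1" "(p^d1, p^d2) \<noteq> (2, 2) \<and> (p^d1, p^d2) \<noteq> (4, 4)"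
    using one(3) that by blast
  show "\<not> sigma_elementary ?R" "sigma ?R = sigma (full_mat n (p^d1) :: (nat \<Rightarrow> nat \<Rightarrow> 'k) rng_struct)"
    if "n \<ge> 2 \<and> d \<ge> n - n div smallest_prime_divisor n" using two that by blast+
  show "\<not> sigma_elementary ?R" if n: "n = 2"
  proof -
    have "{a :: nat. prime a \<and> a dvd 2} = {2}"
      by (auto simp: primes_dvd_imp_eq)
    then have "smallest_prime_divisor n = 2" by (simp add: smallest_prime_divisor_def n)
    \<comment> \<open>For \<open>n = 2\<close> the number \<open>n - n div 2\<close> is 1, so the
      condition on \<open>d\<close> is just \<open>d \<ge> 1\<close>.\<close>
    moreover have "d \<noteq> 0"
    proof
      assume "d = 0"
      then have "p ^ lcm d1 d2 = 1" using assms(6) by simp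
      then show False using assms(1,2,3) by (simp add: lcm_eq_0_iff)
    qed
    ultimately show ?thesis using two[of n] n by simp
  qed
qed

end
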